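(* There is an algorithm that, given a positive integer $k$ and a rooted digraph $D=(V+r,A)$ with $n$ vertices, decides in time $2^{O(k^2 \log k)}\cdot n^{O(1)}$ whether $D$ contains two arc-disjoint spanning $(r,k)$-flow branchings, and, if they exist, computes two such arc-disjoint spanning $(r,k)$-flow branchings within the same running time. In particular, this decision problem is fixed-parameter tractable with parameter $k$.
   Context: Digraphs are loopless but may have parallel arcs. A rooted digraph $D=(V+r,A)$ is a digraph with vertex set $V\cup\{r\}$ and a special vertex $r$ (the root) of in-degree $0$. For a digraph and a vertex set $Y$, $\delta^+(Y)$ and $\delta^-(Y)$ are the sets of arcs leaving and entering $Y$. A flow in a digraph with arc set $A'$ is a function $\mathbf z:A'\to\mathbb Z_{\ge 0}$; for a set of arcs $F$, $\mathbf z(F)=\sum_{a\in F}\mathbf z(a)$. Given a rooted digraph $X=(V'+r,A')$ with $N$ vertices and a positive integer $k$, an $(r,k)$-branching flow in $X$ is a flow $\mathbf z$ with $\mathbf z(a)\le N-k$ for all $a\in A'$, $\mathbf z(\delta^+(r))-\mathbf z(\delta^-(r))=N-1$, and $\mathbf z(\delta^-(v))-\mathbf z(\delta^+(v))=1$ for all $v\in V'$. $X$ is an $(r,k)$-flow branching if it admits an $(r,k)$-branching flow. An $(r,k)$-flow branching that is a subdigraph of $D$ is spanning if it has the same vertex set as $D$. A problem is fixed-parameter tractable with parameter $k$ if it can be solved in time $f(k)\cdot |I|^{c}$ for a computable $f$ and constant $c$. *)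

theory Defs
  imports
    "Graph_Theory.Digraph_Component"
    "Graph_Theory.Digraph_Isomorphism"
    "HOL-Library.Landau_Symbols"
    "HOL-Library.Log_Nat"
begin

locale rooted_digraph = fin_digraph D + loopfree_digraph D
  for D :: "('a, 'b) pre_digraph" +
  fixes r :: 'a
  assumes root_in_verts: "r \<in> verts D"
    and in_degree_root: "in_degree D r = 0"

text \<open>
  The capacity bound is stated over the integers: for \<open>k\<close> larger than the number of
  vertices the capacity is negative, and no arc can satisfy it.
\<close>

definition branching_flow ::
  "('a, 'b) pre_digraph \<Rightarrow> 'a \<Rightarrow> nat \<Rightarrow> ('b \<Rightarrow> nat) \<Rightarrow> bool"
where
  "branching_flow X r k z \<longleftrightarrow>
     (\<forall>a \<in> arcs X. int (z a) \<le> int (card (verts X)) - int k) \<and>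
     int (sum z (out_arcs X r)) - int (sum z (in_arcs X r)) = int (card (verts X)) - 1 \<and>
     (\<forall>v \<in> verts X - {r}. int (sum z (in_arcs X v)) - int (sum z (out_arcs X v)) = 1)"

definition flow_branching :: "('a, 'b) pre_digraph \<Rightarrow> 'a \<Rightarrow> nat \<Rightarrow> bool" where
  "flow_branching X r k \<longleftrightarrow> rooted_digraph X r \<and> (\<exists>z. branching_flow X r k z)"

definition disjoint_spanning_flow_branchings ::
  "('a, 'b) pre_digraph \<Rightarrow> 'a \<Rightarrow> nat \<Rightarrow> ('a, 'b) pre_digraph \<Rightarrow> ('a, 'b) pre_digraph \<Rightarrow> bool"
where
  "disjoint_spanning_flow_branchings D r k X Y \<longleftrightarrow>
     spanning X D \<and> flow_branching X r k \<and>
     spanning Y D \<and> flow_branching Y r k \<and>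
     arcs X \<inter> arcs Y = {}"

text \<open>
  A random access machine with structured control flow. The memory consists of named arrays of
  natural numbers, of which a program mentions only finitely many; a scalar variable is cell 0
  of an array. Addition and truncated subtraction are the only arithmetic operations, so that
  in \<open>t\<close> steps a program can enlarge the bit length of the numbers in memory
  only by \<open>O(t)\<close>. The uniform cost measure is therefore polynomially related to the
  running time of Turing machines.
\<close>

datatype exp =
    Const nat
  | Cell string exp
  | Plus exp exp
  | Minus exp exp

datatype com =
    Skip
  | Store string exp exp
  | Seq com com
  | If exp com com
  | While exp com

type_synonym memory = "string \<Rightarrow> nat \<Rightarrow> nat"

primrec exp_val :: "exp \<Rightarrow> memory \<Rightarrow> nat" where
  "exp_val (Const c) s = c"
| "exp_val (Cell x e) s = s x (exp_val e s)"
| "exp_val (Plus e1 e2) s = exp_val e1 s + exp_val e2 s"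
| "exp_val (Minus e1 e2) s = exp_val e1 s - exp_val e2 s"

primrec exp_cost :: "exp \<Rightarrow> nat" where
  "exp_cost (Const c) = 1"
| "exp_cost (Cell x e) = 1 + exp_cost e"
| "exp_cost (Plus e1 e2) = 1 + exp_cost e1 + exp_cost e2"
| "exp_cost (Minus e1 e2) = 1 + exp_cost e1 + exp_cost e2"

text \<open>
  \<open>exec c s t s'\<close>: started in memory \<open>s\<close>, program \<open>c\<close> halts after time \<open>t\<close> in
  memory \<open>s'\<close>. A guard holds iff its value is nonzero.
\<close>

inductive exec :: "com \<Rightarrow> memory \<Rightarrow> nat \<Rightarrow> memory \<Rightarrow> bool" where
  Skip: "exec Skip s 1 s"
| Store: "exec (Store x i e) s (1 + exp_cost i + exp_cost e)
    (s(x := (s x)(exp_val i s := exp_val e s)))"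
| Seq: "exec c1 s1 t1 s2 \<Longrightarrow> exec c2 s2 t2 s3 \<Longrightarrow> exec (Seq c1 c2) s1 (t1 + t2) s3"
| IfTrue: "exp_val b s \<noteq> 0 \<Longrightarrow> exec c1 s t s' \<Longrightarrow>
    exec (If b c1 c2) s (1 + exp_cost b + t) s'"
| IfFalse: "exp_val b s = 0 \<Longrightarrow> exec c2 s t s' \<Longrightarrow>
    exec (If b c1 c2) s (1 + exp_cost b + t) s'"
| WhileFalse: "exp_val b s = 0 \<Longrightarrow> exec (While b c) s (1 + exp_cost b) s"
| WhileTrue: "exp_val b s1 \<noteq> 0 \<Longrightarrow> exec c s1 t1 s2 \<Longrightarrow> exec (While b c) s2 t2 s3 \<Longrightarrow>
    exec (While b c) s1 (1 + exp_cost b + t1 + t2) s3"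

inductive_cases exec_elims:
  "exec Skip s t s'" "exec (Store x i e) s t s'" "exec (Seq c1 c2) s t s'"
  "exec (If b c1 c2) s t s'" "exec (While b c) s t s'"

lemma exec_deterministic:
  "exec c s t s' \<Longrightarrow> exec c s u s'' \<Longrightarrow> u = t \<and> s'' = s'"
proof (induction arbitrary: u s'' rule: exec.induct)
  case (Skip s)
  then show ?case by (auto elim: exec_elims)
next
  case (Store x i e s)
  then show ?case by (auto elim: exec_elims)
next
  case (Seq c1 s1 t1 s2 c2 t2 s3)
  from Seq.prems obtain u1 u2 w where "exec c1 s1 u1 w" "exec c2 w u2 s''" "u = u1 + u2"
    by (auto elim: exec_elims)
  with Seq.IH show ?case by blast
next
  case (IfTrue b s c1 t s' c2)
  from IfTrue.prems IfTrue.hyps(1) obtain v where "exec c1 s v s''" "u = 1 + exp_cost b + v"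
    by (auto elim: exec_elims)
  with IfTrue.IH show ?case by blast
next
  case (IfFalse b s c2 t s' c1)
  from IfFalse.prems IfFalse.hyps(1) obtain v where "exec c2 s v s''" "u = 1 + exp_cost b + v"
    by (auto elim: exec_elims)
  with IfFalse.IH show ?case by blast
next
  case (WhileFalse b s c)
  then show ?case by (auto elim: exec_elims)
next
  case (WhileTrue b s1 c t1 s2 t2 s3)
  from WhileTrue.prems WhileTrue.hyps(1) obtain u1 u2 w where
    "exec c s1 u1 w" "exec (While b c) w u2 s''" "u = 1 + exp_cost b + u1 + u2"
    by (auto elim: exec_elims(5))
  with WhileTrue.IH show ?case by blast
qed

text \<open>
  The input is the array \<open>in\<close> and the output the array \<open>out\<close>. A list is stored in an
  array as its length in cell 0, followed by its entries.
\<close>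

definition initial_memory :: "nat list \<Rightarrow> memory" where
  "initial_memory xs = (\<lambda>x i. if x = ''in'' \<and> i \<le> length xs then (length xs # xs) ! i else 0)"

definition output_of :: "memory \<Rightarrow> nat list" where
  "output_of s = map (\<lambda>i. s ''out'' (Suc i)) [0..<s ''out'' 0]"

definition runs :: "com \<Rightarrow> nat list \<Rightarrow> nat \<Rightarrow> nat list \<Rightarrow> bool" where
  "runs p xs t ys \<longleftrightarrow> (\<exists>s. exec p (initial_memory xs) t s \<and> output_of s = ys)"

definition computable_fun :: "(nat \<Rightarrow> nat) \<Rightarrow> bool" where
  "computable_fun f \<longleftrightarrow> (\<exists>p. \<forall>x. \<exists>t. runs p [x] t [f x])"

text \<open>Number of bits, with one extra bit per entry as separator.\<close>

definition input_size :: "nat list \<Rightarrow> nat" where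
  "input_size xs = (\<Sum>x\<leftarrow>xs. Suc (floorlog 2 x))"

text \<open>A problem is given by its set of instances, its parameter and its set of yes-instances.\<close>

definition fixed_parameter_tractable ::
  "nat list set \<Rightarrow> (nat list \<Rightarrow> nat) \<Rightarrow> nat list set \<Rightarrow> bool"
where
  "fixed_parameter_tractable I par L \<longleftrightarrow>
     (\<exists>p f c. computable_fun f \<and>
        (\<forall>x \<in> I. \<exists>t. runs p x t [if x \<in> L then 1 else 0] \<and>
            t \<le> f (par x) * input_size x ^ c))"

text \<open>
  The digraph on \<open>{0, \<dots>, n - 1}\<close> with \<open>m u v\<close> parallel arcs \<open>(u, v, 0), (u, v, 1), \<dots>\<close>
  from \<open>u\<close> to \<open>v\<close>. By the lemma below this is a normal form for finite digraphs.
\<close>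

definition multi_digraph ::
  "nat \<Rightarrow> (nat \<Rightarrow> nat \<Rightarrow> nat) \<Rightarrow> (nat, nat \<times> nat \<times> nat) pre_digraph"
where
  "multi_digraph n m =
     \<lparr>verts = {..<n},
      arcs = {(u, v, i). u < n \<and> v < n \<and> i < m u v},
      tail = (\<lambda>(u, v, i). u),
      head = (\<lambda>(u, v, i). v)\<rparr>"

lemma fin_digraph_iso_multi_digraph:
  assumes "fin_digraph G"
  shows "\<exists>m. digraph_iso G (multi_digraph (card (verts G)) m)"
proof -
  interpret fin_digraph G by fact
  obtain h where h: "bij_betw h (verts G) {..<card (verts G)}"
    using ex_bij_betw_finite_nat[OF finite_verts] by (auto simp: atLeast0LessThan)
  define A where "A u v = {a \<in> arcs G. h (tail G a) = u \<and> h (head G a) = v}" for u v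
  have "\<exists>e. bij_betw e (A u v) {..<card (A u v)}" for u v
    using ex_bij_betw_finite_nat[of "A u v"] by (auto simp: atLeast0LessThan A_def)
  then obtain e where e: "\<And>u v. bij_betw (e u v) (A u v) {..<card (A u v)}"
    by metis
  define g where "g a = (h (tail G a), h (head G a), e (h (tail G a)) (h (head G a)) a)" for a
  define f where "f = \<lparr>iso_verts = h, iso_arcs = g,
    iso_head = (\<lambda>(u, v, i). v), iso_tail = (\<lambda>(u, v, i). u)\<rparr>"
  have h_less: "h v < card (verts G)" if "v \<in> verts G" for v
    using bij_betwE[OF h] that by auto
  have "inj_on g (arcs G)"
  proof (rule inj_onI)
    fix a b assume ab: "a \<in> arcs G" "b \<in> arcs G" "g a = g b"
    let ?u = "h (tail G a)" and ?v = "h (head G a)"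
    have "a \<in> A ?u ?v" "b \<in> A ?u ?v" "e ?u ?v a = e ?u ?v b"
      using ab by (auto simp: g_def A_def)
    then show "a = b" using e[of ?u ?v] by (auto simp: bij_betw_def inj_on_def)
  qed
  then have "digraph_isomorphism f"
    using h wf_digraph by (auto simp: digraph_isomorphism_def f_def bij_betw_def g_def)
  moreover have "g ` arcs G =
      {(u, v, i). u < card (verts G) \<and> v < card (verts G) \<and> i < card (A u v)}"
  proof (intro subset_antisym subsetI)
    fix x assume "x \<in> g ` arcs G"
    then obtain a where a: "a \<in> arcs G" "x = g a" by auto
    then have "a \<in> A (h (tail G a)) (h (head G a))" by (auto simp: A_def)
    with e have "e (h (tail G a)) (h (head G a)) a < card (A (h (tail G a)) (h (head G a)))"
      by (auto dest: bij_betwE)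
    with a h_less show "x \<in> {(u, v, i). u < card (verts G) \<and> v < card (verts G) \<and> i < card (A u v)}"
      by (auto simp: g_def)
  next
    fix x assume "x \<in> {(u, v, i). u < card (verts G) \<and> v < card (verts G) \<and> i < card (A u v)}"
    then obtain u v i where x: "x = (u, v, i)" "i < card (A u v)" by auto
    then have "i \<in> e u v ` A u v" using e[of u v] by (auto simp: bij_betw_def)
    then obtain a where "a \<in> A u v" "e u v a = i" by auto
    with x show "x \<in> g ` arcs G" by (auto simp: A_def g_def)
  qed
  ultimately show ?thesis
    using h unfolding digraph_iso_def
    by (intro exI[of _ "\<lambda>u v. card (A u v)"] exI[of _ f])
       (auto simp: app_iso_def multi_digraph_def f_def bij_betw_def)
qed

text \<open>
  The digraph is given by its matrix of arc multiplicities, row by row; a list of all arcs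
  could not even be read in time polynomial in \<open>n\<close>, since the multiplicities are unbounded.
\<close>

definition encode_instance :: "nat \<Rightarrow> nat \<Rightarrow> (nat \<Rightarrow> nat \<Rightarrow> nat) \<Rightarrow> nat \<Rightarrow> nat list" where
  "encode_instance k n m r = [k, n, r] @ concat (map (\<lambda>u. map (m u) [0..<n]) [0..<n])"

definition encode_arcs :: "(nat \<times> nat \<times> nat) list \<Rightarrow> nat list" where
  "encode_arcs as = length as # concat (map (\<lambda>(u, v, i). [u, v, i]) as)"

definition instances :: "nat list set" where
  "instances = {encode_instance k n m r | k n m r. k > 0 \<and> rooted_digraph (multi_digraph n m) r}"

definition yes_instances :: "nat list set" where
  "yes_instances = {encode_instance k n m r | k n m r.
     k > 0 \<and> rooted_digraph (multi_digraph n m) r \<and>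
     (\<exists>X Y. disjoint_spanning_flow_branchings (multi_digraph n m) r k X Y)}"

text \<open>The parameter of \<open>encode_instance k n m r\<close> is its first entry \<open>k\<close>.\<close>

definition parameter :: "nat list \<Rightarrow> nat" where
  "parameter = hd"

end

theory Submission
  imports Defs
begin

text \<open>
  By Hoffman's circulation theorem, a subdigraph with arc multiplicities \<open>x\<close> is an
  \<open>(r, k)\<close>-flow branching iff every set \<open>S\<close> avoiding \<open>r\<close> is entered by at least
  \<open>|S| / (n - k)\<close> arcs. If \<open>2 k \<le> n + 1\<close>, this says that all vertices are reachable from \<open>r\<close>
  and at least \<open>k\<close> of them stay reachable after the deletion of any single arc. Otherwise
  \<open>n < 2 k\<close>, and one can try all pairs of flows with values at most \<open>n\<close>.

  In the main case two arc-disjoint cores are grown from \<open>r\<close>. While some deletion leaves a set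
  \<open>Z\<close> of fewer than \<open>k\<close> reachable vertices, an available arc leaving \<open>Z\<close> is added, subject to
  Edmonds' condition that both cores still extend to disjoint spanning ones. If all vertices
  of \<open>Z\<close> have out-degree at most \<open>B = 16 k^3\<close>, there are at most \<open>k B\<close> such arcs and the choice is
  guessed; a potential argument shows that \<open>k^2\<close> guesses per core suffice. The sets \<open>Z\<close> containing
  a vertex of larger out-degree are treated afterwards without guessing: among so many arcs
  leaving one vertex there is always one that preserves Edmonds' condition. Finally Lovasz's
  augmentations, which exist by Edmonds' condition, make both cores spanning. An odometer
  enumerates the \<open>(16 k^4)^(2 k^2)\<close> guesses. The RAM program is built from for-loops whose bounds
  do not change inside the loop, so that its running time is bounded syntactically.
\<close>

section \<open>Cuts, flows and reachability\<close>

text \<open>The bound may depend on \<open>k\<close> and \<open>n\<close> only, while multiplicities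
  are unbounded; hence arcs are classes of parallel copies with a multiplicity, cut off at
  \<open>2 n\<close>. A core may grow only if the other one can still be completed. As long as
  guesses follow a fixed solution this is automatic. Afterwards no solution is being followed, and
  Edmonds' condition, which bounds a submodular cut function from below, is what allows blocking
  sets to be uncrossed. The potential is at most \<open>k^2\<close> for the empty core and falls
  with every repair. Ignoring out-degrees revives it, but only up to \<open>k^2 + k * k^2\<close>,
  because a core then has at most \<open>k^2\<close> arcs. So neither core exceeds
  \<open>2 k^2 + k^3\<close> arcs before the spanning phase, and any \<open>B\<close> above
  \<open>1 + 4 (2 k^2 + k^3)\<close> guarantees a harmless arc at a vertex of out-degree above
  \<open>B\<close>; \<open>16 k^3\<close> is such a number. A guess is a position in the list of
  candidates, and each guided round reads one guess per core, needed or not, so that a run is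
  determined by a digit sequence of fixed length.\<close>

locale rooted_net =
  fixes V :: "'v set" and A :: "'e set" and src dst :: "'e \<Rightarrow> 'v" and r :: 'v
  assumes finite_V: "finite V" and finite_A: "finite A"
    and src_in: "i \<in> A \<Longrightarrow> src i \<in> V" and dst_in: "i \<in> A \<Longrightarrow> dst i \<in> V"
    and root_in: "r \<in> V"
begin

definition cut :: "('e \<Rightarrow> nat) \<Rightarrow> 'v set \<Rightarrow> nat" where
  "cut x S = (\<Sum>i\<in>A. if src i \<notin> S \<and> dst i \<in> S then x i else 0)"

definition inflow :: "('e \<Rightarrow> nat) \<Rightarrow> 'v \<Rightarrow> nat" where
  "inflow z v = (\<Sum>i\<in>A. if dst i = v then z i else 0)"

definition outflow :: "('e \<Rightarrow> nat) \<Rightarrow> 'v \<Rightarrow> nat" where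
  "outflow z v = (\<Sum>i\<in>A. if src i = v then z i else 0)"

text \<open>The balance at the root is left out, since it follows by summing over all vertices, see
  \<open>unit_flow_root\<close>. Capacities are imposed separately.\<close>

definition unit_flow :: "('e \<Rightarrow> nat) \<Rightarrow> bool" where
  "unit_flow z \<longleftrightarrow> (\<forall>v\<in>V - {r}. inflow z v = outflow z v + 1)"

text \<open>Holds arc by arc; an arc between \<open>S - T\<close> and \<open>T - S\<close> counts on
  the right only.\<close>

lemma cut_submodular: "cut x (S \<inter> T) + cut x (S \<union> T) \<le> cut x S + cut x T"
  unfolding cut_def sum.distrib[symmetric] by (intro sum_mono) auto

lemma cut_mono: "(\<And>i. i \<in> A \<Longrightarrow> x i \<le> y i) \<Longrightarrow> cut x S \<le> cut y S"
  unfolding cut_def by (intro sum_mono) auto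

lemma cut_add: "cut (\<lambda>i. x i + y i) S = cut x S + cut y S"
  unfolding cut_def sum.distrib[symmetric] by (intro sum.cong) auto

lemma cut_cong: "(\<And>i. i \<in> A \<Longrightarrow> x i = y i) \<Longrightarrow> cut x S = cut y S"
  unfolding cut_def by (intro sum.cong) auto

lemma cut_scale: "cut (\<lambda>i. c * x i) S = c * cut x S"
  unfolding cut_def sum_distrib_left by (intro sum.cong) auto

lemma cut_pos: "0 < cut x S \<longleftrightarrow> (\<exists>i\<in>A. src i \<notin> S \<and> dst i \<in> S \<and> 0 < x i)"
  unfolding neq0_conv[symmetric] cut_def by (subst sum_nonneg_eq_0_iff[OF finite_A]) auto

lemma cut_eq_0: "cut x S = 0 \<longleftrightarrow> (\<forall>i\<in>A. src i \<notin> S \<longrightarrow> dst i \<in> S \<longrightarrow> x i = 0)"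
  unfolding cut_def by (subst sum_nonneg_eq_0_iff[OF finite_A]) auto

lemma arc_le_cut: "i \<in> A \<Longrightarrow> src i \<notin> S \<Longrightarrow> dst i \<in> S \<Longrightarrow> x i \<le> cut x S"
  unfolding cut_def
  using member_le_sum[of i A "\<lambda>i. if src i \<notin> S \<and> dst i \<in> S then x i else 0"] finite_A by auto

lemma two_arcs_le_cut:
  assumes "i \<in> A" "j \<in> A" "i \<noteq> j" "src i \<notin> S" "src j \<notin> S" "dst i \<in> S" "dst j \<in> S"
  shows "x i + x j \<le> cut x S"
proof -
  have "x i + x j = (\<Sum>l\<in>{i, j}. if src l \<notin> S \<and> dst l \<in> S then x l else 0)"
    using assms by simp
  also have "\<dots> \<le> cut x S"
    unfolding cut_def using assms finite_A by (intro sum_mono2) auto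
  finally show ?thesis .
qed

lemma cut_upd:
  assumes "i \<in> A"
  shows "cut (x(i := c)) S + (if src i \<notin> S \<and> dst i \<in> S then x i else 0)
    = cut x S + (if src i \<notin> S \<and> dst i \<in> S then c else 0)"
proof -
  have "(\<Sum>j\<in>A - {i}. if src j \<notin> S \<and> dst j \<in> S then (x(i := c)) j else 0)
      = (\<Sum>j\<in>A - {i}. if src j \<notin> S \<and> dst j \<in> S then x j else 0)"
    by (intro sum.cong) auto
  then show ?thesis
    unfolding cut_def sum.remove[OF finite_A assms] by simp
qed

lemma inflow_sum:
  assumes "finite S"
  shows "(\<Sum>v\<in>S. inflow z v) = (\<Sum>i\<in>A. if dst i \<in> S then z i else 0)"
proof -
  have "(\<Sum>v\<in>S. inflow z v) = (\<Sum>i\<in>A. \<Sum>v\<in>S. if dst i = v then z i else 0)"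
    unfolding inflow_def by (rule sum.swap)
  then show ?thesis using assms by simp
qed

lemma outflow_sum:
  assumes "finite S"
  shows "(\<Sum>v\<in>S. outflow z v) = (\<Sum>i\<in>A. if src i \<in> S then z i else 0)"
proof -
  have "(\<Sum>v\<in>S. outflow z v) = (\<Sum>i\<in>A. \<Sum>v\<in>S. if src i = v then z i else 0)"
    unfolding outflow_def by (rule sum.swap)
  then show ?thesis using assms by simp
qed

text \<open>Adding up the balances over \<open>S\<close> cancels the arcs inside \<open>S\<close>,
  and arcs leaving \<open>S\<close> only help. This is the easy half of Hoffman's theorem.\<close>

lemma unit_flow_cut:
  assumes "unit_flow z" "S \<subseteq> V - {r}"
  shows "card S \<le> cut z S"
proof -
  have fin: "finite S" using assms(2) finite_V by (meson finite_Diff finite_subset)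
  have "(\<Sum>v\<in>S. inflow z v) = (\<Sum>v\<in>S. outflow z v + 1)"
    using assms unfolding unit_flow_def by (intro sum.cong) auto
  then have "(\<Sum>i\<in>A. if src i \<in> S then z i else 0) + card S = (\<Sum>i\<in>A. if dst i \<in> S then z i else 0)"
    using fin by (simp add: sum.distrib inflow_sum outflow_sum del: add_Suc_right One_nat_def)
  also have "\<dots> \<le> (\<Sum>i\<in>A. if src i \<in> S then z i else 0) + cut z S"
    unfolding cut_def sum.distrib[symmetric] by (intro sum_mono) auto
  finally show ?thesis by simp
qed

definition cut_condition :: "('e \<Rightarrow> nat) \<Rightarrow> bool" where
  "cut_condition c \<longleftrightarrow> (\<forall>S. S \<subseteq> V - {r} \<longrightarrow> card S \<le> cut c S)"

text \<open>
  A pointwise minimal function below \<open>c\<close> satisfying the cut condition is itself the flow: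
  every arc it uses enters a tight set, tight sets through a vertex are closed under
  intersection, and comparing the smallest one, \<open>M\<close>, with \<open>M - {v}\<close> bounds the net inflow of
  \<open>v\<close> by 1.
\<close>

theorem unit_flow_exists:
  assumes "cut_condition c"
  obtains z where "\<And>i. z i \<le> c i" "unit_flow z"
proof -
  define P where "P z \<longleftrightarrow> (\<forall>i. z i \<le> c i) \<and> cut_condition z" for z
  have "P c" using assms by (simp add: P_def)
  then obtain z where Pz: "P z" and zmin: "\<And>y. P y \<Longrightarrow> sum z A \<le> sum y A"
    using ex_has_least_nat[of P c "\<lambda>z. sum z A"] by auto
  have zc: "\<And>i. z i \<le> c i" and cc: "\<And>S. S \<subseteq> V - {r} \<Longrightarrow> card S \<le> cut z S"
    using Pz by (auto simp: P_def cut_condition_def)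
  define tight where "tight S \<longleftrightarrow> S \<subseteq> V - {r} \<and> cut z S = card S" for S
  have enters: "\<exists>S. tight S \<and> src i \<notin> S \<and> dst i \<in> S" if i: "i \<in> A" "0 < z i" for i
  proof -
    let ?y = "z(i := z i - 1)"
    have "sum ?y A < sum z A"
      using i finite_A by (intro sum_strict_mono_ex1) auto
    then have "\<not> P ?y" using zmin[of ?y] by auto
    moreover have "\<forall>j. ?y j \<le> c j" using zc by (auto intro: le_trans[of _ "z i"])
    ultimately obtain S where S: "S \<subseteq> V - {r}" "cut ?y S < card S"
      unfolding P_def cut_condition_def by (meson not_le)
    then show ?thesis
      using cc[OF S(1)] cut_upd[OF i(1), of z "z i - 1" S] i(2)
      by (intro exI[of _ S]) (auto simp: tight_def split: if_splits)
  qed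
  have inter: "tight (S \<inter> T)" if "tight S" "tight T" for S T
  proof -
    have "finite S" "finite T" using that finite_V unfolding tight_def by (meson finite_Diff finite_subset)+
    then have "card (S \<inter> T) + card (S \<union> T) = card S + card T" using card_Un_Int by (metis add.commute)
    moreover have "card (S \<inter> T) \<le> cut z (S \<inter> T)" "card (S \<union> T) \<le> cut z (S \<union> T)"
      using that by (auto intro!: cc simp: tight_def)
    ultimately show ?thesis
      using that cut_submodular[of z S T] by (auto simp: tight_def)
  qed
  have no_root: "z i = 0" if "i \<in> A" "dst i = r" for i
    using enters[of i] that by (auto simp: tight_def)
  have net_le: "inflow z v \<le> outflow z v + 1" if v: "v \<in> V - {r}" for v
  proof -
    have "0 < cut z {v}" using cc[of "{v}"] v by simp
    then obtain i where i: "i \<in> A" "dst i = v" "0 < z i" by (auto simp: cut_pos)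
    from enters[OF i(1,3)] i(2) obtain T0 where "tight T0 \<and> v \<in> T0" by auto
    then obtain M where M: "tight M" "v \<in> M" and Mmin: "\<And>T. tight T \<Longrightarrow> v \<in> T \<Longrightarrow> card M \<le> card T"
      using ex_has_least_nat[of "\<lambda>T. tight T \<and> v \<in> T" T0 card] by blast
    have finM: "finite M" using M(1) finite_V unfolding tight_def by (meson finite_Diff finite_subset)
    have Msub: "M \<subseteq> T" if "tight T" "v \<in> T" for T
    proof -
      have "card M \<le> card (M \<inter> T)" using Mmin[OF inter[OF M(1) that(1)]] that M(2) by simp
      then have "M \<inter> T = M" using finM by (intro card_seteq) auto
      then show ?thesis by blast
    qed
    have ent: "src j \<notin> M" if j: "j \<in> A" "0 < z j" "dst j = v" for j
    proof -
      obtain T where "tight T" "src j \<notin> T" "dst j \<in> T" using enters[OF j(1,2)] by blast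
      then show ?thesis using Msub[of T] j(3) by auto
    qed
    \<comment> \<open>By \<open>ent\<close> the used arcs into \<open>v\<close> start outside
      \<open>M\<close> and so count in the cut of \<open>M\<close>; an arc into
      \<open>M - {v}\<close> starts outside \<open>M\<close>, where it counts in the same cut, or at
      \<open>v\<close>.\<close>
    have "inflow z v + cut z (M - {v}) \<le> cut z M + outflow z v"
      unfolding inflow_def outflow_def cut_def sum.distrib[symmetric]
      using ent M(2) by (intro sum_mono) auto
    moreover have "card (M - {v}) \<le> cut z (M - {v})" using M by (intro cc) (auto simp: tight_def)
    moreover have "cut z M = card M" "card M = Suc (card (M - {v}))"
      using M finM card_Suc_Diff1[of M v] by (auto simp: tight_def)
    ultimately show ?thesis by simp
  qed
  \<comment> \<open>Nothing enters the root, so summing over the other vertices bounds the total net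
    inflow from below by their number. With \<open>net_le\<close> no vertex can fall short.\<close>
  have "(\<Sum>i\<in>A. if dst i \<in> V - {r} then z i else 0)
      = (\<Sum>i\<in>A. if src i \<in> V - {r} then z i else 0) + cut z (V - {r})"
    unfolding cut_def sum.distrib[symmetric] using no_root src_in dst_in by (intro sum.cong) auto
  then have le: "(\<Sum>v\<in>V - {r}. outflow z v + 1) \<le> (\<Sum>v\<in>V - {r}. inflow z v)"
    using cc[of "V - {r}"] finite_V
    by (simp add: sum.distrib inflow_sum outflow_sum del: add_Suc_right One_nat_def)
  have "inflow z v = outflow z v + 1" if v: "v \<in> V - {r}" for v
  proof (rule ccontr)
    assume "inflow z v \<noteq> outflow z v + 1"
    then have "inflow z v < outflow z v + 1" using net_le[OF v] by simp
    then have "(\<Sum>v\<in>V - {r}. inflow z v) < (\<Sum>v\<in>V - {r}. outflow z v + 1)"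
      using net_le v finite_V by (intro sum_strict_mono_ex1) auto
    with le show False by simp
  qed
  then have "unit_flow z" unfolding unit_flow_def by (rule ballI)
  with zc show thesis by (rule that)
qed

section \<open>Reachability and single-arc robustness as cut conditions\<close>

inductive_set reach :: "('e \<Rightarrow> nat) \<Rightarrow> 'v set \<Rightarrow> 'v set" for x :: "'e \<Rightarrow> nat" and R :: "'v set" where
  base: "v \<in> R \<Longrightarrow> v \<in> reach x R"
| step: "i \<in> A \<Longrightarrow> 0 < x i \<Longrightarrow> src i \<in> reach x R \<Longrightarrow> dst i \<in> reach x R"

lemma reach_least:
  assumes "R \<subseteq> T" "\<And>i. i \<in> A \<Longrightarrow> 0 < x i \<Longrightarrow> src i \<in> T \<Longrightarrow> dst i \<in> T"
  shows "reach x R \<subseteq> T"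
proof
  fix v assume "v \<in> reach x R"
  then show "v \<in> T" by induction (use assms in auto)
qed

lemma reach_mono:
  assumes "R \<subseteq> R'" "\<And>i. i \<in> A \<Longrightarrow> 0 < x i \<Longrightarrow> 0 < y i"
  shows "reach x R \<subseteq> reach y R'"
  by (rule reach_least) (use assms in \<open>auto intro: reach.intros\<close>)

lemma reach_cong:
  assumes "\<And>i. i \<in> A \<Longrightarrow> x i = y i"
  shows "reach x R = reach y R"
  by (intro subset_antisym reach_mono) (use assms in auto)

lemma reach_subset: "R \<subseteq> V \<Longrightarrow> reach x R \<subseteq> V"
  by (rule reach_least) (auto intro: dst_in)

lemma finite_reach: "R \<subseteq> V \<Longrightarrow> finite (reach x R)"
  by (rule finite_subset[OF reach_subset finite_V])

lemma cut_reach: "cut x (V - reach x R) = 0"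
  unfolding cut_eq_0
proof (intro ballI impI, rule ccontr)
  fix i assume i: "i \<in> A" "src i \<notin> V - reach x R" "dst i \<in> V - reach x R" "x i \<noteq> 0"
  then have "dst i \<in> reach x R" using src_in[of i] by (intro reach.step) auto
  then show False using i(3) by simp
qed

text \<open>The complement of a reached set has cut 0. This turns reachability into a condition on
  cuts, where submodularity applies.\<close>

lemma reach_eq_V_iff:
  assumes "R \<subseteq> V"
  shows "reach x R = V \<longleftrightarrow> (\<forall>S. S \<subseteq> V \<longrightarrow> S \<noteq> {} \<longrightarrow> S \<inter> R = {} \<longrightarrow> 0 < cut x S)"
proof
  assume eq: "reach x R = V"
  show "\<forall>S. S \<subseteq> V \<longrightarrow> S \<noteq> {} \<longrightarrow> S \<inter> R = {} \<longrightarrow> 0 < cut x S"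
  proof (intro allI impI, rule ccontr)
    fix S assume S: "S \<subseteq> V" "S \<noteq> {}" "S \<inter> R = {}" "\<not> 0 < cut x S"
    have "reach x R \<subseteq> V - S"
      by (rule reach_least) (use S assms dst_in in \<open>auto simp: cut_pos\<close>)
    then show False using eq S by auto
  qed
next
  assume "\<forall>S. S \<subseteq> V \<longrightarrow> S \<noteq> {} \<longrightarrow> S \<inter> R = {} \<longrightarrow> 0 < cut x S"
  from this[rule_format, of "V - reach x R"] show "reach x R = V"
    using cut_reach[of x R] reach_subset[OF assms, of x] by (auto intro: reach.base)
qed

text \<open>One copy is removed, not the whole class of parallel copies. For an arc with
  \<open>x i = 0\<close> nothing is removed, and the condition speaks about the full reached
  set.\<close>

definition robust :: "nat \<Rightarrow> ('e \<Rightarrow> nat) \<Rightarrow> bool" where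
  "robust k x \<longleftrightarrow> (\<forall>i\<in>A. k \<le> card (reach (x(i := x i - 1)) {r}))"

lemma cut_dec_le: "cut x S \<le> Suc (cut (x(i := x i - 1)) S)"
proof (cases "i \<in> A")
  case True
  then show ?thesis using cut_upd[OF True, of x "x i - 1" S] by (auto split: if_splits)
next
  case False
  then have "cut x S = cut (x(i := x i - 1)) S" by (intro cut_cong) auto
  then show ?thesis by simp
qed

text \<open>A nonempty set of size at most \<open>card V - k\<close> needs one entering arc, a
  larger one needs two, and two always suffice: by the second hypothesis
  \<open>2 * (card V - k)\<close> is at least \<open>card V - 1\<close>. A large set entered by one
  arc only is what the deletion of that arc makes unreachable, leaving fewer than \<open>k\<close>
  vertices.\<close>

lemma cut_condition_iff_robust:
  assumes "k \<le> card V" "2 * k \<le> card V + 1"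
  shows "cut_condition (\<lambda>i. (card V - k) * x i) \<longleftrightarrow> reach x {r} = V \<and> robust k x"
proof
  assume cc: "cut_condition (\<lambda>i. (card V - k) * x i)"
  then have cc: "card S \<le> (card V - k) * cut x S" if "S \<subseteq> V - {r}" for S
    using that unfolding cut_condition_def cut_scale by blast
  have "0 < cut x S" if S: "S \<subseteq> V" "S \<noteq> {}" "S \<inter> {r} = {}" for S
  proof -
    have "0 < card S" using S finite_V by (meson card_gt_0_iff finite_subset)
    then show ?thesis using cc[of S] S by (intro gr0I) auto
  qed
  then have "reach x {r} = V" using root_in by (simp add: reach_eq_V_iff)
  moreover have "robust k x"
    unfolding robust_def
  proof (rule ballI, rule ccontr)
    fix i assume i: "i \<in> A" "\<not> k \<le> card (reach (x(i := x i - 1)) {r})"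
    let ?Z = "reach (x(i := x i - 1)) {r}"
    have Z: "?Z \<subseteq> V" "finite ?Z" "r \<in> ?Z"
      using root_in by (auto intro!: reach_subset finite_reach reach.base)
    have "cut x (V - ?Z) \<le> 1" using cut_dec_le[of x "V - ?Z" i] cut_reach by simp
    then have "(card V - k) * cut x (V - ?Z) \<le> card V - k"
      by (metis mult.right_neutral mult_le_mono2)
    moreover have "card (V - ?Z) \<le> (card V - k) * cut x (V - ?Z)" by (rule cc) (use Z in auto)
    moreover have "card (V - ?Z) = card V - card ?Z" using Z by (simp add: card_Diff_subset)
    ultimately show False using i(2) assms(1) by linarith
  qed
  ultimately show "reach x {r} = V \<and> robust k x" ..
next
  assume rob: "reach x {r} = V \<and> robust k x"
  show "cut_condition (\<lambda>i. (card V - k) * x i)"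
    unfolding cut_condition_def cut_scale
  proof (intro allI impI)
    fix S assume S: "S \<subseteq> V - {r}"
    then have fin: "finite S" "S \<subseteq> V" "r \<notin> S" using finite_V by (auto intro: finite_subset)
    have cardS: "card S < card V" using fin finite_V root_in by (intro psubset_card_mono) auto
    show "card S \<le> (card V - k) * cut x S"
    proof (cases "S = {}")
      case False
      then have pos: "0 < cut x S" using rob reach_eq_V_iff[of "{r}" x] root_in fin by auto
      consider "card S \<le> card V - k" | "card V - k < card S" by linarith
      then show ?thesis
      proof cases
        case 1
        then show ?thesis using pos by (metis Suc_leI le_trans mult.right_neutral mult_le_mono2 One_nat_def)
      next
        case 2
        have "2 \<le> cut x S"
        proof (rule ccontr)
          assume "\<not> 2 \<le> cut x S"
          then have one: "cut x S = 1" using pos by simp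
          obtain i where i: "i \<in> A" "src i \<notin> S" "dst i \<in> S" "0 < x i" using pos unfolding cut_pos by blast
          have "cut (x(i := x i - 1)) S = 0"
            using cut_upd[OF i(1), of x "x i - 1" S] i one by simp
          then have "reach (x(i := x i - 1)) {r} \<subseteq> V - S"
            using fin root_in dst_in unfolding cut_eq_0
            by (intro reach_least) (auto simp del: fun_upd_apply)
          then have "card (reach (x(i := x i - 1)) {r}) \<le> card V - card S"
            using card_mono[of "V - S"] finite_V fin by (metis card_Diff_subset finite_Diff)
          then show False using rob i(1) 2 assms(1) cardS unfolding robust_def by fastforce
        qed
        then have "(card V - k) * 2 \<le> (card V - k) * cut x S" by (rule mult_le_mono2)
        then show ?thesis using cardS assms by linarith
      qed
    qed simp
  qed
qed

section \<open>Grown cores and Edmonds' condition\<close>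

definition grown :: "('e \<Rightarrow> nat) \<Rightarrow> bool" where
  "grown x \<longleftrightarrow> (\<forall>i\<in>A. 0 < x i \<longrightarrow> src i \<in> reach x {r})"

text \<open>Every arc in use already starts in the reached part, so the new arc cannot wake up a
  dormant one. This is why cores are kept \<open>grown\<close>.\<close>

lemma reach_add_arc:
  assumes "grown x" "i \<in> A" "src i \<in> reach x {r}"
  shows "reach (x(i := Suc (x i))) {r} = insert (dst i) (reach x {r})"
proof
  show "reach (x(i := Suc (x i))) {r} \<subseteq> insert (dst i) (reach x {r})"
  proof (rule reach_least)
    fix j assume j: "j \<in> A" "0 < (x(i := Suc (x i))) j"
    show "dst j \<in> insert (dst i) (reach x {r})"
      using assms j by (cases "j = i") (auto simp: grown_def intro: reach.step)
  qed (auto intro: reach.base)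
  have sub: "reach x {r} \<subseteq> reach (x(i := Suc (x i))) {r}" by (rule reach_mono) auto
  then have "dst i \<in> reach (x(i := Suc (x i))) {r}"
    using assms by (intro reach.step) auto
  with sub show "insert (dst i) (reach x {r}) \<subseteq> reach (x(i := Suc (x i))) {r}" by simp
qed

lemma grown_add_arc:
  assumes "grown x" "i \<in> A" "src i \<in> reach x {r}"
  shows "grown (x(i := Suc (x i)))"
  unfolding grown_def reach_add_arc[OF assms] using assms by (auto simp: grown_def)

text \<open>
  Edmonds' condition: the arcs of \<open>d\<close> not used by \<open>x\<close> and \<open>y\<close> contain arc-disjoint extensions
  of \<open>x\<close> and \<open>y\<close> to spanning subdigraphs.
\<close>

definition extendable :: "('e \<Rightarrow> nat) \<Rightarrow> ('e \<Rightarrow> nat) \<Rightarrow> ('e \<Rightarrow> nat) \<Rightarrow> bool" where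
  "extendable d x y \<longleftrightarrow> (\<forall>S. S \<subseteq> V \<longrightarrow> S \<noteq> {} \<longrightarrow>
     of_bool (S \<inter> reach x {r} = {}) + of_bool (S \<inter> reach y {r} = {}) \<le> cut (\<lambda>i. d i - (x i + y i)) S)"

lemma extendable_commute: "extendable d x y \<longleftrightarrow> extendable d y x"
  unfolding extendable_def by (simp add: add.commute)

lemma extendableD:
  assumes "extendable d x y" "S \<subseteq> V" "S \<noteq> {}"
  shows "of_bool (S \<inter> reach x {r} = {}) + of_bool (S \<inter> reach y {r} = {}) \<le> cut (\<lambda>i. d i - (x i + y i)) S"
  using assms unfolding extendable_def by blast

text \<open>A condition on all sets becomes \<open>card A + 2\<close> reachability tests, which is
  what the program evaluates. Sets missed by one core ask for reachability from that core; sets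
  missed by both ask for two entering arcs, that is, for reachability from the union of both after
  any single deletion.\<close>

lemma extendable_iff:
  fixes d x y
  defines "e \<equiv> \<lambda>i. d i - (x i + y i)"
  shows "extendable d x y \<longleftrightarrow> reach e (reach x {r}) = V \<and> reach e (reach y {r}) = V \<and>
    (\<forall>i\<in>A. reach (e(i := e i - 1)) (reach x {r} \<union> reach y {r}) = V)"
proof -
  have sub: "reach x {r} \<subseteq> V" for x using root_in by (auto intro!: reach_subset)
  show ?thesis
  proof
    assume ext: "extendable d x y"
    note D = extendableD[OF ext, folded e_def]
    have 1: "0 < cut e S" if "S \<subseteq> V" "S \<noteq> {}" "S \<inter> reach x {r} = {} \<or> S \<inter> reach y {r} = {}" for S
      using D[OF that(1,2)] that(3) by auto
    have 2: "0 < cut (e(i := e i - 1)) S" if "S \<subseteq> V" "S \<noteq> {}" "S \<inter> (reach x {r} \<union> reach y {r}) = {}" for S i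
    proof -
      have "S \<inter> reach x {r} = {}" "S \<inter> reach y {r} = {}" using that(3) by auto
      then have "2 \<le> cut e S" using D[OF that(1,2)] by simp
      then show ?thesis using cut_dec_le[of e S i] by simp
    qed
    show "reach e (reach x {r}) = V \<and> reach e (reach y {r}) = V \<and>
      (\<forall>i\<in>A. reach (e(i := e i - 1)) (reach x {r} \<union> reach y {r}) = V)"
      using 1 2 sub by (simp add: reach_eq_V_iff)
  next
    assume "reach e (reach x {r}) = V \<and> reach e (reach y {r}) = V \<and>
      (\<forall>i\<in>A. reach (e(i := e i - 1)) (reach x {r} \<union> reach y {r}) = V)"
    note all = this
    have D: "0 < cut f S" if "reach f R = V" "R \<subseteq> V" "S \<subseteq> V" "S \<noteq> {}" "S \<inter> R = {}" for f R S
      using that(1,3-5) unfolding reach_eq_V_iff[OF that(2)] by blast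
    have 1: "0 < cut e S" if "S \<subseteq> V" "S \<noteq> {}" "S \<inter> reach x {r} = {} \<or> S \<inter> reach y {r} = {}" for S
      using that(3) D[OF conjunct1[OF all] sub that(1,2)] D[OF conjunct1[OF conjunct2[OF all]] sub that(1,2)] by blast
    have 2: "0 < cut (e(i := e i - 1)) S" if "i \<in> A" "S \<subseteq> V" "S \<noteq> {}" "S \<inter> (reach x {r} \<union> reach y {r}) = {}" for i S
      using D[OF bspec[OF conjunct2[OF conjunct2[OF all]] that(1)] Un_least[OF sub sub] that(2-4)] .
    show "extendable d x y"
      unfolding extendable_def e_def[symmetric]
    proof (intro allI impI)
      fix S assume S: "S \<subseteq> V" "S \<noteq> {}"
      show "of_bool (S \<inter> reach x {r} = {}) + of_bool (S \<inter> reach y {r} = {}) \<le> cut e S"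
      proof (cases "S \<inter> reach x {r} = {} \<and> S \<inter> reach y {r} = {}")
        case True
        \<comment> \<open>Some copy enters \<open>S\<close> by the tests for one core; by the
          deletion test another one remains after its removal, so the cut is at least 2.\<close>
        then have "0 < cut e S" using 1 S by blast
        then obtain i where i: "i \<in> A" "src i \<notin> S" "dst i \<in> S" "0 < e i" unfolding cut_pos by blast
        have "0 < cut (e(i := e i - 1)) S" using 2[OF i(1) S] True by blast
        then show ?thesis using cut_upd[OF i(1), of e "e i - 1" S] i True by simp
      next
        case False
        then show ?thesis using 1[OF S] by (auto simp: of_bool_def)
      qed
    qed
  qed
qed

text \<open>If \<open>x\<close> misses \<open>S\<close>, an arc of \<open>X\<close> entering
  \<open>S\<close> cannot belong to the grown core \<open>x\<close>, whose arcs all have reached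
  heads; so \<open>X - x\<close> enters \<open>S\<close>. The same holds for \<open>Y - y\<close>,
  and both differences fit into what is left of \<open>d\<close>.\<close>

lemma extendable_if_solution:
  assumes "\<And>i. i \<in> A \<Longrightarrow> x i \<le> X i" "\<And>i. i \<in> A \<Longrightarrow> y i \<le> Y i" "\<And>i. i \<in> A \<Longrightarrow> X i + Y i \<le> d i"
    and "grown x" "grown y" "reach X {r} = V" "reach Y {r} = V"
  shows "extendable d x y"
  unfolding extendable_def
proof (intro allI impI)
  fix S assume S: "S \<subseteq> V" "S \<noteq> {}"
  have *: "of_bool (S \<inter> reach x {r} = {}) \<le> cut (\<lambda>i. X i - x i) S"
    if "\<And>i. i \<in> A \<Longrightarrow> x i \<le> X i" "grown x" "reach X {r} = V" for x X
  proof (cases "S \<inter> reach x {r} = {}")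
    case True
    then have "r \<notin> S" using reach.base[of r "{r}" x] by auto
    then have "0 < cut X S" using that(3) S root_in reach_eq_V_iff[of "{r}" X] by simp
    then obtain i where i: "i \<in> A" "src i \<notin> S" "dst i \<in> S" "0 < X i" unfolding cut_pos by blast
    have "x i = 0"
    proof (rule ccontr)
      assume "x i \<noteq> 0"
      then have "dst i \<in> reach x {r}" using that(2) i(1) by (auto simp: grown_def intro: reach.step)
      then show False using True i(3) by auto
    qed
    then have "0 < cut (\<lambda>i. X i - x i) S" unfolding cut_pos using i by auto
    then show ?thesis by simp
  qed simp
  have "of_bool (S \<inter> reach x {r} = {}) + of_bool (S \<inter> reach y {r} = {})
      \<le> cut (\<lambda>i. X i - x i) S + cut (\<lambda>i. Y i - y i) S"
    using *[OF assms(1,4,6)] *[OF assms(2,5,7)] by simp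
  also have "\<dots> \<le> cut (\<lambda>i. d i - (x i + y i)) S"
    unfolding cut_add[symmetric]
  proof (rule cut_mono)
    fix i assume "i \<in> A"
    then show "X i - x i + (Y i - y i) \<le> d i - (x i + y i)" using assms(1-3)[of i] by linarith
  qed
  finally show "of_bool (S \<inter> reach x {r} = {}) + of_bool (S \<inter> reach y {r} = {})
    \<le> cut (\<lambda>i. d i - (x i + y i)) S" .
qed

text \<open>Adding \<open>i\<close> lowers the cut of a set that \<open>i\<close> enters by one. If
  \<open>x\<close> misses this set, the demand falls as well, because the head of \<open>i\<close>
  becomes reached. So only a set that \<open>x\<close> already meets, that \<open>y\<close> misses
  and whose cut is 1 can become violated.\<close>

lemma extendable_blocked:
  assumes ext: "extendable d x y" and x: "grown x" "i \<in> A" "src i \<in> reach x {r}"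
    and avail: "x i + y i < d i" and nonext: "\<not> extendable d (x(i := Suc (x i))) y"
  obtains S where "S \<subseteq> V" "dst i \<in> S" "src i \<notin> S" "S \<inter> reach y {r} = {}" "S \<inter> reach x {r} \<noteq> {}"
    "cut (\<lambda>i. d i - (x i + y i)) S = 1"
proof -
  define e where "e = (\<lambda>i. d i - (x i + y i))"
  let ?x = "x(i := Suc (x i))"
  have e': "(\<lambda>j. d j - (?x j + y j)) = e(i := e i - 1)" by (auto simp: e_def)
  obtain S where S: "S \<subseteq> V" "S \<noteq> {}"
    "cut (e(i := e i - 1)) S < of_bool (S \<inter> reach ?x {r} = {}) + of_bool (S \<inter> reach y {r} = {})"
    using nonext unfolding extendable_def e' by (meson not_le)
  note D = extendableD[OF ext S(1,2), folded e_def]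
  have R: "reach ?x {r} = insert (dst i) (reach x {r})" by (rule reach_add_arc[OF x])
  have le: "of_bool (S \<inter> reach ?x {r} = {}) \<le> (of_bool (S \<inter> reach x {r} = {}) :: nat)" using R by auto
  have ent: "src i \<notin> S \<and> dst i \<in> S"
  proof (rule ccontr)
    assume "\<not> (src i \<notin> S \<and> dst i \<in> S)"
    then have "cut (e(i := e i - 1)) S = cut e S" using cut_upd[OF x(2), of e "e i - 1" S] by (simp split: if_splits)
    then show False using S(3) D le by linarith
  qed
  have "0 < e i" using avail by (simp add: e_def)
  then have "cut e S = Suc (cut (e(i := e i - 1)) S)" using cut_upd[OF x(2), of e "e i - 1" S] ent by simp
  moreover have "S \<inter> reach ?x {r} \<noteq> {}" using R ent by auto
  ultimately have "cut e S = 1 \<and> S \<inter> reach y {r} = {} \<and> S \<inter> reach x {r} \<noteq> {}"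
    using S(3) D by (auto simp: of_bool_def split: if_splits)
  then show thesis using that[of S] S(1) ent unfolding e_def by blast
qed

text \<open>Each blocked arc of \<open>Q\<close> has a set from \<open>extendable_blocked\<close>.
  Two such sets cannot meet: their intersection, missed by \<open>y\<close>, has cut at least 1, and
  their union is entered by both arcs, because these have the same tail; but the two cuts are 1
  each. Every one of these disjoint sets contains a vertex reached by \<open>x\<close>, so there are
  no more blocked arcs than reached vertices.\<close>

lemma extendable_star:
  assumes ext: "extendable d x y" and x: "grown x" "z \<in> reach x {r}"
    and many: "card (reach x {r}) < card Q" and Q: "Q \<subseteq> {i \<in> A. src i = z \<and> x i + y i < d i}"
  obtains i where "i \<in> Q" "extendable d (x(i := Suc (x i))) y"
proof (rule ccontr)
  assume neg: "\<not> thesis"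
  define e where "e = (\<lambda>i. d i - (x i + y i))"
  have "\<forall>i\<in>Q. \<exists>S. S \<subseteq> V \<and> dst i \<in> S \<and> src i \<notin> S \<and> S \<inter> reach y {r} = {} \<and> S \<inter> reach x {r} \<noteq> {} \<and> cut e S = 1"
  proof
    fix i assume i: "i \<in> Q"
    then have iQ: "i \<in> A" "src i = z" "x i + y i < d i" using Q by blast+
    have nonext: "\<not> extendable d (x(i := Suc (x i))) y" using i neg that[of i] by blast
    show "\<exists>S. S \<subseteq> V \<and> dst i \<in> S \<and> src i \<notin> S \<and> S \<inter> reach y {r} = {} \<and> S \<inter> reach x {r} \<noteq> {} \<and> cut e S = 1"
      by (rule extendable_blocked[OF ext x(1) _ _ _ nonext]) (use iQ x in \<open>auto simp: e_def\<close>)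
  qed
  from bchoice[OF this] obtain S where S': "\<forall>i\<in>Q. S i \<subseteq> V \<and> dst i \<in> S i \<and> src i \<notin> S i
      \<and> S i \<inter> reach y {r} = {} \<and> S i \<inter> reach x {r} \<noteq> {} \<and> cut e (S i) = 1" ..
  note S = bspec[OF S']
  have disj: "S i \<inter> S j = {}" if ij: "i \<in> Q" "j \<in> Q" "i \<noteq> j" for i j
  proof (rule ccontr)
    assume ne: "S i \<inter> S j \<noteq> {}"
    note Si = S[OF ij(1)] and Sj = S[OF ij(2)]
    have ijQ: "i \<in> A" "j \<in> A" "src i = z" "src j = z" "0 < e i" "0 < e j"
      using ij Q by (auto simp: e_def)
    have "S i \<inter> S j \<subseteq> V" using Si by auto
    from extendableD[OF ext this ne, folded e_def] have "1 \<le> cut e (S i \<inter> S j)"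
    proof -
      assume "of_bool (S i \<inter> S j \<inter> reach x {r} = {}) + of_bool (S i \<inter> S j \<inter> reach y {r} = {}) \<le> cut e (S i \<inter> S j)"
      moreover have "S i \<inter> S j \<inter> reach y {r} = {}" using Si by blast
      ultimately show ?thesis by simp
    qed
    moreover have "e i + e j \<le> cut e (S i \<union> S j)" 
      using ij(3) ijQ Si Sj by (intro two_arcs_le_cut) auto
    ultimately show False using ijQ(5,6) cut_submodular[of e "S i" "S j"] Si Sj by linarith
  qed
  define v where "v i = (SOME v. v \<in> S i \<inter> reach x {r})" for i
  have v: "v i \<in> S i \<inter> reach x {r}" if "i \<in> Q" for i
  proof -
    have "\<exists>v. v \<in> S i \<inter> reach x {r}" using S[OF that] by blast
    then show ?thesis unfolding v_def by (rule someI_ex)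
  qed
  have "inj_on v Q"
  proof (rule inj_onI, rule ccontr)
    fix i j assume ij: "i \<in> Q" "j \<in> Q" "v i = v j" "i \<noteq> j"
    then show False using v[OF ij(1)] v[OF ij(2)] disj[OF ij(1,2,4)] by auto
  qed
  then have "card Q \<le> card (reach x {r})"
    using v by (intro card_inj_on_le[of v]) (auto intro: finite_reach simp: root_in)
  with many show False by simp
qed

text \<open>The augmentation step of Lovasz's proof of Edmonds' branching theorem.\<close>

lemma extendable_leave:
  assumes ext: "extendable d x y" and x: "grown x" "reach x {r} \<noteq> V"
  obtains i where "i \<in> A" "src i \<in> reach x {r}" "dst i \<notin> reach x {r}" "x i + y i < d i"
    "extendable d (x(i := Suc (x i))) y"
proof -
  define e where "e = (\<lambda>i. d i - (x i + y i))"
  let ?R = "reach x {r}" and ?R2 = "reach y {r}"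
  note D = extendableD[OF ext, folded e_def]
  have RV: "?R \<subseteq> V" using root_in by (auto intro!: reach_subset)
  \<comment> \<open>By \<open>extendable_blocked\<close> every set that blocks an arc leaving
    \<open>?R\<close> is of this kind: it contains the head of that arc and so is no subset of
    \<open>?R\<close>.\<close>
  define danger where "danger S \<longleftrightarrow> S \<subseteq> V \<and> S \<inter> ?R \<noteq> {} \<and> S \<inter> ?R2 = {} \<and> cut e S = 1 \<and> \<not> S \<subseteq> ?R" for S
  show thesis
  proof (cases "\<exists>S. danger S")
    case False
    have "1 \<le> cut e (V - ?R)" using D[of "V - ?R"] x(2) RV by (auto simp: Int_commute)
    then have "0 < cut e (V - ?R)" by simp
    then obtain i where i: "i \<in> A" "src i \<notin> V - ?R" "dst i \<in> V - ?R" "0 < e i" unfolding cut_pos by blast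
    have "extendable d (x(i := Suc (x i))) y"
    proof (rule ccontr)
      assume nonext: "\<not> ?thesis"
      show False
        by (rule extendable_blocked[OF ext x(1) i(1) _ _ nonext])
          (use i src_in[OF i(1)] False in \<open>auto simp: e_def danger_def\<close>)
    qed
    then show thesis using that[of i] i src_in[OF i(1)] by (auto simp: e_def)
  next
    case True
    then obtain S where S: "danger S" and Smin: "\<And>T. danger T \<Longrightarrow> card S \<le> card T"
      using ex_has_least_nat[of danger _ card] by auto
    have SV: "S \<subseteq> V" "finite S" using S finite_V by (auto simp: danger_def intro: finite_subset)
    have ne: "S - ?R \<noteq> {}" "(S - ?R) \<inter> ?R2 = {}" "(S - ?R) \<inter> ?R = {}" using S by (auto simp: danger_def)
    have "S - ?R \<subseteq> V" using SV by blast
    from D[OF this ne(1)] ne(2,3) have "2 \<le> cut e (S - ?R)" by simp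
    \<comment> \<open>\<open>S\<close> has cut 1, but \<open>S - ?R\<close>, missed by both cores,
      has cut at least 2; the surplus must start inside \<open>S\<close> and hence in
      \<open>?R\<close>.\<close>
    have "\<exists>i\<in>A. src i \<in> S \<inter> ?R \<and> dst i \<in> S - ?R \<and> 0 < e i"
    proof (rule ccontr)
      assume *: "\<not> ?thesis"
      have "cut e (S - ?R) \<le> cut e S"
        unfolding cut_def using * by (intro sum_mono) auto
      then show False using \<open>2 \<le> _\<close> S by (auto simp: danger_def)
    qed
    then obtain i where i: "i \<in> A" "src i \<in> S \<inter> ?R" "dst i \<in> S - ?R" "0 < e i" by blast
    have "extendable d (x(i := Suc (x i))) y"
    proof (rule ccontr)
      assume nonext: "\<not> ?thesis"
      show False
      proof (rule extendable_blocked[OF ext x(1) i(1) _ _ nonext])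
        fix T assume T: "T \<subseteq> V" "dst i \<in> T" "src i \<notin> T" "T \<inter> ?R2 = {}" "T \<inter> ?R \<noteq> {}"
          "cut (\<lambda>i. d i - (x i + y i)) T = 1"
        have Sd: "S \<inter> ?R2 = {}" "cut e S = 1" and Td: "cut e T = 1" using S T(6) by (auto simp: danger_def e_def)
        have UV: "S \<union> T \<subseteq> V" "S \<union> T \<noteq> {}" and U0: "(S \<union> T) \<inter> ?R2 = {}"
          and IV: "S \<inter> T \<subseteq> V" "S \<inter> T \<noteq> {}" and I0: "S \<inter> T \<inter> ?R2 = {}"
          using SV T Sd i by blast+
        \<comment> \<open>The cuts of \<open>S\<close> and \<open>T\<close> are 1 and their union is
          missed by \<open>y\<close>, so the intersection has cut 1; if \<open>x\<close> missed it
          as well, it would need 2.\<close>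
        have "1 \<le> cut e (S \<union> T)" using D[OF UV] U0 by simp
        moreover have I: "of_bool (S \<inter> T \<inter> ?R = {}) + 1 \<le> cut e (S \<inter> T)" using D[OF IV] I0 by simp
        ultimately have "cut e (S \<inter> T) = 1" "S \<inter> T \<inter> ?R \<noteq> {}"
          using cut_submodular[of e S T] Sd Td by (cases "S \<inter> T \<inter> ?R = {}"; simp)+
        moreover have "\<not> S \<inter> T \<subseteq> ?R" using i(3) T(2) by blast
        ultimately have "danger (S \<inter> T)" unfolding danger_def using IV(1) I0 by blast
        \<comment> \<open>The tail of \<open>i\<close> lies in \<open>S\<close> but not in
          \<open>T\<close>, so the dangerous set \<open>S \<inter> T\<close> contradicts the
          minimality of \<open>S\<close>.\<close>
        moreover have "card (S \<inter> T) < card S" using SV i T by (intro psubset_card_mono) auto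
        ultimately show False using Smin by fastforce
      qed (use i in \<open>auto simp: e_def\<close>)
    qed
    then show thesis using that[of i] i by (auto simp: e_def)
  qed
qed

end

lemma card_filter_le_sum:
  fixes f :: "'a \<Rightarrow> nat"
  assumes "finite A"
  shows "card {i \<in> A. 0 < f i} \<le> sum f A"
proof -
  have "card {i \<in> A. 0 < f i} = (\<Sum>i\<in>{i \<in> A. 0 < f i}. 1)" by simp
  also have "\<dots> \<le> (\<Sum>i\<in>{i \<in> A. 0 < f i}. f i)" by (intro sum_mono) auto
  also have "\<dots> \<le> sum f A" using assms by (intro sum_mono2) auto
  finally show ?thesis .
qed

section \<open>Growing two disjoint cores\<close>

text \<open>
  The first and the last arc are loops and never available; removing a copy of one of them
  from \<open>x\<close> leaves \<open>x\<close> unchanged.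
\<close>

locale arc_array = rooted_net "{..<n}" "{..<m}" src dst r
  for n m :: nat and src dst :: "nat \<Rightarrow> nat" and r :: nat +
  fixes d :: "nat \<Rightarrow> nat"
  assumes m_pos: "0 < m" and d_first: "d 0 = 0" and d_last: "d (m - 1) = 0"
    and simple: "inj_on (\<lambda>i. (src i, dst i)) {..<m}"
begin

text \<open>Parallel copies count once: an arc index is one candidate whatever its multiplicity, and
  candidates are what a guess ranges over.\<close>

definition outdeg :: "nat \<Rightarrow> nat" where
  "outdeg u = card {i. i < m \<and> src i = u \<and> 0 < d i}"

definition big :: "nat \<Rightarrow> nat set" where
  "big B = {u. u < n \<and> B < outdeg u}"

definition reach_del :: "(nat \<Rightarrow> nat) \<Rightarrow> nat \<Rightarrow> nat set" where
  "reach_del x i = reach (x(i := x i - 1)) {r}"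

text \<open>
  As arc 0 is never used, the test of \<open>i = 0\<close> concerns the set of all vertices reached by \<open>x\<close>;
  for it the bound \<open>k\<close> is replaced by \<open>h\<close>.
\<close>

definition bad :: "nat \<Rightarrow> nat \<Rightarrow> nat \<Rightarrow> (nat \<Rightarrow> nat) \<Rightarrow> nat \<Rightarrow> bool" where
  "bad h k B x i \<longleftrightarrow> card (reach_del x i) < (if i = 0 then h else k) \<and> reach_del x i \<inter> big B = {}"

text \<open>The last bad index is taken because the program overwrites the recorded set at every bad
  index of an increasing loop.\<close>

definition violator :: "nat \<Rightarrow> nat \<Rightarrow> nat \<Rightarrow> (nat \<Rightarrow> nat) \<Rightarrow> nat set option" where
  "violator h k B x = (if \<exists>i<m. bad h k B x i
     then Some (reach_del x (Max {i. i < m \<and> bad h k B x i})) else None)"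

definition candidate :: "(nat \<Rightarrow> nat) \<Rightarrow> (nat \<Rightarrow> nat) \<Rightarrow> nat set \<Rightarrow> nat \<Rightarrow> bool" where
  "candidate x y Z i \<longleftrightarrow> src i \<in> Z \<and> dst i \<notin> Z \<and> x i + y i < d i \<and> extendable d (x(i := Suc (x i))) y"

definition candidates :: "(nat \<Rightarrow> nat) \<Rightarrow> (nat \<Rightarrow> nat) \<Rightarrow> nat set \<Rightarrow> nat list" where
  "candidates x y Z = filter (candidate x y Z) [0..<m]"

definition augment :: "nat \<Rightarrow> (nat \<Rightarrow> nat) \<Rightarrow> (nat \<Rightarrow> nat) \<Rightarrow> nat set \<Rightarrow> (nat \<Rightarrow> nat)" where
  "augment c x y Z = (if c < length (candidates x y Z)
     then x(candidates x y Z ! c := Suc (x (candidates x y Z ! c))) else x)"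

definition repair :: "nat \<Rightarrow> nat \<Rightarrow> nat \<Rightarrow> nat \<Rightarrow> (nat \<Rightarrow> nat) \<Rightarrow> (nat \<Rightarrow> nat) \<Rightarrow> (nat \<Rightarrow> nat)" where
  "repair h k B c x y = (case violator h k B x of None \<Rightarrow> x | Some Z \<Rightarrow> augment c x y Z)"

lemma set_candidates: "set (candidates x y Z) = {i. i < m \<and> candidate x y Z i}"
  by (auto simp: candidates_def)

lemma repair_cases:
  obtains (none) "violator h k B x = None" "repair h k B c x y = x"
  | (stuck) Z where "violator h k B x = Some Z" "length (candidates x y Z) \<le> c" "repair h k B c x y = x"
  | (add) Z i where "violator h k B x = Some Z" "i < m" "candidate x y Z i"
      "repair h k B c x y = x(i := Suc (x i))"
proof (cases "violator h k B x")
  case None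
  then show thesis using none by (simp add: repair_def)
next
  case (Some Z)
  show thesis
  proof (cases "c < length (candidates x y Z)")
    case True
    then have "candidates x y Z ! c \<in> set (candidates x y Z)" by (rule nth_mem)
    then show thesis using add[OF Some] True Some by (auto simp: set_candidates repair_def augment_def)
  next
    case False
    then show thesis using stuck[OF Some] Some by (simp add: repair_def augment_def)
  qed
qed

lemma root_less: "r < n"
  using root_in by simp

lemma reach_del_subset: "reach_del x i \<subseteq> reach x {r}"
  unfolding reach_del_def by (rule reach_mono) (auto split: if_splits)

lemma reach_del_eq: "x i = 0 \<Longrightarrow> reach_del x i = reach x {r}"
  unfolding reach_del_def by (rule arg_cong[of _ _ "\<lambda>y. reach y {r}"]) auto

lemma reach_del_mono: "(\<And>i. i < m \<Longrightarrow> x i \<le> y i) \<Longrightarrow> reach_del x i \<subseteq> reach_del y i"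
  unfolding reach_del_def by (rule reach_mono) (fastforce split: if_splits)+

lemma root_reach: "r \<in> reach x {r}" "r \<in> reach_del x i"
  unfolding reach_del_def by (auto intro: reach.base)

lemma reach_bounds: "reach x {r} \<subseteq> {..<n}" "reach_del x i \<subseteq> {..<n}"
    "finite (reach x {r})" "finite (reach_del x i)"
  unfolding reach_del_def using root_in by (intro reach_subset finite_reach; simp)+

lemma outdeg_le: "outdeg u \<le> n"
proof -
  have "inj_on dst {i. i < m \<and> src i = u \<and> 0 < d i}"
    using simple by (auto simp: inj_on_def)
  then have "outdeg u \<le> card {..<n}"
    unfolding outdeg_def using dst_in by (intro card_inj_on_le[of dst]) auto
  then show ?thesis by simp
qed

text \<open>No out-degree exceeds the number of vertices, so passing \<open>n\<close> for
  \<open>B\<close> switches the out-degree test off.\<close>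

lemma big_n: "big n = {}"
  using outdeg_le by (auto simp: big_def not_less)

lemma violator_None: "violator h k B x = None \<longleftrightarrow> (\<forall>i<m. \<not> bad h k B x i)"
  by (simp add: violator_def)

lemma violator_Some:
  assumes "violator h k B x = Some Z"
  obtains j where "j < m" "bad h k B x j" "Z = reach_del x j"
proof -
  let ?M = "{i. i < m \<and> bad h k B x i}"
  have "?M \<noteq> {}" "finite ?M" using assms by (auto simp: violator_def split: if_splits)
  then have "Max ?M \<in> ?M" by (rule Max_in[rotated])
  then show thesis using that[of "Max ?M"] assms by (auto simp: violator_def split: if_splits)
qed

text \<open>Index \<open>m - 1\<close> is the largest one and carries no arc, so its set is all of
  \<open>reach x {r}\<close>. The maximum in \<open>violator\<close> thus prefers the whole reached
  set to the set of a single deletion; \<open>potential_decreases\<close> depends on this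
  order.\<close>

lemma violator_Some_reach:
  assumes "violator h k B x = Some Z" "k \<le> h" "x (m - 1) = 0"
    and "card (reach x {r}) < k" "reach x {r} \<inter> big B = {}"
  shows "Z = reach x {r}"
proof -
  let ?M = "{i. i < m \<and> bad h k B x i}"
  define l where "l = m - 1"
  have eq: "reach_del x l = reach x {r}" unfolding l_def using assms(3) by (rule reach_del_eq)
  have "card (reach x {r}) < (if l = 0 then h else k)" using assms(2,4) by simp
  then have "bad h k B x l" unfolding bad_def eq using assms(5) by blast
  then have "l \<in> ?M" using m_pos by (simp add: l_def)
  then have "Max ?M = l" unfolding l_def by (intro Max_eqI) auto
  then show ?thesis using assms(1) eq by (auto simp: violator_def split: if_splits)
qed

text \<open>More arcs make the sets \<open>reach_del\<close> larger, which helps both against the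
  size test and towards a big vertex. Hence later phases never undo an earlier one.\<close>

lemma violator_mono:
  assumes "violator h k B x = None" "\<And>i. i < m \<Longrightarrow> x i \<le> y i"
  shows "violator h k B y = None"
  unfolding violator_None
proof (intro allI impI)
  fix i assume i: "i < m"
  have sub: "reach_del x i \<subseteq> reach_del y i" using assms(2) by (rule reach_del_mono)
  then have "card (reach_del x i) \<le> card (reach_del y i)" by (rule card_mono[OF reach_bounds(4)])
  then show "\<not> bad h k B y i" using assms(1) i sub unfolding violator_None bad_def by fastforce
qed

lemma violator_None_solution:
  assumes "violator n k n x = None" "x 0 = 0" "k \<le> n"
  shows "reach x {r} = {..<n}" "robust k x"
proof -
  have nb: "(if i = 0 then n else k) \<le> card (reach_del x i)" if "i < m" for i
    using assms(1) that unfolding violator_None bad_def big_n by (simp add: not_less)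
  have "n \<le> card (reach x {r})" using nb[OF m_pos] reach_del_eq[of x 0] assms(2) by simp
  then show "reach x {r} = {..<n}" using reach_bounds(1) by (intro card_seteq) auto
  have "k \<le> card (reach_del x i)" if "i < m" for i
    using nb[OF that] assms(3) by (cases "i = 0") auto
  then show "robust k x" unfolding robust_def reach_del_def[symmetric] by simp
qed

lemma candidate_src:
  assumes "violator h k B x = Some Z" "candidate x y Z i"
  shows "src i \<in> reach x {r}"
  using assms reach_del_subset unfolding candidate_def by (metis subsetD violator_Some)

section \<open>A potential that bounds the number of repairs\<close>

definition deficit :: "nat \<Rightarrow> nat \<Rightarrow> nat set \<Rightarrow> nat" where
  "deficit k B Z = (if Z \<inter> big B = {} then k - card Z else 0)"

text \<open>
  A repair adds a summand for the new arc, equal to the old deficit of \<open>reach x {r}\<close>. The weight \<open>k\<close>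
  of the first summand pays for it.
\<close>

definition potential :: "nat \<Rightarrow> nat \<Rightarrow> (nat \<Rightarrow> nat) \<Rightarrow> nat" where
  "potential k B x = k * deficit k B (reach x {r})
     + (\<Sum>i<m. if 0 < x i then deficit k B (reach_del x i) else 0)"

lemma deficit_antimono: "Z \<subseteq> Z' \<Longrightarrow> finite Z' \<Longrightarrow> deficit k B Z' \<le> deficit k B Z"
  unfolding deficit_def using card_mono[of Z' Z] by auto

lemma deficit_less:
  "Z \<subset> Z' \<Longrightarrow> finite Z' \<Longrightarrow> 0 < deficit k B Z \<Longrightarrow> deficit k B Z' < deficit k B Z"
  unfolding deficit_def using psubset_card_mono[of Z' Z] by (auto split: if_splits)

text \<open>Every used arc contributes at most \<open>k\<close>. For the empty core the bound is
  \<open>k * k\<close>, the number of guided rounds; for a core of \<open>k * k\<close> arcs it is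
  the length of the second phase.\<close>

lemma potential_le: "potential k B x \<le> k * k + k * (\<Sum>i<m. x i)"
proof -
  have le: "deficit k B Z \<le> k * c" if "0 < c" for Z c
    using that by (cases c) (auto simp: deficit_def)
  have "deficit k B (reach x {r}) \<le> k" by (simp add: deficit_def)
  then show ?thesis
    unfolding potential_def sum_distrib_left using le
    by (intro add_mono mult_le_mono2 sum_mono) auto
qed

text \<open>If arc \<open>j\<close> is in use, its set has a summand of its own; otherwise its set
  is the whole reached set, counted in the first summand. Hence potential 0 certifies the end of a
  phase.\<close>

lemma violator_pos_potential:
  assumes "violator k k B x = Some Z"
  shows "0 < potential k B x"
proof -
  obtain j where j: "j < m" "bad k k B x j" "Z = reach_del x j" by (rule violator_Some[OF assms])
  then have pos: "0 < deficit k B (reach_del x j)" "0 < k" by (auto simp: bad_def deficit_def)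
  show ?thesis
  proof (cases "x j = 0")
    case True
    then show ?thesis using pos by (simp add: reach_del_eq potential_def)
  next
    case False
    then have "0 < (\<Sum>i<m. if 0 < x i then deficit k B (reach_del x i) else 0)"
      using pos j(1) by (intro sum_pos2[of _ j]) auto
    then show ?thesis by (simp add: potential_def)
  qed
qed

lemma potential_decreases:
  assumes viol: "violator k k B x = Some Z" and x: "grown x" "x (m - 1) = 0"
    and i: "i < m" "src i \<in> Z" "dst i \<notin> Z"
  shows "potential k B (x(i := Suc (x i))) < potential k B x"
proof -
  let ?x = "x(i := Suc (x i))" and ?R = "reach x {r}"
  obtain j where j: "j < m" "bad k k B x j" "Z = reach_del x j" by (rule violator_Some[OF viol])
  have cardZ: "card Z < k" "Z \<inter> big B = {}" and defZ: "0 < deficit k B Z"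
    using j by (auto simp: bad_def deficit_def)
  have src_R: "src i \<in> ?R" using i(2) reach_del_subset j(3) by blast
  have R': "reach ?x {r} = insert (dst i) ?R" using x(1) i(1) src_R by (intro reach_add_arc) auto
  define t where "t x l = (if 0 < x l then deficit k B (reach_del x l) else 0)" for x :: "nat \<Rightarrow> nat" and l
  have pot: "potential k B x = k * deficit k B (reach x {r}) + (t x i + (\<Sum>l\<in>{..<m} - {i}. t x l))" for x
    unfolding potential_def t_def[symmetric] using i(1) by (subst sum.remove[of _ i]) auto
  have t_le: "t ?x l \<le> t x l" if "l \<noteq> i" for l
    using that unfolding t_def by (auto intro!: deficit_antimono reach_del_mono reach_bounds)
  have rest: "(\<Sum>l\<in>{..<m} - {i}. t ?x l) \<le> (\<Sum>l\<in>{..<m} - {i}. t x l)"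
    using t_le by (intro sum_mono) auto
  have del_i: "reach_del ?x i = ?R" unfolding reach_del_def by simp
  have tx: "t ?x i = deficit k B ?R" by (simp add: t_def del_i)
  have def_R': "deficit k B (reach ?x {r}) \<le> deficit k B ?R"
    unfolding R' by (rule deficit_antimono) (auto simp: reach_bounds)
  show ?thesis
  proof (cases "card ?R < k \<and> ?R \<inter> big B = {}")
    case True
    then have Z: "Z = ?R" using violator_Some_reach[OF viol] x(2) by simp
    then have "deficit k B (reach ?x {r}) < deficit k B ?R"
      unfolding R' using i(3) defZ by (intro deficit_less) (auto simp: reach_bounds)
    then have "Suc (deficit k B (reach ?x {r})) \<le> deficit k B ?R" by simp
    then have "k * Suc (deficit k B (reach ?x {r})) \<le> k * deficit k B ?R" by (rule mult_le_mono2)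
    \<comment> \<open>The root is always reached, so this deficit is strictly below \<open>k\<close>
      and the gain of \<open>k\<close> in the first summand outweighs the new summand.\<close>
    moreover have "0 < card ?R" using root_reach(1) reach_bounds(3) by (metis card_gt_0_iff empty_iff)
    then have "deficit k B ?R < k" using True by (simp add: deficit_def)
    ultimately show ?thesis unfolding pot tx using rest by simp
  next
    case False
    \<comment> \<open>The reached set has no deficit, so the new arc costs nothing and the gain has
      to come from \<open>j\<close>: its summand vanishes if a copy of \<open>j\<close> itself is
      added, and otherwise drops because the set belonging to \<open>j\<close> grows.\<close>
    then have R0: "deficit k B ?R = 0" by (auto simp: deficit_def)
    then have xj: "0 < x j" using defZ j(3) reach_del_eq[of x j] by (cases "x j = 0") auto
    show ?thesis
    proof (cases "i = j")
      case True
      then have "0 < t x i" using xj defZ j(3) by (simp add: t_def)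
      then show ?thesis unfolding pot tx using R0 def_R' rest by simp
    next
      case False
      have "Z \<subset> reach_del ?x j"
      proof
        show "Z \<subseteq> reach_del ?x j" unfolding j(3) by (rule reach_del_mono) auto
        then have "src i \<in> reach_del ?x j" using i(2) by blast
        then have "dst i \<in> reach_del ?x j"
          unfolding reach_del_def using i(1) False by (intro reach.step) auto
        then show "Z \<noteq> reach_del ?x j" using i(3) by blast
      qed
      then have "deficit k B (reach_del ?x j) < deficit k B Z"
        using defZ by (intro deficit_less) (auto simp: reach_bounds)
      then have "t ?x j < t x j" using xj False j(3) by (simp add: t_def)
      then have "(\<Sum>l\<in>{..<m} - {i}. t ?x l) < (\<Sum>l\<in>{..<m} - {i}. t x l)"
        using t_le False j(1) by (intro sum_strict_mono_ex1) auto
      then show ?thesis unfolding pot tx using R0 def_R' by simp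
    qed
  qed
qed

section \<open>A single repair in each of the three phases\<close>

definition state :: "(nat \<Rightarrow> nat) \<Rightarrow> (nat \<Rightarrow> nat) \<Rightarrow> bool" where
  "state x y \<longleftrightarrow> grown x \<and> grown y \<and> (\<forall>i<m. x i + y i \<le> d i)"

lemma state_commute: "state x y \<longleftrightarrow> state y x"
  by (auto simp: state_def add.commute)

lemma state_loops: "state x y \<Longrightarrow> x 0 = 0 \<and> x (m - 1) = 0"
  unfolding state_def using m_pos d_first d_last
  by (metis add_is_0 diff_less le_zero_eq zero_less_one)

lemma state_add:
  assumes "state x y" "violator h k B x = Some Z" "i < m" "candidate x y Z i"
  shows "state (x(i := Suc (x i))) y"
  using assms grown_add_arc[of x i] candidate_src[OF assms(2,4)]
  by (auto simp: state_def candidate_def)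

lemma state_repair: "state x y \<Longrightarrow> state (repair h k B c x y) y"
  by (cases rule: repair_cases[of h k B x c y]) (auto intro: state_add)

lemma sum_add_arc: "i < m \<Longrightarrow> (\<Sum>l<m. (x(i := Suc (x i))) l) = Suc (\<Sum>l<m. x l)"
  by (simp add: sum.remove[of "{..<m}" i] del: fun_upd_apply) (simp add: fun_upd_apply cong: sum.cong_simp)

lemma sum_repair: "(\<Sum>l<m. repair h k B c x y l) \<le> Suc (\<Sum>l<m. x l)"
  by (cases rule: repair_cases[of h k B x c y]) (auto simp: sum_add_arc simp del: fun_upd_apply)

lemma repair_mono: "x i \<le> repair h k B c x y i"
  by (cases rule: repair_cases[of h k B x c y]) auto

text \<open>In \<open>X\<close> at least \<open>k\<close> vertices survive the deletion of
  \<open>j\<close>, hence some arc of the reduced \<open>X\<close> leaves \<open>Z\<close>. The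
  reduced \<open>x\<close> does not contain it, since \<open>Z\<close> is closed under its arcs; so
  \<open>X\<close> has a copy to spare, and \<open>X\<close> and \<open>Y\<close> witness that
  adding it keeps Edmonds' condition. All tails in \<open>Z\<close> have out-degree at most
  \<open>B\<close>, which bounds the position of this arc among the candidates.\<close>

lemma violator_step:
  assumes sol: "\<And>i. i < m \<Longrightarrow> X i + Y i \<le> d i" "reach X {r} = {..<n}" "reach Y {r} = {..<n}" "robust k X"
    and st: "state x y" "\<And>i. i < m \<Longrightarrow> x i \<le> X i" "\<And>i. i < m \<Longrightarrow> y i \<le> Y i"
    and viol: "violator k k B x = Some Z"
  obtains c i where "c < k * B" "i < m" "candidate x y Z i" "x i < X i"
    "repair k k B c x y = x(i := Suc (x i))"
proof -
  obtain j where j: "j < m" "bad k k B x j" "Z = reach_del x j" by (rule violator_Some[OF viol])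
  have Z: "card Z < k" "Z \<inter> big B = {}" "finite Z" "Z \<subseteq> {..<n}"
    using j by (auto simp: bad_def reach_bounds)
  have "\<exists>i<m. 0 < (X(j := X j - 1)) i \<and> src i \<in> Z \<and> dst i \<notin> Z"
  proof (rule ccontr)
    assume *: "\<not> ?thesis"
    have "reach (X(j := X j - 1)) {r} \<subseteq> Z"
      by (rule reach_least) (use * root_reach(2) j(3) in auto)
    then have "card (reach_del X j) \<le> card Z" unfolding reach_del_def by (rule card_mono[OF Z(3)])
    moreover have "k \<le> card (reach_del X j)"
      using sol(4) j(1) unfolding robust_def reach_del_def[symmetric] by simp
    ultimately show False using Z(1) by simp
  qed
  then obtain i where i: "i < m" "0 < (X(j := X j - 1)) i" "src i \<in> Z" "dst i \<notin> Z" by blast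
  have "\<not> 0 < (x(j := x j - 1)) i"
  proof
    assume "0 < (x(j := x j - 1)) i"
    then have "dst i \<in> reach_del x j"
      using i(1,3) unfolding j(3) reach_del_def by (intro reach.step) auto
    then show False using i(4) j(3) by simp
  qed
  then have xi: "x i < X i" using i(2) by (auto split: if_splits)
  have srcR: "src i \<in> reach x {r}" using i(3) reach_del_subset unfolding j(3) by blast
  have "x i + y i < d i" using xi sol(1)[OF i(1)] st(3)[OF i(1)] by linarith
  moreover have "extendable d (x(i := Suc (x i))) y"
  proof (rule extendable_if_solution[of _ X _ Y])
    show "grown (x(i := Suc (x i)))" using st(1) i(1) srcR by (intro grown_add_arc) (auto simp: state_def)
  qed (use st sol xi in \<open>auto simp: state_def\<close>)
  ultimately have cand: "candidate x y Z i" using i by (simp add: candidate_def)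
  then have "i \<in> set (candidates x y Z)" using i(1) by (simp add: set_candidates)
  then obtain c where c: "c < length (candidates x y Z)" "candidates x y Z ! c = i"
    by (auto simp: in_set_conv_nth)
  have "length (candidates x y Z) = card (set (candidates x y Z))"
    by (rule distinct_card[symmetric]) (simp add: candidates_def)
  also have "\<dots> \<le> card (\<Union>z\<in>Z. {i. i < m \<and> src i = z \<and> 0 < d i})"
    using Z(3) by (intro card_mono) (auto simp: set_candidates candidate_def)
  also have "\<dots> \<le> (\<Sum>z\<in>Z. outdeg z)" unfolding outdeg_def using Z(3) by (rule card_UN_le)
  also have "\<dots> \<le> (\<Sum>z\<in>Z. B)" using Z by (intro sum_mono) (auto simp: big_def not_less)
  also have "\<dots> \<le> k * B" using Z(1) by simp
  finally have "c < k * B" using c(1) by simp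
  then show thesis using that[of c i] i(1) cand xi c viol by (simp add: repair_def augment_def)
qed

text \<open>The disjunction with \<open>t\<close> and \<open>p\<close> is a countdown: a round
  either lowers the potential or has nothing to repair. At \<open>t = p\<close> the potential is 0,
  and by \<open>violator_pos_potential\<close> no violator is left.\<close>

lemma guided_repair:
  assumes sol: "\<And>i. i < m \<Longrightarrow> X i + Y i \<le> d i" "reach X {r} = {..<n}" "reach Y {r} = {..<n}" "robust k X"
    and st: "state x y" "\<And>i. i < m \<Longrightarrow> x i \<le> X i" "\<And>i. i < m \<Longrightarrow> y i \<le> Y i"
    and pot: "potential k B x + t \<le> p \<or> violator k k B x = None" and pos: "0 < k * B"
  obtains c where "c < k * B" "\<And>i. i < m \<Longrightarrow> repair k k B c x y i \<le> X i"
    "potential k B (repair k k B c x y) + Suc t \<le> p \<or> violator k k B (repair k k B c x y) = None"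
proof (cases "violator k k B x")
  case None
  then show thesis using that[of 0] pos st(2) by (simp add: repair_def)
next
  case (Some Z)
  obtain c i where ci: "c < k * B" "i < m" "candidate x y Z i" "x i < X i"
    "repair k k B c x y = x(i := Suc (x i))"
    using violator_step[OF sol st Some] by blast
  have "potential k B (x(i := Suc (x i))) < potential k B x"
    using ci st(1) state_loops[OF st(1)]
    by (intro potential_decreases[OF Some]) (auto simp: state_def candidate_def)
  then show thesis using that[OF ci(1)] ci st(2) pot Some by auto
qed

text \<open>Since \<open>x\<close> has no violator for \<open>B\<close>, the set \<open>Z\<close>
  contains a vertex of out-degree above \<open>B\<close>. At most \<open>card ?R\<close> of its
  out-arcs end in the reached set \<open>?R\<close>, and no more are in use than the cores have
  arcs. As \<open>card ?R\<close> is at most 1 plus the size of \<open>x\<close>, more than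
  \<open>card ?R\<close> available arcs leave \<open>?R\<close>, as \<open>extendable_star\<close>
  requires. The factor 3 counts \<open>x\<close> once for its used arcs and twice through
  \<open>card ?R\<close>.\<close>

lemma star_candidate:
  assumes st: "state x y" and ext: "extendable d x y"
    and none: "violator k k B x = None" and viol: "violator k k n x = Some Z"
    and B: "1 + 3 * (\<Sum>i<m. x i) + (\<Sum>i<m. y i) < B"
  obtains i where "i < m" "candidate x y Z i"
proof -
  obtain j where j: "j < m" "bad k k n x j" "Z = reach_del x j" by (rule violator_Some[OF viol])
  then have "Z \<inter> big B \<noteq> {}" using none unfolding violator_None bad_def big_n by auto
  then obtain z where z: "z \<in> Z" "z \<in> big B" by blast
  let ?R = "reach x {r}"
  have ZR: "Z \<subseteq> ?R" unfolding j(3) by (rule reach_del_subset)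
  define Q where "Q = {i. i < m \<and> src i = z \<and> x i + y i < d i \<and> dst i \<notin> ?R}"
  define In where "In = {i. i < m \<and> src i = z \<and> dst i \<in> ?R}"
  define U where "U f = {i \<in> {..<m}. 0 < f i}" for f :: "nat \<Rightarrow> nat"
  have "?R \<subseteq> insert r (dst ` U x)" unfolding U_def by (rule reach_least) auto
  then have "card ?R \<le> card (insert r (dst ` U x))" by (rule card_mono[rotated]) (simp add: U_def)
  also have "\<dots> \<le> Suc (card (dst ` U x))" by (simp add: card_insert_if U_def)
  also have "\<dots> \<le> Suc (card (U x))" by (simp add: card_image_le U_def)
  finally have R: "card ?R \<le> Suc (card (U x))" .
  have U: "card (U f) \<le> (\<Sum>i<m. f i)" for f unfolding U_def by (rule card_filter_le_sum) simp
  have "inj_on dst In" using simple by (auto simp: In_def inj_on_def)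
  then have In: "card In \<le> card ?R" by (rule card_inj_on_le) (auto simp: In_def reach_bounds)
  have fin: "finite Q" "finite In" "finite (U f)" for f by (auto simp: Q_def In_def U_def)
  have "{i. i < m \<and> src i = z \<and> 0 < d i} \<subseteq> Q \<union> (In \<union> (U x \<union> U y))"
    by (auto simp: Q_def In_def U_def)
  then have "outdeg z \<le> card (Q \<union> (In \<union> (U x \<union> U y)))"
    unfolding outdeg_def using fin by (intro card_mono) auto
  also have "\<dots> \<le> card Q + (card In + (card (U x) + card (U y)))"
    by (meson add_left_mono card_Un_le order_trans)
  finally have "card ?R < card Q"
    using z(2) B R In U[of x] U[of y] unfolding big_def by simp
  then obtain i where i: "i \<in> Q" "extendable d (x(i := Suc (x i))) y"
    using extendable_star[OF ext, of z Q] st z(1) ZR by (auto simp: state_def Q_def)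
  then show thesis using that[of i] z(1) ZR by (auto simp: candidate_def Q_def)
qed

text \<open>Once Edmonds' condition replaces the guiding solution, any candidate will do; fixing
  guess 0 avoids an enumeration.\<close>

lemma first_candidate:
  assumes "violator h k B x = Some Z" "i < m" "candidate x y Z i"
  obtains i' where "i' < m" "candidate x y Z i'" "repair h k B 0 x y = x(i' := Suc (x i'))"
proof -
  have "i \<in> set (candidates x y Z)" using assms by (simp add: set_candidates)
  then have ne: "0 < length (candidates x y Z)" by (cases "candidates x y Z") auto
  then have "candidates x y Z ! 0 \<in> set (candidates x y Z)" by (rule nth_mem)
  then show thesis
    using that[of "candidates x y Z ! 0"] assms(1) ne by (auto simp: set_candidates repair_def augment_def)
qed

lemma star_repair:
  assumes st: "state x y" and ext: "extendable d x y"
    and none: "violator k k B x = None"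
    and B: "1 + 3 * (\<Sum>i<m. x i) + (\<Sum>i<m. y i) < B"
    and pot: "potential k n x + t \<le> p \<or> violator k k n x = None"
  shows "extendable d (repair k k n 0 x y) y"
    "potential k n (repair k k n 0 x y) + Suc t \<le> p \<or> violator k k n (repair k k n 0 x y) = None"
proof -
  have "extendable d (repair k k n 0 x y) y \<and>
    (potential k n (repair k k n 0 x y) + Suc t \<le> p \<or> violator k k n (repair k k n 0 x y) = None)"
  proof (cases "violator k k n x")
    case None
    then show ?thesis using ext by (simp add: repair_def)
  next
    case (Some Z)
    obtain i0 where i0: "i0 < m" "candidate x y Z i0" by (rule star_candidate[OF st ext none Some B])
    obtain i where i: "i < m" "candidate x y Z i" "repair k k n 0 x y = x(i := Suc (x i))"
      by (rule first_candidate[OF Some i0])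
    have "potential k n (x(i := Suc (x i))) < potential k n x"
      using i st state_loops[OF st] by (intro potential_decreases[OF Some]) (auto simp: state_def candidate_def)
    then show ?thesis using i Some pot by (auto simp: candidate_def)
  qed
  then show "extendable d (repair k k n 0 x y) y"
    "potential k n (repair k k n 0 x y) + Suc t \<le> p \<or> violator k k n (repair k k n 0 x y) = None"
    by (rule conjunct1, rule conjunct2)
qed

text \<open>After the second phase only index 0, whose threshold is now \<open>n\<close>, can be
  bad, so \<open>Z\<close> is the whole reached set. The arc supplied by Lovasz's step leads to a
  new vertex; thus \<open>n\<close> rounds suffice.\<close>

lemma span_repair:
  assumes st: "state x y" and ext: "extendable d x y"
    and none: "violator k k n x = None"
    and card: "t \<le> card (reach x {r}) \<or> violator n k n x = None"
  shows "extendable d (repair n k n 0 x y) y"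
    "Suc t \<le> card (reach (repair n k n 0 x y) {r}) \<or> violator n k n (repair n k n 0 x y) = None"
proof -
  have "extendable d (repair n k n 0 x y) y \<and>
    (Suc t \<le> card (reach (repair n k n 0 x y) {r}) \<or> violator n k n (repair n k n 0 x y) = None)"
  proof (cases "violator n k n x")
    case None
    then show ?thesis using ext by (simp add: repair_def)
  next
    case (Some Z)
    obtain j where j: "j < m" "bad n k n x j" "Z = reach_del x j" by (rule violator_Some[OF Some])
    have "j = 0"
    proof (rule ccontr)
      assume "j \<noteq> 0"
      then have "bad k k n x j" using j(2) by (simp add: bad_def)
      then show False using j(1) none by (simp add: violator_None)
    qed
    have "x 0 = 0" using state_loops[OF st] by blast
    then have Z: "Z = reach x {r}" using j(3) unfolding \<open>j = 0\<close> by (simp add: reach_del_eq)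
    have cardR: "card (reach x {r}) < n" using j(2,3) Z \<open>j = 0\<close> by (simp add: bad_def)
    have ne: "reach x {r} \<noteq> {..<n}" using cardR by (metis card_lessThan less_irrefl)
    have "grown x" using st by (simp add: state_def)
    from extendable_leave[OF ext this ne] obtain i0 where "i0 \<in> {..<m}" "src i0 \<in> reach x {r}"
      "dst i0 \<notin> reach x {r}" "x i0 + y i0 < d i0" "extendable d (x(i0 := Suc (x i0))) y" .
    then have i0: "i0 < m" "candidate x y Z i0" unfolding Z by (auto simp: candidate_def)
    obtain i where i: "i < m" "candidate x y Z i" "repair n k n 0 x y = x(i := Suc (x i))"
      by (rule first_candidate[OF Some i0])
    have "reach (x(i := Suc (x i))) {r} = insert (dst i) (reach x {r})"
      using i st Z by (intro reach_add_arc) (auto simp: state_def candidate_def)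
    then have "card (reach (x(i := Suc (x i))) {r}) = Suc (card (reach x {r}))"
      using i(2) Z by (simp add: reach_bounds candidate_def)
    then show ?thesis using i Some card by (auto simp: candidate_def)
  qed
  then show "extendable d (repair n k n 0 x y) y"
    "Suc t \<le> card (reach (repair n k n 0 x y) {r}) \<or> violator n k n (repair n k n 0 x y) = None"
    by (rule conjunct1, rule conjunct2)
qed

section \<open>Complete runs: soundness for all guesses, completeness for some guesses\<close>

definition repair_both :: "nat \<Rightarrow> nat \<Rightarrow> nat \<Rightarrow> nat \<Rightarrow> nat \<Rightarrow>
    (nat \<Rightarrow> nat) \<times> (nat \<Rightarrow> nat) \<Rightarrow> (nat \<Rightarrow> nat) \<times> (nat \<Rightarrow> nat)" where
  "repair_both h k B c c' = (\<lambda>(x, y). let x' = repair h k B c x y in (x', repair h k B c' y x'))"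

text \<open>
  In the first phase the guesses keep both cores inside a solution, hence extendable; in the
  second one out-degrees no longer count and candidate 0 is taken; in the third one \<open>h = n\<close>
  forces spanning cores.
\<close>

primrec run :: "nat \<Rightarrow> nat \<Rightarrow> nat \<Rightarrow> nat \<Rightarrow> (nat \<Rightarrow> nat) \<Rightarrow> nat \<Rightarrow> (nat \<Rightarrow> nat) \<times> (nat \<Rightarrow> nat)" where
  "run k B t1 t2 g 0 = (\<lambda>_. 0, \<lambda>_. 0)"
| "run k B t1 t2 g (Suc t) = repair_both (if t < t2 then k else n) k (if t < t1 then B else n)
     (g (t + t)) (g (t + t + 1)) (run k B t1 t2 g t)"

definition accepting :: "nat \<Rightarrow> (nat \<Rightarrow> nat) \<times> (nat \<Rightarrow> nat) \<Rightarrow> bool" where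
  "accepting k = (\<lambda>(x, y). violator n k n x = None \<and> violator n k n y = None)"

lemma run_cong:
  assumes "\<And>j. j < t + t \<Longrightarrow> g j = g' j"
  shows "run k B t1 t2 g t = run k B t1 t2 g' t"
  using assms by (induction t) simp_all

lemma grown_0: "grown (\<lambda>_. 0)"
  by (simp add: grown_def)

lemma state_run: "case run k B t1 t2 g t of (x, y) \<Rightarrow> state x y"
proof (induction t)
  case 0
  then show ?case by (simp add: state_def grown_0)
next
  case (Suc t)
  obtain x y where xy: "run k B t1 t2 g t = (x, y)" by fastforce
  let ?h = "if t < t2 then k else n" and ?B = "if t < t1 then B else n"
  have "state x y" using Suc xy by simp
  then have "state (repair ?h k ?B (g (t + t)) x y) y" by (rule state_repair)
  then have "state y (repair ?h k ?B (g (t + t)) x y)" by (simp only: state_commute)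
  then have "state (repair ?h k ?B (g (t + t + 1)) y (repair ?h k ?B (g (t + t)) x y)) (repair ?h k ?B (g (t + t)) x y)"
    by (rule state_repair)
  then show ?case unfolding run.simps xy repair_both_def Let_def by (simp only: prod.case state_commute)
qed

text \<open>Every repair keeps \<open>state\<close>, whatever the guesses are, and the final test
  alone certifies the result. Wrong guesses can therefore only miss a solution.\<close>

theorem run_sound:
  assumes "run k B t1 t2 g t = (x, y)" "accepting k (x, y)" "k \<le> n" "2 * k \<le> n + 1"
  shows "\<And>i. i < m \<Longrightarrow> x i + y i \<le> d i"
    "cut_condition (\<lambda>i. (n - k) * x i)" "cut_condition (\<lambda>i. (n - k) * y i)"
proof -
  have st: "state x y" using state_run[of k B t1 t2 g t] assms(1) by simp
  then show "\<And>i. i < m \<Longrightarrow> x i + y i \<le> d i" by (simp add: state_def)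
  have "x 0 = 0" "y 0 = 0" using state_loops[OF st] state_loops[OF st[unfolded state_commute[of x]]] by auto
  then show "cut_condition (\<lambda>i. (n - k) * x i)" "cut_condition (\<lambda>i. (n - k) * y i)"
    using violator_None_solution[of k x] violator_None_solution[of k y] assms(2-4)
      cut_condition_iff_robust[of k x] cut_condition_iff_robust[of k y]
    by (auto simp: accepting_def)
qed

definition guided :: "nat \<Rightarrow> nat \<Rightarrow> (nat \<Rightarrow> nat) \<Rightarrow> nat \<Rightarrow> (nat \<Rightarrow> nat) \<Rightarrow> bool" where
  "guided k B X t x \<longleftrightarrow> (\<forall>i<m. x i \<le> X i) \<and> (\<Sum>i<m. x i) \<le> t \<and>
     (potential k B x + t \<le> k * k \<or> violator k k B x = None)"

text \<open>The guesses are chosen round by round. The second core is repaired against the already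
  enlarged first one, which still lies below \<open>X\<close>, so one fixed solution guides
  both.\<close>

lemma run_guided:
  assumes sol: "\<And>i. i < m \<Longrightarrow> X i + Y i \<le> d i" "reach X {r} = {..<n}" "reach Y {r} = {..<n}"
      "robust k X" "robust k Y"
    and pos: "0 < k * B"
    and t: "t \<le> t1" "t \<le> t2"
  obtains g x y where "\<And>j. g j < k * B" "\<And>j. t + t \<le> j \<Longrightarrow> g j = 0"
    "run k B t1 t2 g t = (x, y)" "guided k B X t x" "guided k B Y t y"
  using t
proof (induction t arbitrary: thesis)
  case 0
  have "potential k B (\<lambda>_. 0) \<le> k * k" using potential_le[of k B "\<lambda>_. 0"] by simp
  then have "guided k B Z 0 (\<lambda>_. 0)" for Z by (simp add: guided_def)
  then show ?case using 0(1)[of "\<lambda>_. 0"] pos by simp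
next
  case (Suc t)
  obtain g x y where g: "\<And>j. g j < k * B" "\<And>j. t + t \<le> j \<Longrightarrow> g j = 0"
    "run k B t1 t2 g t = (x, y)" "guided k B X t x" "guided k B Y t y"
    using Suc.IH Suc.prems(2,3) by auto
  have st: "state x y" using state_run[of k B t1 t2 g t] g(3) by simp
  have st': "state y x" using st by (simp only: state_commute)
  have sol': "\<And>i. i < m \<Longrightarrow> Y i + X i \<le> d i" using sol(1) by (simp add: add.commute)
  have gx: "\<And>i. i < m \<Longrightarrow> x i \<le> X i" "potential k B x + t \<le> k * k \<or> violator k k B x = None"
    "(\<Sum>i<m. x i) \<le> t"
    and gy: "\<And>i. i < m \<Longrightarrow> y i \<le> Y i" "potential k B y + t \<le> k * k \<or> violator k k B y = None"
    "(\<Sum>i<m. y i) \<le> t"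
    using g(4,5) by (auto simp: guided_def)
  obtain c where c: "c < k * B" "\<And>i. i < m \<Longrightarrow> repair k k B c x y i \<le> X i"
    "potential k B (repair k k B c x y) + Suc t \<le> k * k \<or> violator k k B (repair k k B c x y) = None"
    by (rule guided_repair[OF sol(1-4) st gx(1) gy(1) gx(2) pos]) (assumption+, blast)
  let ?x = "repair k k B c x y"
  have st2: "state y ?x" using state_repair[OF st] by (simp only: state_commute)
  obtain c' where c': "c' < k * B" "\<And>i. i < m \<Longrightarrow> repair k k B c' y ?x i \<le> Y i"
    "potential k B (repair k k B c' y ?x) + Suc t \<le> k * k \<or> violator k k B (repair k k B c' y ?x) = None"
    by (rule guided_repair[OF sol' sol(3,2,5) st2 gy(1) c(2) gy(2) pos]) (assumption+, blast)
  let ?y = "repair k k B c' y ?x"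
  \<comment> \<open>Positions \<open>t + t\<close> and \<open>t + t + 1\<close> are read for the
    first time in this round, so overwriting them does not affect the earlier rounds.\<close>
  define g' where "g' = g(t + t := c, t + t + 1 := c')"
  have "run k B t1 t2 g' t = (x, y)"
    using g(3) run_cong[of t g g' k B t1 t2] by (simp add: g'_def)
  then have r: "run k B t1 t2 g' (Suc t) = (?x, ?y)"
    using Suc.prems(2,3) by (simp add: repair_both_def Let_def g'_def)
  have "(\<Sum>i<m. ?x i) \<le> Suc t" "(\<Sum>i<m. ?y i) \<le> Suc t"
    using sum_repair[of k k B c x y] sum_repair[of k k B c' y ?x] gx(3) gy(3) by linarith+
  then have gd: "guided k B X (Suc t) ?x" "guided k B Y (Suc t) ?y"
    using c c' by (simp_all add: guided_def)
  show ?case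
    by (rule Suc.prems(1)[OF _ _ r gd]) (use g(1,2) c(1) c'(1) in \<open>auto simp: g'_def\<close>)
qed

text \<open>The potential is restarted with out-degrees ignored. At most \<open>k * k\<close> arcs
  are present at that time, so \<open>potential_le\<close> bounds it by
  \<open>k * k + k * (k * k)\<close>, the length of this phase.\<close>

definition packed :: "nat \<Rightarrow> nat \<Rightarrow> nat \<Rightarrow> (nat \<Rightarrow> nat) \<Rightarrow> bool" where
  "packed k B t x \<longleftrightarrow> violator k k B x = None \<and> (\<Sum>i<m. x i) \<le> k * k + t \<and>
     (potential k n x + t \<le> k * k + k * (k * k) \<or> violator k k n x = None)"

text \<open>The bound on \<open>B\<close> reads \<open>1 + 4 * (k * k + Suc t) < B\<close>. It
  allows \<open>Suc t\<close> for the other core, which may already have received its arc of the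
  current round.\<close>

lemma packed_star_repair:
  assumes "state x y" "extendable d x y" "packed k B t x" "(\<Sum>i<m. y i) \<le> k * k + Suc t"
    and "5 + 4 * (k * k + t) < B"
  shows "state (repair k k n 0 x y) y" "extendable d (repair k k n 0 x y) y"
    "packed k B (Suc t) (repair k k n 0 x y)"
proof -
  let ?x = "repair k k n 0 x y"
  have sums: "(\<Sum>i<m. x i) \<le> k * k + t" and none: "violator k k B x = None"
    and pot: "potential k n x + t \<le> k * k + k * (k * k) \<or> violator k k n x = None"
    using assms(3) by (auto simp: packed_def)
  have B: "1 + 3 * (\<Sum>i<m. x i) + (\<Sum>i<m. y i) < B"
  proof -
    have "1 + 3 * a + b < B" if "a \<le> c + t" "b \<le> c + Suc t" "5 + 4 * (c + t) < B" for a b c :: nat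
      using that by (simp add: algebra_simps)
    from this[OF sums assms(4,5)] show ?thesis .
  qed
  note star = star_repair[OF assms(1,2) none B pot]
  show "state ?x y" by (rule state_repair[OF assms(1)])
  show "extendable d ?x y" by (rule star(1))
  have "violator k k B ?x = None" by (rule violator_mono[OF none]) (rule repair_mono)
  then show "packed k B (Suc t) ?x"
    using star(2) sum_repair[of k k n 0 x y] sums by (auto simp: packed_def)
qed

lemma packed_sum_mono: "packed k B t x \<Longrightarrow> (\<Sum>i<m. x i) \<le> k * k + Suc t"
  by (simp add: packed_def)

lemma run_packed:
  assumes "run k B t1 t2 g t1 = (x, y)" "extendable d x y" "packed k B 0 x" "packed k B 0 y"
    and "t1 + t \<le> t2" "\<And>j. t1 + t1 \<le> j \<Longrightarrow> g j = 0" "1 + 4 * (k * k + t) < B"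
  shows "\<exists>x y. run k B t1 t2 g (t1 + t) = (x, y) \<and> extendable d x y \<and> packed k B t x \<and> packed k B t y"
  using assms(5,7)
proof (induction t)
  case 0
  then show ?case using assms by simp
next
  case (Suc t)
  then obtain x y where IH: "run k B t1 t2 g (t1 + t) = (x, y)" "extendable d x y" "packed k B t x" "packed k B t y"
    by auto
  have st: "state x y" using state_run[of k B t1 t2 g "t1 + t"] IH(1) by simp
  have B: "5 + 4 * (k * k + t) < B" using Suc.prems by simp
  let ?x = "repair k k n 0 x y"
  note 1 = packed_star_repair[OF st IH(2,3) packed_sum_mono[OF IH(4)] B]
  have st': "state y ?x" and ext': "extendable d y ?x"
    using 1(1,2) by (simp_all only: state_commute extendable_commute)
  have sumx: "(\<Sum>i<m. ?x i) \<le> k * k + Suc t" using 1(3) by (simp add: packed_def)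
  let ?y = "repair k k n 0 y ?x"
  note 2 = packed_star_repair[OF st' ext' IH(4) sumx B]
  have ext: "extendable d ?x ?y" using 2(2) by (simp only: extendable_commute)
  have "run k B t1 t2 g (t1 + Suc t) = (?x, ?y)"
    using IH(1) Suc.prems assms(6) by (simp add: repair_both_def Let_def)
  then show ?case using ext 1(3) 2(3) by blast
qed

definition spanned :: "nat \<Rightarrow> nat \<Rightarrow> (nat \<Rightarrow> nat) \<Rightarrow> bool" where
  "spanned k t x \<longleftrightarrow> violator k k n x = None \<and> (t \<le> card (reach x {r}) \<or> violator n k n x = None)"

lemma spanned_repair:
  assumes "state x y" "extendable d x y" "spanned k t x"
  shows "state (repair n k n 0 x y) y" "extendable d (repair n k n 0 x y) y"
    "spanned k (Suc t) (repair n k n 0 x y)"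
proof -
  have none: "violator k k n x = None" and c: "t \<le> card (reach x {r}) \<or> violator n k n x = None"
    using assms(3) by (auto simp: spanned_def)
  note span = span_repair[OF assms(1,2) none c]
  show "state (repair n k n 0 x y) y" by (rule state_repair[OF assms(1)])
  show "extendable d (repair n k n 0 x y) y" by (rule span(1))
  have "violator k k n (repair n k n 0 x y) = None" by (rule violator_mono[OF none]) (rule repair_mono)
  then show "spanned k (Suc t) (repair n k n 0 x y)" using span(2) unfolding spanned_def by blast
qed

lemma run_spanned:
  assumes "run k B t1 t2 g t2 = (x, y)" "extendable d x y" "spanned k 0 x" "spanned k 0 y"
    and "t1 \<le> t2" "\<And>j. t2 + t2 \<le> j \<Longrightarrow> g j = 0"
  shows "\<exists>x y. run k B t1 t2 g (t2 + t) = (x, y) \<and> extendable d x y \<and> spanned k t x \<and> spanned k t y"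
proof (induction t)
  case 0
  then show ?case using assms by simp
next
  case (Suc t)
  then obtain x y where IH: "run k B t1 t2 g (t2 + t) = (x, y)" "extendable d x y" "spanned k t x" "spanned k t y"
    by auto
  have st: "state x y" using state_run[of k B t1 t2 g "t2 + t"] IH(1) by simp
  let ?x = "repair n k n 0 x y"
  note 1 = spanned_repair[OF st IH(2,3)]
  have st': "state y ?x" and ext': "extendable d y ?x"
    using 1(1,2) by (simp_all only: state_commute extendable_commute)
  let ?y = "repair n k n 0 y ?x"
  note 2 = spanned_repair[OF st' ext' IH(4)]
  have ext: "extendable d ?x ?y" using 2(2) by (simp only: extendable_commute)
  have "run k B t1 t2 g (t2 + Suc t) = (?x, ?y)"
    using IH(1) assms(5,6) by (simp add: repair_both_def Let_def)
  then show ?case using ext 1(3) 2(3) by blast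
qed

lemma spanned_n: "spanned k n x \<Longrightarrow> x 0 = 0 \<Longrightarrow> violator n k n x = None"
proof (rule ccontr)
  assume sp: "spanned k n x" and x0: "x 0 = 0" and some: "violator n k n x \<noteq> None"
  then have "n \<le> card (reach x {r})" and none: "violator k k n x = None" by (auto simp: spanned_def)
  then have "\<not> bad n k n x i" if "i < m" for i
    using that reach_del_eq[of x 0] x0 unfolding violator_None bad_def by (cases "i = 0") auto
  then have "violator n k n x = None" unfolding violator_None by blast
  then show False using some by contradiction
qed

text \<open>The phases last \<open>k * k\<close>, \<open>k * k + k * (k * k)\<close> and
  \<open>n\<close> rounds: the starting values of the two potentials, and one new vertex per round.
  A core has at most \<open>t2\<close> arcs when the second phase ends, whence the condition on
  \<open>B\<close>. Nothing is guessed after the first phase, so all later digits are 0.\<close>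

theorem run_complete:
  assumes sol: "\<And>i. i < m \<Longrightarrow> X i + Y i \<le> d i"
      "cut_condition (\<lambda>i. (n - k) * X i)" "cut_condition (\<lambda>i. (n - k) * Y i)"
    and k: "0 < k" "k \<le> n" "2 * k \<le> n + 1"
    and t1: "t1 = k * k" and t2: "t2 = t1 + (k * k + k * (k * k))" and B: "1 + 4 * t2 < B"
  obtains g where "\<And>j. g j < k * B" "\<And>j. t1 + t1 \<le> j \<Longrightarrow> g j = 0"
    "accepting k (run k B t1 t2 g (t2 + n))"
proof -
  have rob: "reach X {r} = {..<n}" "reach Y {r} = {..<n}" "robust k X" "robust k Y"
    using cut_condition_iff_robust[of k X] cut_condition_iff_robust[of k Y] sol(2,3) k by auto
  have pos: "0 < k * B" using k(1) B by simp
  obtain g x y where g: "\<And>j. g j < k * B" "\<And>j. t1 + t1 \<le> j \<Longrightarrow> g j = 0"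
    "run k B t1 t2 g t1 = (x, y)" "guided k B X t1 x" "guided k B Y t1 y"
    by (rule run_guided[where t = t1 and ?t1.0 = t1 and ?t2.0 = t2, OF sol(1) rob pos])
      (assumption, simp, simp add: t2, blast)
  have none: "violator k k B x = None" if "guided k B Z t1 x" for Z x
  proof (rule ccontr)
    assume "violator k k B x \<noteq> None"
    moreover from this have "potential k B x = 0" using that by (auto simp: guided_def t1)
    ultimately show False using violator_pos_potential by fastforce
  qed
  have st: "state x y" using state_run[of k B t1 t2 g t1] g(3) by simp
  have ext: "extendable d x y"
    by (rule extendable_if_solution[of _ X _ Y]) (use g(4,5) sol(1) rob st in \<open>auto simp: guided_def state_def\<close>)
  have "packed k B 0 x" if "guided k B Z t1 x" for Z x
  proof -
    have s: "(\<Sum>i<m. x i) \<le> k * k" using that by (simp add: guided_def t1)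
    have "potential k n x \<le> k * k + k * (\<Sum>i<m. x i)" by (rule potential_le)
    also have "\<dots> \<le> k * k + k * (k * k)" using s by simp
    finally show ?thesis using none[OF that] s by (simp add: packed_def)
  qed
  note packed = this[OF g(4)] this[OF g(5)]
  obtain x y where 1: "run k B t1 t2 g t2 = (x, y)" "extendable d x y"
    "packed k B (k * k + k * (k * k)) x" "packed k B (k * k + k * (k * k)) y"
    using run_packed[OF g(3) ext packed, of "k * k + k * (k * k)"] g(2) B unfolding t2 t1 by auto
  have "spanned k 0 x" if "packed k B (k * k + k * (k * k)) x" for x
  proof -
    have "violator k k n x = None"
    proof (rule ccontr)
      assume "violator k k n x \<noteq> None"
      moreover from this have "potential k n x = 0" using that by (auto simp: packed_def)
      ultimately show False using violator_pos_potential by fastforce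
    qed
    then show ?thesis by (simp add: spanned_def)
  qed
  note spanned = this[OF 1(3)] this[OF 1(4)]
  obtain x y where 2: "run k B t1 t2 g (t2 + n) = (x, y)" "spanned k n x" "spanned k n y"
    using run_spanned[OF 1(1,2) spanned, of n] g(2) unfolding t2 by auto
  have st: "state x y" using state_run[of k B t1 t2 g "t2 + n"] 2(1) by simp
  have "x 0 = 0" "y 0 = 0" using state_loops[OF st] state_loops[OF st[unfolded state_commute[of x]]] by auto
  then have "accepting k (x, y)" using spanned_n[OF 2(2)] spanned_n[OF 2(3)] by (simp add: accepting_def)
  then show thesis using that[of g] g(1,2) 2(1) by simp
qed

end

section \<open>Multiplicity vectors that carry a flow\<close>

context rooted_net
begin

text \<open>\<open>x i\<close> parallel copies of capacity \<open>c\<close> jointly act as one arc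
  of capacity \<open>c * x i\<close>.\<close>

definition feasible :: "nat \<Rightarrow> ('e \<Rightarrow> nat) \<Rightarrow> bool" where
  "feasible c x \<longleftrightarrow> (\<exists>z. (\<forall>i\<in>A. z i \<le> c * x i) \<and> unit_flow z)"

lemma feasible_iff_cut: "feasible c x \<longleftrightarrow> cut_condition (\<lambda>i. c * x i)"
proof
  assume "feasible c x"
  then obtain z where z: "\<And>i. i \<in> A \<Longrightarrow> z i \<le> c * x i" "unit_flow z" by (auto simp: feasible_def)
  show "cut_condition (\<lambda>i. c * x i)"
    unfolding cut_condition_def
  proof (intro allI impI)
    fix S assume "S \<subseteq> V - {r}"
    with z(2) have "card S \<le> cut z S" by (rule unit_flow_cut)
    also have "\<dots> \<le> cut (\<lambda>i. c * x i) S" using z(1) by (rule cut_mono)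
    finally show "card S \<le> cut (\<lambda>i. c * x i) S" .
  qed
next
  assume "cut_condition (\<lambda>i. c * x i)"
  then show "feasible c x" using unit_flow_exists unfolding feasible_def by metis
qed

text \<open>No cut needs more than \<open>card V\<close> units, so larger capacities can be truncated.\<close>

lemma cut_condition_truncate:
  assumes "cut_condition c" "\<And>i. i \<in> A \<Longrightarrow> min (c i) (card V) \<le> c' i"
  shows "cut_condition c'"
  unfolding cut_condition_def
proof (intro allI impI)
  fix S assume S: "S \<subseteq> V - {r}"
  show "card S \<le> cut c' S"
  proof (cases "\<exists>i\<in>A. src i \<notin> S \<and> dst i \<in> S \<and> card V \<le> c i")
    case True
    then obtain i where i: "i \<in> A" "src i \<notin> S" "dst i \<in> S" "card V \<le> c i" by blast
    have "card S \<le> card V" using S finite_V by (intro card_mono) auto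
    also have "\<dots> \<le> c' i" using assms(2)[OF i(1)] i(4) by simp
    also have "\<dots> \<le> cut c' S" using i by (intro arc_le_cut)
    finally show ?thesis .
  next
    case False
    have "card S \<le> cut c S" using assms(1) S by (simp add: cut_condition_def)
    also have "\<dots> \<le> cut c' S"
      unfolding cut_def
    proof (rule sum_mono)
      fix i assume "i \<in> A"
      then show "(if src i \<notin> S \<and> dst i \<in> S then c i else 0) \<le> (if src i \<notin> S \<and> dst i \<in> S then c' i else 0)"
        using assms(2)[of i] False by (auto simp: not_le)
    qed
    finally show ?thesis .
  qed
qed

text \<open>Every arc counts once as inflow and once as outflow, so the surplus of the other
  vertices has to come from the root.\<close>

lemma unit_flow_root:
  assumes "unit_flow z"
  shows "outflow z r = inflow z r + (card V - 1)"
proof -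
  have "(\<Sum>v\<in>V. inflow z v) = (\<Sum>v\<in>V. outflow z v)"
    unfolding inflow_sum[OF finite_V] outflow_sum[OF finite_V]
    using src_in dst_in by (intro sum.cong) auto
  moreover have "(\<Sum>v\<in>V. f v) = f r + (\<Sum>v\<in>V - {r}. f v)" for f :: "'v \<Rightarrow> nat"
    using finite_V root_in by (rule sum.remove)
  moreover have "(\<Sum>v\<in>V - {r}. inflow z v) = (\<Sum>v\<in>V - {r}. outflow z v + 1)"
    using assms unfolding unit_flow_def by (intro sum.cong) auto
  moreover have "(\<Sum>v\<in>V - {r}. outflow z v + 1) = (\<Sum>v\<in>V - {r}. outflow z v) + (card V - 1)"
    using root_in finite_V unfolding sum.distrib by simp
  ultimately show ?thesis by simp
qed

end

section \<open>Multidigraphs as arrays of multiplicities\<close>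

definition arc_index :: "nat \<Rightarrow> nat \<times> nat \<times> nat \<Rightarrow> nat" where
  "arc_index n = (\<lambda>(u, v, j). u * n + v)"

text \<open>The offset \<open>lo\<close> lets the second branching take the copies above those of
  the first one.\<close>

definition arc_copies :: "nat \<Rightarrow> (nat \<Rightarrow> nat) \<Rightarrow> (nat \<Rightarrow> nat) \<Rightarrow> (nat \<times> nat \<times> nat) list" where
  "arc_copies n lo x = concat (map (\<lambda>i. map (\<lambda>j. (i div n, i mod n, lo i + j)) [0..<x i]) [0..<n * n])"

lemma arc_index_less: "u < n \<Longrightarrow> v < n \<Longrightarrow> u * n + v < n * (n :: nat)"
  by (rule less_le_trans[of _ "Suc u * n"]) (simp_all, metis Suc_leI mult_Suc mult_le_mono1)

lemma div_mod_less:
  assumes "i < n * (n :: nat)"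
  shows "i div n < n" "i mod n < n"
proof -
  have "0 < n" using assms by (cases n) auto
  with assms show "i div n < n" "i mod n < n" by (auto simp: less_mult_imp_div_less)
qed

lemma distinct_arc_copies: "distinct (arc_copies n lo x)"
proof -
  have *: "distinct (concat (map (\<lambda>i. map (\<lambda>j. (i div n, i mod n, lo i + j)) [0..<x i]) is))"
    if "distinct is" for "is"
    using that
  proof (induction "is")
    case (Cons i "is")
    have "i = j" if "i div n = j div n" "i mod n = j mod n" for j
      using that by (metis div_mult_mod_eq)
    then show ?case using Cons by (auto simp: distinct_map inj_on_def)
  qed simp
  show ?thesis unfolding arc_copies_def by (rule *) simp
qed

lemma set_arc_copies:
  "set (arc_copies n lo x) =
     {(u, v, j). u < n \<and> v < n \<and> lo (u * n + v) \<le> j \<and> j < lo (u * n + v) + x (u * n + v)}"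
  (is "_ = ?S")
proof (intro subset_antisym subsetI)
  fix a assume "a \<in> set (arc_copies n lo x)"
  then obtain i j where ij: "i < n * n" "j < x i" "a = (i div n, i mod n, lo i + j)"
    by (auto simp: arc_copies_def)
  then show "a \<in> ?S" using div_mod_less[OF ij(1)] by simp
next
  fix a assume "a \<in> ?S"
  then obtain u v j where a: "a = (u, v, j)" "u < n" "v < n" "lo (u * n + v) \<le> j"
    "j < lo (u * n + v) + x (u * n + v)" by auto
  then have "a = ((u * n + v) div n, (u * n + v) mod n, lo (u * n + v) + (j - lo (u * n + v)))" by simp
  then show "a \<in> set (arc_copies n lo x)"
    unfolding arc_copies_def using a arc_index_less[OF a(2,3)]
    by (auto intro!: bexI[of _ "u * n + v"] image_eqI[of _ _ "j - lo (u * n + v)"])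
qed

text \<open>Fills \<open>c\<close> copies of capacity \<open>p\<close> greedily with
  \<open>q\<close> units; this spreads an aggregated flow over parallel arcs.\<close>

lemma sum_min_steps: "(\<Sum>j<c. min p (q - j * p)) = min (c * p) (q :: nat)"
  by (induction c) (auto simp: min_def)

locale rooted_multi_digraph =
  fixes n :: nat and m :: "nat \<Rightarrow> nat \<Rightarrow> nat" and r :: nat
  assumes rooted: "rooted_digraph (multi_digraph n m) r"
begin

lemma r_less: "r < n"
  using rooted unfolding rooted_digraph_def rooted_digraph_axioms_def by (simp add: multi_digraph_def)

lemma loopfree: "u < n \<Longrightarrow> m u u = 0"
  using rooted unfolding rooted_digraph_def
  by (force simp: multi_digraph_def dest: loopfree_digraph.no_loops)

sublocale rooted_net "{..<n}" "{..<n * n}" "\<lambda>i. i div n" "\<lambda>i. i mod n" r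
  by unfold_locales (auto simp: div_mod_less r_less)

definition aggregate :: "(nat \<times> nat \<times> nat) set \<Rightarrow> (nat \<times> nat \<times> nat \<Rightarrow> nat) \<Rightarrow> nat \<Rightarrow> nat" where
  "aggregate E z i = sum z {a \<in> E. arc_index n a = i}"

lemma arc_index_arc:
  assumes "(u, v, j) \<in> arcs (multi_digraph n m)"
  shows "arc_index n (u, v, j) < n * n" "arc_index n (u, v, j) div n = u" "arc_index n (u, v, j) mod n = v"
  using assms arc_index_less[of u n v] by (auto simp: multi_digraph_def arc_index_def)

lemma finite_arcs_D: "finite (arcs (multi_digraph n m))"
  using rooted unfolding rooted_digraph_def by (simp add: fin_digraph.finite_arcs)

lemma inflow_aggregate:
  assumes E: "E \<subseteq> arcs (multi_digraph n m)"
  shows "inflow (aggregate E z) v = sum z {a \<in> E. head (multi_digraph n m) a = v}"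
    "outflow (aggregate E z) v = sum z {a \<in> E. tail (multi_digraph n m) a = v}"
proof -
  have fin: "finite E" using E finite_arcs_D by (rule finite_subset)
  have gen: "(\<Sum>i<n * n. if f i = v then aggregate E z i else 0) = sum z {a \<in> E. h a = v}"
    if f: "\<And>a. a \<in> E \<Longrightarrow> f (arc_index n a) = h a" for f :: "nat \<Rightarrow> nat" and h
  proof -
    have "(\<Sum>i<n * n. if f i = v then aggregate E z i else 0)
        = (\<Sum>i<n * n. \<Sum>a\<in>{a \<in> E. arc_index n a = i}. if h a = v then z a else 0)"
    proof (rule sum.cong[OF refl])
      fix i
      have "(\<Sum>a\<in>{a \<in> E. arc_index n a = i}. if h a = v then z a else 0)
          = (\<Sum>a\<in>{a \<in> E. arc_index n a = i}. if f i = v then z a else 0)"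
        using f by (intro sum.cong) auto
      then show "(if f i = v then aggregate E z i else 0)
          = (\<Sum>a\<in>{a \<in> E. arc_index n a = i}. if h a = v then z a else 0)"
        by (simp add: aggregate_def)
    qed
    also have "\<dots> = (\<Sum>a\<in>E. if h a = v then z a else 0)"
      using fin E arc_index_arc(1) by (intro sum.group) auto
    also have "\<dots> = sum z {a \<in> E. h a = v}" using fin by (simp add: sum.If_cases Int_def)
    finally show ?thesis .
  qed
  show "inflow (aggregate E z) v = sum z {a \<in> E. head (multi_digraph n m) a = v}"
    unfolding inflow_def
    by (rule gen) (use E arc_index_arc(3) in \<open>auto simp: multi_digraph_def\<close>)
  show "outflow (aggregate E z) v = sum z {a \<in> E. tail (multi_digraph n m) a = v}"
    unfolding outflow_def
    by (rule gen) (use E arc_index_arc(2) in \<open>auto simp: multi_digraph_def\<close>)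
qed

text \<open>The root equation of \<open>branching_flow\<close> follows from the other balances by
  \<open>unit_flow_root\<close>, so the flow only matters through its capacities and its
  aggregate.\<close>

lemma branching_flow_iff:
  assumes "arcs X \<subseteq> arcs (multi_digraph n m)" "verts X = {..<n}"
    "tail X = tail (multi_digraph n m)" "head X = head (multi_digraph n m)"
  shows "branching_flow X r k z \<longleftrightarrow>
    (\<forall>a\<in>arcs X. int (z a) \<le> int n - int k) \<and> unit_flow (aggregate (arcs X) z)"
proof -
  have sums: "sum z (in_arcs X v) = inflow (aggregate (arcs X) z) v"
    "sum z (out_arcs X v) = outflow (aggregate (arcs X) z) v" for v
    unfolding inflow_aggregate[OF assms(1)] by (simp_all add: in_arcs_def out_arcs_def assms(3,4))
  have "unit_flow f \<Longrightarrow> int (outflow f r) - int (inflow f r) = int n - 1" for f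
    using unit_flow_root[of f] r_less by simp
  moreover have "unit_flow f \<longleftrightarrow> (\<forall>v\<in>{..<n} - {r}. int (inflow f v) - int (outflow f v) = 1)" for f
    unfolding unit_flow_def by (intro ball_cong refl) linarith
  ultimately show ?thesis unfolding branching_flow_def sums assms(2) by auto
qed

lemma flow_branching_feasible:
  assumes "spanning X (multi_digraph n m)" "flow_branching X r k"
  shows "feasible (n - k) (aggregate (arcs X) (\<lambda>_. 1))"
proof -
  have X: "arcs X \<subseteq> arcs (multi_digraph n m)" "verts X = {..<n}"
    "tail X = tail (multi_digraph n m)" "head X = head (multi_digraph n m)"
    using assms(1) by (auto simp: spanning_def subgraph_def compatible_def multi_digraph_def)
  obtain z where z: "branching_flow X r k z" using assms(2) by (auto simp: flow_branching_def)
  have cap: "z a \<le> n - k" if "a \<in> arcs X" for a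
  proof -
    have "int (z a) \<le> int n - int k" using z that by (simp add: branching_flow_iff[OF X])
    then show ?thesis by linarith
  qed
  have "aggregate (arcs X) z i \<le> (n - k) * aggregate (arcs X) (\<lambda>_. 1) i" for i
    unfolding aggregate_def sum_distrib_left by (intro sum_mono) (auto intro: cap)
  then show ?thesis using z unfolding branching_flow_iff[OF X] feasible_def by blast
qed

lemma aggregate_disjoint:
  assumes "E \<subseteq> arcs (multi_digraph n m)" "F \<subseteq> arcs (multi_digraph n m)" "E \<inter> F = {}" "i < n * n"
  shows "aggregate E (\<lambda>_. 1) i + aggregate F (\<lambda>_. 1) i \<le> m (i div n) (i mod n)"
proof -
  let ?T = "\<lambda>E. {a \<in> E. arc_index n a = i}"
  have fin: "finite E" "finite F" using assms finite_arcs_D by (auto intro: finite_subset)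
  have "aggregate E (\<lambda>_. 1) i + aggregate F (\<lambda>_. 1) i = card (?T E \<union> ?T F)"
    using fin assms(3) by (subst card_Un_disjoint) (auto simp: aggregate_def)
  also have "\<dots> \<le> card ((\<lambda>j. (i div n, i mod n, j)) ` {..<m (i div n) (i mod n)})"
  proof (rule card_mono)
    show "?T E \<union> ?T F \<subseteq> (\<lambda>j. (i div n, i mod n, j)) ` {..<m (i div n) (i mod n)}"
    proof
      fix a assume "a \<in> ?T E \<union> ?T F"
      then have a: "a \<in> arcs (multi_digraph n m)" "arc_index n a = i" using assms(1,2) by auto
      obtain u v j where uvj: "a = (u, v, j)" by (cases a)
      then have "u = i div n" "v = i mod n" using a arc_index_arc[of u v j] by auto
      then show "a \<in> (\<lambda>j. (i div n, i mod n, j)) ` {..<m (i div n) (i mod n)}"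
        using a(1) uvj by (auto simp: multi_digraph_def)
    qed
  qed simp
  also have "\<dots> \<le> m (i div n) (i mod n)" using card_image_le[of "{..<m (i div n) (i mod n)}"] by force
  finally show ?thesis .
qed

lemma disjoint_branchings_feasible:
  assumes "disjoint_spanning_flow_branchings (multi_digraph n m) r k X Y"
  obtains x y where "\<And>i. i < n * n \<Longrightarrow> x i + y i \<le> m (i div n) (i mod n)"
    "feasible (n - k) x" "feasible (n - k) y"
  using assms flow_branching_feasible[of X k] flow_branching_feasible[of Y k]
    that[of "aggregate (arcs X) (\<lambda>_. 1)" "aggregate (arcs Y) (\<lambda>_. 1)"]
    aggregate_disjoint[of "arcs X" "arcs Y"]
  by (auto simp: disjoint_spanning_flow_branchings_def spanning_def subgraph_def)

lemma arc_copies_arcs: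
  assumes "\<And>i. i < n * n \<Longrightarrow> lo i + x i \<le> m (i div n) (i mod n)"
  shows "set (arc_copies n lo x) \<subseteq> arcs (multi_digraph n m)"
proof
  fix a assume "a \<in> set (arc_copies n lo x)"
  then obtain u v j where a: "a = (u, v, j)" "u < n" "v < n" "j < lo (u * n + v) + x (u * n + v)"
    unfolding set_arc_copies by auto
  then show "a \<in> arcs (multi_digraph n m)"
    using assms[OF arc_index_less[OF a(2,3)]] by (auto simp: multi_digraph_def)
qed

lemma feasible_flow_branching:
  assumes x: "\<And>i. i < n * n \<Longrightarrow> lo i + x i \<le> m (i div n) (i mod n)" and feas: "feasible (n - k) x"
  defines "X \<equiv> (multi_digraph n m)\<lparr>arcs := set (arc_copies n lo x)\<rparr>"
  shows "spanning X (multi_digraph n m)" "flow_branching X r k"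
proof -
  have X: "arcs X \<subseteq> arcs (multi_digraph n m)" "verts X = {..<n}"
    "tail X = tail (multi_digraph n m)" "head X = head (multi_digraph n m)"
    "arcs X = set (arc_copies n lo x)"
    using arc_copies_arcs[OF x] by (auto simp: X_def multi_digraph_def)
  interpret D: rooted_digraph "multi_digraph n m" r by (rule rooted)
  have wf: "wf_digraph X"
    by unfold_locales (use X D.tail_in_verts D.head_in_verts in \<open>auto simp: multi_digraph_def\<close>)
  show "spanning X (multi_digraph n m)"
    using X wf D.wf_digraph by (auto simp: spanning_def subgraph_def compatible_def multi_digraph_def)
  have "in_arcs X r \<subseteq> in_arcs (multi_digraph n m) r" using X by (auto simp: in_arcs_def)
  moreover have "in_arcs (multi_digraph n m) r = {}"
    using D.in_degree_root finite_arcs_D by (auto simp: in_degree_def in_arcs_def)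
  ultimately have "in_degree X r = 0" by (simp add: in_degree_def)
  then have "rooted_digraph X r"
    using wf X D.no_loops r_less finite_subset[OF X(1) finite_arcs_D]
    unfolding rooted_digraph_def fin_digraph_def fin_digraph_axioms_def loopfree_digraph_def
      loopfree_digraph_axioms_def rooted_digraph_axioms_def by auto
  obtain z where z: "\<And>i. i < n * n \<Longrightarrow> z i \<le> (n - k) * x i" "unit_flow z"
    using feas by (auto simp: feasible_def)
  \<comment> \<open>The copies are filled one after the other up to their capacity, in the order of
    their numbers.\<close>
  define z' where "z' = (\<lambda>(u, v, j). min (n - k) (z (u * n + v) - (j - lo (u * n + v)) * (n - k)))"
  have agg: "aggregate (arcs X) z' i = z i" if i: "i < n * n" for i
  proof -
    have T: "{a \<in> arcs X. arc_index n a = i} = (\<lambda>j. (i div n, i mod n, lo i + j)) ` {..<x i}"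
    proof (intro subset_antisym subsetI)
      fix a assume a: "a \<in> {a \<in> arcs X. arc_index n a = i}"
      then obtain u v j where uvj: "a = (u, v, j)" "u < n" "v < n" "i = u * n + v" "lo i \<le> j" "j < lo i + x i"
        unfolding X(5) set_arc_copies by (auto simp: arc_index_def)
      then show "a \<in> (\<lambda>j. (i div n, i mod n, lo i + j)) ` {..<x i}"
        by (auto intro!: image_eqI[of _ _ "j - lo i"])
    qed (use div_mod_less[OF i] in \<open>auto simp: X(5) set_arc_copies arc_index_def\<close>)
    have "aggregate (arcs X) z' i = (\<Sum>j<x i. z' (i div n, i mod n, lo i + j))"
      unfolding aggregate_def T by (subst sum.reindex) (auto simp: inj_on_def)
    also have "\<dots> = (\<Sum>j<x i. min (n - k) (z i - j * (n - k)))" by (simp add: z'_def)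
    also have "\<dots> = z i" unfolding sum_min_steps using z(1)[OF i] by (simp add: min_def mult.commute)
    finally show ?thesis .
  qed
  have "inflow (aggregate (arcs X) z') v = inflow z v" "outflow (aggregate (arcs X) z') v = outflow z v" for v
    unfolding inflow_def outflow_def using agg by (auto intro!: sum.cong)
  then have uf: "unit_flow (aggregate (arcs X) z')" using z(2) by (simp add: unit_flow_def)
  have "int (z' a) \<le> int n - int k" if a: "a \<in> arcs X" for a
  proof (cases "k \<le> n")
    case True
    have "z' a \<le> n - k" by (cases a) (simp add: z'_def)
    then show ?thesis using True by linarith
  next
    case False
    \<comment> \<open>For \<open>k > n\<close> the integer capacity is negative although
      \<open>n - k\<close> is 0. The zero flow is balanced only if the root is the only vertex, and
      then a loopless digraph has no arc that could violate the capacity.\<close>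
    have "inflow z v = 0" for v using z(1) False by (simp add: inflow_def)
    then have "{..<n} - {r} = {}" using z(2) unfolding unit_flow_def by fastforce
    then have eq: "v = r" if "v < n" for v using that by blast
    obtain u v j where uvj: "a = (u, v, j)" by (cases a)
    then have "u < n" "v < n" "j < m u v" using a X(1) by (auto simp: multi_digraph_def)
    then show ?thesis using eq[of u] eq[of v] loopfree[of u] by simp
  qed
  then have "branching_flow X r k z'" using uf by (simp add: branching_flow_iff[OF X(1-4)])
  then show "flow_branching X r k" using \<open>rooted_digraph X r\<close> by (auto simp: flow_branching_def)
qed

lemma feasible_disjoint_branchings:
  assumes "\<And>i. i < n * n \<Longrightarrow> x i + y i \<le> m (i div n) (i mod n)"
    "feasible (n - k) x" "feasible (n - k) y"
  shows "disjoint_spanning_flow_branchings (multi_digraph n m) r k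
    ((multi_digraph n m)\<lparr>arcs := set (arc_copies n (\<lambda>_. 0) x)\<rparr>)
    ((multi_digraph n m)\<lparr>arcs := set (arc_copies n x y)\<rparr>)"
proof -
  have "0 + x i \<le> m (i div n) (i mod n)" if "i < n * n" for i using assms(1)[OF that] by simp
  note 1 = feasible_flow_branching[of "\<lambda>_. 0", OF this assms(2)]
  note 2 = feasible_flow_branching[OF assms(1,3)]
  have "set (arc_copies n (\<lambda>_. 0) x) \<inter> set (arc_copies n x y) = {}"
    unfolding set_arc_copies by auto
  then show ?thesis using 1 2 by (simp add: disjoint_spanning_flow_branchings_def)
qed

end

section \<open>Programs with bounded loops\<close>

datatype prg =
    Nop
  | Assign string exp exp
  | Then prg prg  (infixr ";;" 60)
  | Cond exp prg prg
  | For string string prg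

abbreviation Var :: "string \<Rightarrow> exp" where
  "Var x \<equiv> Cell x (Const 0)"

abbreviation set_var :: "string \<Rightarrow> nat \<Rightarrow> memory \<Rightarrow> memory" where
  "set_var x v s \<equiv> s(x := (s x)(0 := v))"

primrec compile :: "prg \<Rightarrow> com" where
  "compile Nop = Skip"
| "compile (Assign x i e) = Store x i e"
| "compile (c1 ;; c2) = Seq (compile c1) (compile c2)"
| "compile (Cond b c1 c2) = If b (compile c1) (compile c2)"
| "compile (For i b c) = Seq (Store i (Const 0) (Const 0))
     (While (Minus (Var b) (Var i)) (Seq (compile c) (Store i (Const 0) (Plus (Var i) (Const 1)))))"

primrec assigned :: "prg \<Rightarrow> string set" where
  "assigned Nop = {}"
| "assigned (Assign x i e) = {x}"
| "assigned (c1 ;; c2) = assigned c1 \<union> assigned c2"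
| "assigned (Cond b c1 c2) = assigned c1 \<union> assigned c2"
| "assigned (For i b c) = insert i (assigned c)"

primrec loop_bounds :: "prg \<Rightarrow> string set" where
  "loop_bounds Nop = {}"
| "loop_bounds (Assign x i e) = {}"
| "loop_bounds (c1 ;; c2) = loop_bounds c1 \<union> loop_bounds c2"
| "loop_bounds (Cond b c1 c2) = loop_bounds c1 \<union> loop_bounds c2"
| "loop_bounds (For i b c) = insert b (loop_bounds c)"

primrec well_formed :: "prg \<Rightarrow> bool" where
  "well_formed Nop = True"
| "well_formed (Assign x i e) = True"
| "well_formed (c1 ;; c2) = (well_formed c1 \<and> well_formed c2)"
| "well_formed (Cond b c1 c2) = (well_formed c1 \<and> well_formed c2)"
| "well_formed (For i b c) = (i \<notin> assigned c \<and> well_formed c)"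

primrec iterate :: "(nat \<Rightarrow> 'a \<Rightarrow> 'a) \<Rightarrow> nat \<Rightarrow> 'a \<Rightarrow> 'a" where
  "iterate f 0 s = s"
| "iterate f (Suc j) s = f j (iterate f j s)"

primrec ev :: "prg \<Rightarrow> memory \<Rightarrow> memory" where
  "ev Nop = (\<lambda>s. s)"
| "ev (Assign x i e) = (\<lambda>s. s(x := (s x)(exp_val i s := exp_val e s)))"
| "ev (c1 ;; c2) = (\<lambda>s. ev c2 (ev c1 s))"
| "ev (Cond b c1 c2) = (\<lambda>s. if exp_val b s \<noteq> 0 then ev c1 s else ev c2 s)"
| "ev (For i b c) = (\<lambda>s. set_var i (s b 0) (iterate (\<lambda>j t. ev c (set_var i j t)) (s b 0) s))"

text \<open>\<open>N\<close> stands for a common limit on all loop bounds. In a loop, 9 is 3 for the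
  initialisation plus 6 for the failing guard, and 12 is 6 for the guard plus 6 for the
  increment.\<close>

primrec time_bound :: "prg \<Rightarrow> nat \<Rightarrow> nat" where
  "time_bound Nop = (\<lambda>N. 1)"
| "time_bound (Assign x i e) = (\<lambda>N. 1 + exp_cost i + exp_cost e)"
| "time_bound (c1 ;; c2) = (\<lambda>N. time_bound c1 N + time_bound c2 N)"
| "time_bound (Cond b c1 c2) = (\<lambda>N. 1 + exp_cost b + time_bound c1 N + time_bound c2 N)"
| "time_bound (For i b c) = (\<lambda>N. 9 + N * (12 + time_bound c N))"

lemma ev_frame: "x \<notin> assigned c \<Longrightarrow> ev c s x = s x"
proof (induction c arbitrary: s)
  case (For i b c)
  then have "iterate (\<lambda>j t. ev c (set_var i j t)) N s x = s x" for N
    by (induction N) auto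
  then show ?case using For.prems by simp
qed auto

text \<open>Since no loop bound is ever assigned, the limit \<open>N\<close> on the initial memory
  holds throughout, so one number limits all loops, nested ones included.\<close>

lemma exec_compile:
  assumes "well_formed c" "loop_bounds c \<inter> assigned c = {}" "\<And>b. b \<in> loop_bounds c \<Longrightarrow> s b 0 \<le> N"
  shows "\<exists>t\<le>time_bound c N. exec (compile c) s t (ev c s)"
  using assms
proof (induction c arbitrary: s)
  case Nop
  show ?case using exec.Skip[of s] by auto
next
  case (Assign x i e)
  show ?case
    unfolding compile.simps ev.simps time_bound.simps
    by (rule exI[of _ "1 + exp_cost i + exp_cost e"]) (use exec.Store[of x i e s] in blast)
next
  case (Then c1 c2)
  have "\<exists>t\<le>time_bound c1 N. exec (compile c1) s t (ev c1 s)"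
    using Then.prems by (intro Then.IH(1)) auto
  moreover have "\<exists>t\<le>time_bound c2 N. exec (compile c2) (ev c1 s) t (ev c2 (ev c1 s))"
  proof (rule Then.IH(2))
    fix b assume "b \<in> loop_bounds c2"
    then have "b \<notin> assigned c1" "s b 0 \<le> N" using Then.prems by auto
    then show "ev c1 s b 0 \<le> N" by (simp add: ev_frame)
  qed (use Then.prems in auto)
  ultimately obtain t1 t2 where "t1 \<le> time_bound c1 N" "exec (compile c1) s t1 (ev c1 s)"
    "t2 \<le> time_bound c2 N" "exec (compile c2) (ev c1 s) t2 (ev c2 (ev c1 s))" by blast
  then show ?case using exec.Seq[of "compile c1" s t1 "ev c1 s" "compile c2" t2 "ev c2 (ev c1 s)"]
    by (intro exI[of _ "t1 + t2"]) auto
next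
  case (Cond b c1 c2)
  show ?case
  proof (cases "exp_val b s = 0")
    case True
    have "\<exists>t\<le>time_bound c2 N. exec (compile c2) s t (ev c2 s)"
      using Cond.prems by (intro Cond.IH(2)) auto
    then obtain t where "t \<le> time_bound c2 N" "exec (compile c2) s t (ev c2 s)" by blast
    then show ?thesis using exec.IfFalse[OF True, of "compile c2" t "ev c2 s" "compile c1"] True
      by (intro exI[of _ "1 + exp_cost b + t"]) auto
  next
    case False
    have "\<exists>t\<le>time_bound c1 N. exec (compile c1) s t (ev c1 s)"
      using Cond.prems by (intro Cond.IH(1)) auto
    then obtain t where "t \<le> time_bound c1 N" "exec (compile c1) s t (ev c1 s)" by blast
    then show ?thesis using exec.IfTrue[OF False, of "compile c1" t "ev c1 s" "compile c2"] False
      by (intro exI[of _ "1 + exp_cost b + t"]) auto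
  qed
next
  case (For i b c)
  define M where "M = s b 0"
  define st where "st j = iterate (\<lambda>j t. ev c (set_var i j t)) j s" for j
  \<comment> \<open>The memory at the head of iteration \<open>j\<close>. The body leaves the
    counter alone, so incrementing it after the body agrees with \<open>ev\<close>, which sets it
    before.\<close>
  define U where "U j = set_var i j (st j)" for j
  have MN: "M \<le> N" and ib: "i \<noteq> b" "b \<notin> assigned c" "i \<notin> assigned c"
    using For.prems by (auto simp: M_def)
  have st_Suc: "st (Suc j) = ev c (U j)" for j by (simp add: st_def U_def)
  have st_frame: "st j x = s x" if "x \<noteq> i" "x \<notin> assigned c" for j x
  proof (induction j)
    case (Suc j)
    then show ?case using that by (simp add: st_Suc ev_frame U_def)
  qed (simp add: st_def)
  have Ub: "U j b 0 = M" and Ui: "U j i 0 = j" for j using ib by (auto simp: U_def st_frame M_def)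
  have body: "\<exists>t\<le>time_bound c N + 6. exec (Seq (compile c) (Store i (Const 0) (Plus (Var i) (Const 1)))) (U j) t (U (Suc j))" for j
  proof -
    have "\<exists>t\<le>time_bound c N. exec (compile c) (U j) t (ev c (U j))"
    proof (rule For.IH)
      fix b' assume b': "b' \<in> loop_bounds c"
      then have "b' \<noteq> i" "b' \<notin> assigned c" using For.prems by auto
      then show "U j b' 0 \<le> N" using For.prems(3) b' by (simp add: U_def st_frame)
    qed (use For.prems in auto)
    then obtain t where t: "t \<le> time_bound c N" "exec (compile c) (U j) t (st (Suc j))" by (auto simp: st_Suc)
    have "st (Suc j) i 0 = j" using ib Ui[of j] by (simp add: st_Suc ev_frame)
    then have "exec (Store i (Const 0) (Plus (Var i) (Const 1))) (st (Suc j)) 6 (U (Suc j))"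
      using exec.Store[of i "Const 0" "Plus (Var i) (Const 1)" "st (Suc j)"] by (simp add: U_def numeral_eq_Suc)
    then show ?thesis using exec.Seq[OF t(2)] t(1) by (intro exI[of _ "t + 6"]) auto
  qed
  have loop: "\<exists>t\<le>6 + (M - j) * (12 + time_bound c N).
      exec (While (Minus (Var b) (Var i)) (Seq (compile c) (Store i (Const 0) (Plus (Var i) (Const 1))))) (U j) t (U M)"
    if "j \<le> M" for j
    using that
  proof (induction "M - j" arbitrary: j)
    case 0
    then have "j = M" by simp
    then show ?case using exec.WhileFalse[of "Minus (Var b) (Var i)" "U M"] Ub[of M] Ui[of M]
      by (intro exI[of _ 6]) (auto simp: numeral_eq_Suc)
  next
    case (Suc l)
    obtain t1 where t1: "t1 \<le> time_bound c N + 6"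
      "exec (Seq (compile c) (Store i (Const 0) (Plus (Var i) (Const 1)))) (U j) t1 (U (Suc j))" using body by blast
    have "l = M - Suc j" "Suc j \<le> M" using Suc.hyps(2) by auto
    from Suc.hyps(1)[OF this] obtain t2 where t2: "t2 \<le> 6 + (M - Suc j) * (12 + time_bound c N)"
      "exec (While (Minus (Var b) (Var i)) (Seq (compile c) (Store i (Const 0) (Plus (Var i) (Const 1))))) (U (Suc j)) t2 (U M)"
      by blast
    have "exp_val (Minus (Var b) (Var i)) (U j) \<noteq> 0" using Suc.hyps(2) Ub[of j] Ui[of j] by simp
    from exec.WhileTrue[OF this t1(2) t2(2)]
    have "exec (While (Minus (Var b) (Var i)) (Seq (compile c) (Store i (Const 0) (Plus (Var i) (Const 1)))))
      (U j) (6 + t1 + t2) (U M)" by (simp add: numeral_eq_Suc)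
    moreover have "6 + t1 + t2 \<le> 6 + (M - j) * (12 + time_bound c N)"
    proof -
      have "M - j = Suc (M - Suc j)" using Suc.hyps(2) by simp
      then show ?thesis using t1(1) t2(1) by simp
    qed
    ultimately show ?case by blast
  qed
  obtain t where t: "t \<le> 6 + M * (12 + time_bound c N)"
    "exec (While (Minus (Var b) (Var i)) (Seq (compile c) (Store i (Const 0) (Plus (Var i) (Const 1))))) (U 0) t (U M)"
    using loop[of 0] by auto
  have "exec (Store i (Const 0) (Const 0)) s 3 (U 0)"
    using exec.Store[of i "Const 0" "Const 0" s] by (simp add: U_def st_def numeral_eq_Suc)
  from exec.Seq[OF this t(2)] have "exec (compile (For i b c)) s (3 + t) (ev (For i b c) s)"
    by (simp add: U_def st_def M_def)
  moreover have "3 + t \<le> time_bound (For i b c) N"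
    using order_trans[OF t(1) add_left_mono[OF mult_le_mono1[OF MN, of "12 + time_bound c N"]]] by simp
  ultimately show ?case by blast
qed

text \<open>By induction on the program: functions below some \<open>C * (N + 1) ^ e\<close> are
  closed under addition and under multiplication by \<open>N\<close>. Taking \<open>N + 1\<close>
  keeps the base positive, so that exponents can be raised.\<close>

lemma time_bound_poly: "\<exists>C e. \<forall>N. time_bound c N \<le> C * (N + 1) ^ e"
proof -
  have up: "C * (N + 1) ^ e \<le> D * (N + 1) ^ f" if "C \<le> D" "e \<le> f" for C D e f N :: nat
    using that by (intro mult_le_mono power_increasing) auto
  have add: "\<exists>C e. \<forall>N. f N + g N \<le> C * (N + 1) ^ e"
    if f: "\<exists>C e. \<forall>N. f N \<le> C * (N + 1) ^ e" and g: "\<exists>C e. \<forall>N. g N \<le> C * (N + 1) ^ e" for f g :: "nat \<Rightarrow> nat"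
  proof -
    obtain C e D e' where *: "\<And>N. f N \<le> C * (N + 1) ^ e" "\<And>N. g N \<le> D * (N + 1) ^ e'" using f g by blast
    have "f N + g N \<le> (C + D) * (N + 1) ^ (e + e')" for N
    proof -
      have "f N \<le> C * (N + 1) ^ (e + e')" by (rule le_trans[OF *(1) up]) simp_all
      moreover have "g N \<le> D * (N + 1) ^ (e + e')" by (rule le_trans[OF *(2) up]) simp_all
      ultimately show ?thesis by (simp add: add_mult_distrib)
    qed
    then show ?thesis by blast
  qed
  have const: "\<exists>C e. \<forall>N. d \<le> C * (N + 1) ^ e" for d :: nat
    by (rule exI[of _ d], rule exI[of _ 0]) simp
  have mult: "\<exists>C e. \<forall>N. N * f N \<le> C * (N + 1) ^ e" if f: "\<exists>C e. \<forall>N. f N \<le> C * (N + 1) ^ e" for f :: "nat \<Rightarrow> nat"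
  proof -
    obtain C e where *: "\<And>N. f N \<le> C * (N + 1) ^ e" using f by blast
    have "N * f N \<le> C * (N + 1) ^ Suc e" for N
      using mult_le_mono[of N "N + 1", OF _ *[of N]] by (simp add: mult.left_commute)
    then show ?thesis by blast
  qed
  show ?thesis
  proof (induction c)
    case Nop
    show ?case using const[of 1] by simp
  next
    case (Assign x i e)
    show ?case using const[of "1 + exp_cost i + exp_cost e"] by simp
  next
    case (Then c1 c2)
    then show ?case using add by simp
  next
    case (Cond b c1 c2)
    then show ?case
      using add[OF add[OF const[of "1 + exp_cost b"]], of "time_bound c1" "time_bound c2"] by simp
  next
    case (For i b c)
    show ?case
      using add[OF const[of 9] mult[OF add[OF const[of 12] For]]] by simp
  qed
qed

text \<open>An invariant rule that supplies the frame for free: everything outside \<open>i\<close>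
  and \<open>assigned c\<close> is known to be unchanged, so an invariant only mentions what the
  body modifies.\<close>

lemma For_rule:
  assumes "I 0 s"
    and "\<And>j t. j < s b 0 \<Longrightarrow> I j t \<Longrightarrow> (\<And>x. x \<noteq> i \<Longrightarrow> x \<notin> assigned c \<Longrightarrow> t x = s x) \<Longrightarrow>
      I (Suc j) (ev c (set_var i j t))"
  obtains t where "I (s b 0) t" "ev (For i b c) s = set_var i (s b 0) t"
proof -
  let ?f = "\<lambda>j t. ev c (set_var i j t)"
  have "I N (iterate ?f N s) \<and> (\<forall>x. x \<noteq> i \<longrightarrow> x \<notin> assigned c \<longrightarrow> iterate ?f N s x = s x)" if "N \<le> s b 0" for N
    using that
  proof (induction N)
    case 0
    then show ?case using assms(1) by simp
  next
    case (Suc N)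
    have "N \<le> s b 0" using Suc.prems by simp
    from Suc.IH[OF this] have IH: "I N (iterate ?f N s)" "\<And>x. x \<noteq> i \<Longrightarrow> x \<notin> assigned c \<Longrightarrow> iterate ?f N s x = s x" by blast+
    have "I (Suc N) (?f N (iterate ?f N s))"
      using Suc.prems by (intro assms(2)[OF _ IH]) auto
    moreover have "?f N (iterate ?f N s) x = s x" if "x \<noteq> i" "x \<notin> assigned c" for x
      using ev_frame[OF that(2)] IH(2)[OF that] that(1) by simp
    ultimately show ?case unfolding iterate.simps by blast
  qed
  from this[OF order_refl] show thesis using that[of "iterate ?f (s b 0) s"] unfolding ev.simps by blast
qed

lemma ev_For_fill:
  assumes c: "\<And>j t. j < s b 0 \<Longrightarrow> (\<And>y. y \<noteq> x \<Longrightarrow> y \<noteq> i \<Longrightarrow> t y = s y) \<Longrightarrow> t i 0 = j \<Longrightarrow> exp_val e t = f j"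
    and "x \<noteq> i"
  shows "ev (For i b (Assign x (Var i) e)) s x = (\<lambda>j. if j < s b 0 then f j else s x j)"
proof -
  obtain t where "t x = (\<lambda>j. if j < s b 0 then f j else s x j)"
    "ev (For i b (Assign x (Var i) e)) s = set_var i (s b 0) t"
  proof (rule For_rule[where I = "\<lambda>l t. t x = (\<lambda>j. if j < l then f j else s x j)"
        and s = s and b = b and i = i and c = "Assign x (Var i) e"])
    fix j t assume j: "j < s b 0" "t x = (\<lambda>l. if l < j then f l else s x l)"
      "\<And>y. y \<noteq> i \<Longrightarrow> y \<notin> assigned (Assign x (Var i) e) \<Longrightarrow> t y = s y"
    have "exp_val e (set_var i j t) = f j" by (rule c) (use j in auto)
    then show "ev (Assign x (Var i) e) (set_var i j t) x = (\<lambda>l. if l < Suc j then f l else s x l)"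
      using j(2) assms(2) by auto
  qed auto
  then show ?thesis using assms(2) by simp
qed

section \<open>The program\<close>

text \<open>
  Register names: \<open>T\<close>, \<open>H\<close>, \<open>d\<close> are the tails, heads and multiplicities of the arcs, \<open>D\<close> the
  out-degrees, \<open>x\<close> and \<open>y\<close> the two cores, \<open>g\<close> the guesses. Reachability works on the support of
  the weights \<open>w\<close> and marks the vertices \<open>q\<close>; \<open>z\<close> holds the current violator, \<open>f\<close> tells whether
  there is one, and \<open>j\<close> is the verdict on Edmonds' condition.
\<close>

abbreviation Set :: "string \<Rightarrow> exp \<Rightarrow> prg" where
  "Set x e \<equiv> Assign x (Const 0) e"

definition Eq :: "exp \<Rightarrow> exp \<Rightarrow> exp" where
  "Eq e1 e2 = Minus (Minus (Const 1) (Minus e1 e2)) (Minus e2 e1)"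

lemma exp_val_Eq [simp]: "exp_val (Eq e1 e2) s = (if exp_val e1 s = exp_val e2 s then 1 else 0)"
  by (auto simp: Eq_def)

definition PASS :: prg where
  "PASS = For ''i'' ''m'' (Cond (Cell ''w'' (Var ''i''))
     (Cond (Cell ''q'' (Cell ''T'' (Var ''i''))) (Assign ''q'' (Cell ''H'' (Var ''i'')) (Const 1)) Nop) Nop)"

definition CLOSE :: prg where
  "CLOSE = For ''t'' ''m'' PASS"

definition GROW :: "exp \<Rightarrow> exp \<Rightarrow> prg" where
  "GROW ew eq = For ''i'' ''m'' (Assign ''w'' (Var ''i'') ew) ;;
     For ''u'' ''n'' (Assign ''q'' (Var ''u'') eq) ;; CLOSE"

text \<open>Register \<open>c\<close> counts down from a threshold with truncated subtraction and
  stays positive iff fewer vertices are marked. A marked vertex of out-degree above \<open>B\<close>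
  sets it to 0 for good.\<close>

definition COUNT :: prg where
  "COUNT = For ''u'' ''n'' (Cond (Cell ''q'' (Var ''u''))
     (Set ''c'' (Minus (Var ''c'') (Const 1)) ;;
      Cond (Minus (Cell ''D'' (Var ''u'')) (Var ''B'')) (Set ''c'' (Const 0)) Nop) Nop)"

definition COPY :: "string \<Rightarrow> prg" where
  "COPY x = For ''u'' ''n'' (Assign x (Var ''u'') (Cell ''q'' (Var ''u'')))"

definition FIND :: "string \<Rightarrow> prg" where
  "FIND X = Set ''f'' (Const 0) ;; For ''a'' ''m''
     (GROW (Minus (Cell X (Var ''i'')) (Eq (Var ''i'') (Var ''a''))) (Eq (Var ''u'') (Var ''r'')) ;;
      Cond (Var ''a'') (Set ''c'' (Var ''k'')) (Set ''c'' (Var ''h'')) ;;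
      COUNT ;;
      Cond (Var ''c'') (Set ''f'' (Const 1) ;; COPY ''z'') Nop)"

definition CHECK :: prg where
  "CHECK = For ''u'' ''n'' (Cond (Cell ''q'' (Var ''u'')) Nop (Set ''j'' (Const 0)))"

definition EXTEND :: prg where
  "EXTEND = GROW (Cell ''x'' (Var ''i'')) (Eq (Var ''u'') (Var ''r'')) ;; COPY ''R'' ;;
     GROW (Cell ''y'' (Var ''i'')) (Eq (Var ''u'') (Var ''r'')) ;; COPY ''S'' ;;
     For ''i'' ''m'' (Assign ''e'' (Var ''i'')
       (Minus (Cell ''d'' (Var ''i'')) (Plus (Cell ''x'' (Var ''i'')) (Cell ''y'' (Var ''i''))))) ;;
     Set ''j'' (Const 1) ;;
     GROW (Cell ''e'' (Var ''i'')) (Cell ''R'' (Var ''u'')) ;; CHECK ;;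
     GROW (Cell ''e'' (Var ''i'')) (Cell ''S'' (Var ''u'')) ;; CHECK ;;
     For ''b'' ''m''
       (GROW (Minus (Cell ''e'' (Var ''i'')) (Eq (Var ''i'') (Var ''b'')))
          (Plus (Cell ''R'' (Var ''u'')) (Cell ''S'' (Var ''u''))) ;; CHECK)"

text \<open>These write sets, kept as simp rules, discharge the side conditions of
  \<open>ev_frame\<close> without unfolding the programs again.\<close>

lemma assigned_PASS [simp]: "assigned PASS = {''i'', ''q''}"
  by (auto simp: PASS_def)

lemma assigned_CLOSE [simp]: "assigned CLOSE = {''t'', ''i'', ''q''}"
  by (auto simp: CLOSE_def)

lemma assigned_GROW [simp]: "assigned (GROW ew eq) = {''i'', ''w'', ''u'', ''q'', ''t''}"
  by (auto simp: GROW_def)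

lemma assigned_COUNT [simp]: "assigned COUNT = {''u'', ''c''}"
  by (auto simp: COUNT_def)

lemma assigned_COPY [simp]: "assigned (COPY x) = {''u'', x}"
  by (auto simp: COPY_def)

lemma assigned_FIND [simp]:
  "assigned (FIND X) = {''f'', ''a'', ''i'', ''w'', ''u'', ''q'', ''t'', ''c'', ''z''}"
  by (auto simp: FIND_def)

lemma assigned_CHECK [simp]: "assigned CHECK = {''u'', ''j''}"
  by (auto simp: CHECK_def)

lemma assigned_EXTEND [simp]:
  "assigned EXTEND = {''i'', ''w'', ''u'', ''q'', ''t'', ''R'', ''S'', ''e'', ''j'', ''b''}"
  by (auto simp: EXTEND_def)

section \<open>Correctness of the closure, the violator search and Edmonds' test\<close>

context arc_array
begin

definition graph_mem :: "memory \<Rightarrow> bool" where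
  "graph_mem s \<longleftrightarrow> s ''n'' 0 = n \<and> s ''m'' 0 = m \<and> s ''r'' 0 = r \<and> n \<le> m \<and>
     (\<forall>i<m. s ''T'' i = src i \<and> s ''H'' i = dst i \<and> s ''d'' i = d i) \<and> (\<forall>u<n. s ''D'' u = outdeg u)"

definition marked :: "memory \<Rightarrow> string \<Rightarrow> nat set" where
  "marked s x = {u. u < n \<and> s x u \<noteq> 0}"

lemma graph_mem_cong:
  assumes "graph_mem s" "\<And>x. x \<in> {''n'', ''m'', ''r'', ''T'', ''H'', ''d'', ''D''} \<Longrightarrow> t x = s x"
  shows "graph_mem t"
  using assms by (simp add: graph_mem_def)

lemma graph_mem_ev:
  assumes "graph_mem s" "assigned c \<inter> {''n'', ''m'', ''r'', ''T'', ''H'', ''d'', ''D''} = {}"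
  shows "graph_mem (ev c s)"
  by (rule graph_mem_cong[OF assms(1)], rule ev_frame) (use assms(2) in blast)

lemma marked_less: "marked s x \<subseteq> {..<n}"
  by (auto simp: marked_def)

text \<open>A mark set early in a pass may be propagated later in the same pass, so the result is
  not exactly one step of reachability. A lower and an upper bound are enough for
  \<open>ev_CLOSE\<close>.\<close>

lemma ev_PASS:
  assumes s: "graph_mem s"
  shows "marked s ''q'' \<subseteq> marked (ev PASS s) ''q''"
    "marked (ev PASS s) ''q'' \<subseteq> reach (s ''w'') (marked s ''q'')"
    "i < m \<Longrightarrow> 0 < s ''w'' i \<Longrightarrow> src i \<in> marked s ''q'' \<Longrightarrow> dst i \<in> marked (ev PASS s) ''q''"
proof -
  let ?M = "marked s ''q''"
  define I where "I l t \<longleftrightarrow> ?M \<subseteq> marked t ''q'' \<and> marked t ''q'' \<subseteq> reach (s ''w'') ?M \<and>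
    (\<forall>i<l. 0 < s ''w'' i \<longrightarrow> src i \<in> ?M \<longrightarrow> dst i \<in> marked t ''q'')" for l t
  have sm: "s ''m'' 0 = m" using s by (simp add: graph_mem_def)
  obtain t where t: "I (s ''m'' 0) t" "ev PASS s = set_var ''i'' (s ''m'' 0) t"
    unfolding PASS_def
  proof (rule For_rule[where I = I and s = s])
    show "I 0 s" by (auto simp: I_def intro: reach.base)
  next
    fix l t
    let ?c = "Cond (Cell ''w'' (Var ''i''))
     (Cond (Cell ''q'' (Cell ''T'' (Var ''i''))) (Assign ''q'' (Cell ''H'' (Var ''i'')) (Const 1)) Nop) Nop"
    assume l: "l < s ''m'' 0" and I: "I l t"
      and fr: "\<And>x. x \<noteq> ''i'' \<Longrightarrow> x \<notin> assigned ?c \<Longrightarrow> t x = s x"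
    have lm: "l < m" using l sm by simp
    have TH: "t ''w'' = s ''w''" "t ''T'' l = src l" "t ''H'' l = dst l" "src l < n" "dst l < n"
      using fr lm s src_in dst_in by (auto simp: graph_mem_def)
    let ?t = "ev ?c (set_var ''i'' l t)"
    have q: "?t ''q'' = (if 0 < s ''w'' l \<and> t ''q'' (src l) \<noteq> 0 then (t ''q'')(dst l := 1) else t ''q'')"
      using TH by simp
    have mk: "marked ?t ''q'' = (if 0 < s ''w'' l \<and> src l \<in> marked t ''q'' then insert (dst l) (marked t ''q'') else marked t ''q'')"
      unfolding marked_def q using TH(4,5) by auto
    show "I (Suc l) ?t"
      using I lm unfolding I_def mk by (auto simp: less_Suc_eq intro: reach.step)
  qed
  then have "marked (ev PASS s) ''q'' = marked t ''q''" by (simp add: marked_def)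
  with t(1) sm show "?M \<subseteq> marked (ev PASS s) ''q''"
    "marked (ev PASS s) ''q'' \<subseteq> reach (s ''w'') ?M"
    "i < m \<Longrightarrow> 0 < s ''w'' i \<Longrightarrow> src i \<in> ?M \<Longrightarrow> dst i \<in> marked (ev PASS s) ''q''"
    by (auto simp: I_def)
qed

lemma reach_idem:
  assumes "R \<subseteq> Q" "Q \<subseteq> reach x R"
  shows "reach x Q = reach x R"
proof
  show "reach x Q \<subseteq> reach x R" by (rule reach_least) (use assms(2) in \<open>auto intro: reach.step\<close>)
  show "reach x R \<subseteq> reach x Q" by (rule reach_mono) (use assms(1) in auto)
qed

text \<open>A pass that marks nothing new has reached the closure, so \<open>m \<ge> n\<close> passes suffice.\<close>

lemma ev_CLOSE:
  assumes s: "graph_mem s"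
  shows "marked (ev CLOSE s) ''q'' = reach (s ''w'') (marked s ''q'')"
proof -
  let ?R = "marked s ''q''"
  define I where "I l t \<longleftrightarrow> ?R \<subseteq> marked t ''q'' \<and> marked t ''q'' \<subseteq> reach (s ''w'') ?R \<and>
    (marked t ''q'' = reach (s ''w'') ?R \<or> l \<le> card (marked t ''q''))" for l t
  obtain t where t: "I (s ''m'' 0) t" "ev CLOSE s = set_var ''t'' (s ''m'' 0) t"
    unfolding CLOSE_def
  proof (rule For_rule[where I = I and s = s])
    show "I 0 s" by (auto simp: I_def intro: reach.base)
  next
    fix l t
    assume I: "I l t" and fr: "\<And>x. x \<noteq> ''t'' \<Longrightarrow> x \<notin> assigned PASS \<Longrightarrow> t x = s x"
    let ?t = "set_var ''t'' l t"
    have gm: "graph_mem ?t" by (rule graph_mem_cong[OF s]) (auto simp: fr)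
    have w: "?t ''w'' = s ''w''" and q: "marked ?t ''q'' = marked t ''q''" by (simp_all add: marked_def fr)
    note pass = ev_PASS[OF gm, unfolded w q]
    have "reach (s ''w'') (marked t ''q'') = reach (s ''w'') ?R"
      using I by (intro reach_idem) (auto simp: I_def)
    then have sub: "marked (ev PASS ?t) ''q'' \<subseteq> reach (s ''w'') ?R" using pass(2) by simp
    have fin: "finite (marked (ev PASS ?t) ''q'')" by (rule finite_subset[OF marked_less]) simp
    consider "marked (ev PASS ?t) ''q'' = marked t ''q''" | "marked t ''q'' \<subset> marked (ev PASS ?t) ''q''"
      using pass(1) by blast
    then show "I (Suc l) (ev PASS ?t)"
    proof cases
      case 1
      have "reach (s ''w'') ?R \<subseteq> marked t ''q''"
        by (rule reach_least) (use I pass(3) 1 in \<open>auto simp: I_def\<close>)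
      then show ?thesis using I 1 unfolding I_def by blast
    next
      case 2
      then have "card (marked t ''q'') < card (marked (ev PASS ?t) ''q'')" using fin by (intro psubset_card_mono)
      moreover have "marked t ''q'' \<noteq> reach (s ''w'') ?R" using 2 sub by blast
      ultimately show ?thesis using I sub 2 by (auto simp: I_def)
    qed
  qed
  have "marked t ''q'' = reach (s ''w'') ?R"
  proof (rule ccontr)
    assume ne: "marked t ''q'' \<noteq> reach (s ''w'') ?R"
    then have "n \<le> card (marked t ''q'')" using t(1) s by (auto simp: I_def graph_mem_def)
    then have "marked t ''q'' = {..<n}" by (intro card_seteq marked_less) auto
    then show False using ne t(1) reach_subset[OF marked_less, of "s ''w''" s "''q''"] by (auto simp: I_def)
  qed
  then show ?thesis by (simp add: t(2) marked_def)
qed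

text \<open>\<open>ew\<close> and \<open>eq\<close> are evaluated while scratch arrays are being
  overwritten; therefore their values are required in every memory that agrees with \<open>s\<close>
  elsewhere.\<close>

lemma ev_GROW:
  assumes s: "graph_mem s"
    and w: "\<And>j t. j < m \<Longrightarrow> (\<And>x. x \<notin> {''i'', ''w''} \<Longrightarrow> t x = s x) \<Longrightarrow> t ''i'' 0 = j \<Longrightarrow> exp_val ew t = W j"
    and q: "\<And>u t. u < n \<Longrightarrow> (\<And>x. x \<notin> {''i'', ''w'', ''u'', ''q''} \<Longrightarrow> t x = s x) \<Longrightarrow> t ''u'' 0 = u \<Longrightarrow>
      exp_val eq t = Q u"
  shows "marked (ev (GROW ew eq) s) ''q'' = reach W {u. u < n \<and> 0 < Q u}"
proof -
  let ?c1 = "For ''i'' ''m'' (Assign ''w'' (Var ''i'') ew)"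
  let ?c2 = "For ''u'' ''n'' (Assign ''q'' (Var ''u'') eq)"
  define s1 where "s1 = ev ?c1 s"
  define s2 where "s2 = ev ?c2 s1"
  have fr1: "s1 x = s x" if "x \<notin> {''i'', ''w''}" for x
    using that unfolding s1_def by (intro ev_frame) auto
  have fr2: "s2 x = s1 x" if "x \<notin> {''u'', ''q''}" for x
    using that unfolding s2_def by (intro ev_frame) auto
  have sm: "s ''m'' 0 = m" "s1 ''n'' 0 = n" using s fr1 by (auto simp: graph_mem_def)
  have "s1 ''w'' = (\<lambda>j. if j < s ''m'' 0 then W j else s ''w'' j)"
    unfolding s1_def by (rule ev_For_fill) (use w sm in auto)
  then have w2: "s2 ''w'' j = W j" if "j < m" for j using that sm fr2 by simp
  have "s2 ''q'' = (\<lambda>u. if u < s1 ''n'' 0 then Q u else s1 ''q'' u)"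
    unfolding s2_def by (rule ev_For_fill) (use q sm fr1 in auto)
  then have q2: "marked s2 ''q'' = {u. u < n \<and> 0 < Q u}" using sm by (auto simp: marked_def)
  have gm: "graph_mem s2" by (rule graph_mem_cong[OF s]) (auto simp: fr1 fr2)
  have "marked (ev CLOSE s2) ''q'' = reach (s2 ''w'') {u. u < n \<and> 0 < Q u}"
    using ev_CLOSE[OF gm] q2 by simp
  also have "\<dots> = reach W {u. u < n \<and> 0 < Q u}" by (rule reach_cong) (simp add: w2)
  finally show ?thesis by (simp add: GROW_def s1_def s2_def)
qed

lemma ev_GROW_root:
  assumes s: "graph_mem s"
    and w: "\<And>j t. j < m \<Longrightarrow> (\<And>x. x \<notin> {''i'', ''w''} \<Longrightarrow> t x = s x) \<Longrightarrow> t ''i'' 0 = j \<Longrightarrow> exp_val ew t = W j"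
  shows "marked (ev (GROW ew (Eq (Var ''u'') (Var ''r''))) s) ''q'' = reach W {r}"
proof -
  have "marked (ev (GROW ew (Eq (Var ''u'') (Var ''r''))) s) ''q''
      = reach W {u. u < n \<and> 0 < (if u = r then 1 else 0 :: nat)}"
    by (rule ev_GROW[OF s w]) (use s in \<open>auto simp: graph_mem_def\<close>)
  also have "{u. u < n \<and> 0 < (if u = r then 1 else 0 :: nat)} = {r}" using root_less by auto
  finally show ?thesis .
qed

lemma ev_COPY:
  assumes "graph_mem s" "x \<notin> {''u'', ''q''}"
  shows "u < n \<Longrightarrow> ev (COPY x) s x u = s ''q'' u" "marked (ev (COPY x) s) x = marked s ''q''"
proof -
  have "ev (COPY x) s x = (\<lambda>u. if u < s ''n'' 0 then s ''q'' u else s x u)"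
    unfolding COPY_def by (rule ev_For_fill) (use assms(2) in auto)
  then show "u < n \<Longrightarrow> ev (COPY x) s x u = s ''q'' u" "marked (ev (COPY x) s) x = marked s ''q''"
    using assms(1) by (auto simp: graph_mem_def marked_def)
qed

lemma ev_COUNT:
  assumes s: "graph_mem s"
  shows "0 < ev COUNT s ''c'' 0 \<longleftrightarrow>
    card (marked s ''q'') < s ''c'' 0 \<and> marked s ''q'' \<inter> big (s ''B'' 0) = {}"
proof -
  let ?M = "\<lambda>l. marked s ''q'' \<inter> {..<l}" and ?G = "big (s ''B'' 0)"
  define I where "I l t \<longleftrightarrow> t ''c'' 0 = (if ?M l \<inter> ?G = {} then s ''c'' 0 - card (?M l) else 0)" for l and t :: memory
  have sn: "s ''n'' 0 = n" using s by (simp add: graph_mem_def)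
  obtain t where t: "I (s ''n'' 0) t" "ev COUNT s = set_var ''u'' (s ''n'' 0) t"
    unfolding COUNT_def
  proof (rule For_rule[where I = I and s = s])
    show "I 0 s" by (simp add: I_def)
  next
    fix l t
    let ?c = "Cond (Cell ''q'' (Var ''u'')) (Set ''c'' (Minus (Var ''c'') (Const 1)) ;;
      Cond (Minus (Cell ''D'' (Var ''u'')) (Var ''B'')) (Set ''c'' (Const 0)) Nop) Nop"
    assume l: "l < s ''n'' 0" and I: "I l t" and fr: "\<And>x. x \<noteq> ''u'' \<Longrightarrow> x \<notin> assigned ?c \<Longrightarrow> t x = s x"
    have ln: "l < n" using l sn by simp
    have e: "t ''q'' = s ''q''" "t ''B'' = s ''B''" "t ''D'' l = outdeg l"
      using fr s ln by (auto simp: graph_mem_def)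
    have c: "ev ?c (set_var ''u'' l t) ''c'' 0 = (if s ''q'' l = 0 then t ''c'' 0
        else if s ''B'' 0 < outdeg l then 0 else t ''c'' 0 - 1)"
      using e by simp
    show "I (Suc l) (ev ?c (set_var ''u'' l t))"
    proof (cases "s ''q'' l = 0")
      case True
      then have "?M (Suc l) = ?M l" by (auto simp: marked_def less_Suc_eq)
      then show ?thesis using I True unfolding I_def c by simp
    next
      case False
      then have M: "?M (Suc l) = insert l (?M l)" using ln by (auto simp: marked_def less_Suc_eq)
      then have cd: "card (?M (Suc l)) = Suc (card (?M l))" by simp
      have "l \<in> ?G \<longleftrightarrow> s ''B'' 0 < outdeg l" using ln by (simp add: big_def)
      then show ?thesis using I False unfolding I_def c cd M by auto
    qed
  qed
  have "?M (s ''n'' 0) = marked s ''q''" using sn marked_less[of s "''q''"] by auto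
  then have "t ''c'' 0 = (if marked s ''q'' \<inter> ?G = {} then s ''c'' 0 - card (marked s ''q'') else 0)"
    using t(1) by (simp add: I_def)
  then show ?thesis by (simp add: t(2))
qed

lemma ev_FIND:
  assumes s: "graph_mem s" and X: "X \<in> {''x'', ''y''}"
  defines "viol \<equiv> violator (s ''h'' 0) (s ''k'' 0) (s ''B'' 0) (s X)"
  shows "0 < ev (FIND X) s ''f'' 0 \<longleftrightarrow> viol \<noteq> None" "viol = Some Z \<Longrightarrow> marked (ev (FIND X) s) ''z'' = Z"
proof -
  let ?h = "s ''h'' 0" and ?k = "s ''k'' 0" and ?B = "s ''B'' 0"
  let ?bad = "\<lambda>l. {i. i < l \<and> bad ?h ?k ?B (s X) i}"
  define I where "I l t \<longleftrightarrow> (0 < t ''f'' 0 \<longleftrightarrow> ?bad l \<noteq> {}) \<and>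
    (?bad l \<noteq> {} \<longrightarrow> marked t ''z'' = reach_del (s X) (Max (?bad l)))" for l t
  let ?grow = "GROW (Minus (Cell X (Var ''i'')) (Eq (Var ''i'') (Var ''a''))) (Eq (Var ''u'') (Var ''r''))"
  let ?thr = "Cond (Var ''a'') (Set ''c'' (Var ''k'')) (Set ''c'' (Var ''h''))"
  let ?fin = "Cond (Var ''c'') (Set ''f'' (Const 1) ;; COPY ''z'') Nop"
  let ?s = "set_var ''f'' 0 s"
  have sm: "?s ''m'' 0 = m" using s by (simp add: graph_mem_def)
  obtain t where t: "I (?s ''m'' 0) t"
    "ev (For ''a'' ''m'' (?grow ;; ?thr ;; COUNT ;; ?fin)) ?s = set_var ''a'' (?s ''m'' 0) t"
  proof (rule For_rule[where I = I and s = ?s and i = "''a''" and b = "''m''" and c = "?grow ;; ?thr ;; COUNT ;; ?fin"])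
    show "I 0 ?s" by (simp add: I_def)
  next
    fix l t
    assume l: "l < ?s ''m'' 0" and I: "I l t"
      and fr: "\<And>x. x \<noteq> ''a'' \<Longrightarrow> x \<notin> assigned (?grow ;; ?thr ;; COUNT ;; ?fin) \<Longrightarrow> t x = ?s x"
    have lm: "l < m" using l sm by simp
    let ?t = "set_var ''a'' l t"
    define t1 where "t1 = ev ?grow ?t"
    define t2 where "t2 = ev ?thr t1"
    define t3 where "t3 = ev COUNT t2"
    have gm: "graph_mem ?t" by (rule graph_mem_cong[OF s]) (auto simp: fr)
    have c: "t X = s X" "t ''k'' = s ''k''" "t ''h'' = s ''h''" "t ''B'' = s ''B''" using X by (auto simp: fr)
    have "marked t1 ''q'' = reach (\<lambda>i. s X i - (if i = l then 1 else 0)) {r}"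
      unfolding t1_def
    proof (rule ev_GROW_root[OF gm])
      fix j t' assume t': "\<And>x. x \<notin> {''i'', ''w''} \<Longrightarrow> t' x = ?t x" "t' ''i'' 0 = j"
      have "t' X = s X" "t' ''a'' 0 = l" using t'(1)[of X] t'(1)[of "''a''"] c(1) X by auto
      then show "exp_val (Minus (Cell X (Var ''i'')) (Eq (Var ''i'') (Var ''a''))) t'
          = s X j - (if j = l then 1 else 0)"
        using t'(2) by simp
    qed
    also have "\<dots> = reach_del (s X) l" unfolding reach_del_def by (rule reach_cong) auto
    finally have q1: "marked t1 ''q'' = reach_del (s X) l" .
    have t1: "t1 x = ?t x" if "x \<notin> {''i'', ''w'', ''u'', ''q'', ''t''}" for x
      unfolding t1_def using that by (intro ev_frame) simp
    have t2: "t2 x = t1 x" if "x \<noteq> ''c''" for x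
      unfolding t2_def using that by (intro ev_frame) simp
    have t3: "t3 x = t2 x" if "x \<notin> {''u'', ''c''}" for x
      unfolding t3_def using that by (intro ev_frame) simp
    have c2: "t2 ''c'' 0 = (if l = 0 then ?h else ?k)"
      unfolding t2_def using t1[of "''a''"] t1[of "''k''"] t1[of "''h''"] c by simp
    have gm2: "graph_mem t2" by (rule graph_mem_cong[OF gm]) (auto simp: t1 t2)
    have q2: "marked t2 ''q'' = reach_del (s X) l" using q1 by (simp add: marked_def t2)
    have B2: "t2 ''B'' = s ''B''" by (simp add: t1 t2 c)
    have bad: "0 < t3 ''c'' 0 \<longleftrightarrow> bad ?h ?k ?B (s X) l"
      unfolding t3_def ev_COUNT[OF gm2] q2 c2 B2 bad_def ..
    have f3: "t3 ''f'' = t ''f''" and z3: "marked t3 ''z'' = marked t ''z''" and q3: "marked t3 ''q'' = reach_del (s X) l"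
      using q2 by (simp_all add: marked_def t1 t2 t3)
    have gm3: "graph_mem (set_var ''f'' 1 t3)" by (rule graph_mem_cong[OF gm2]) (auto simp: t3)
    have bad_Suc: "?bad (Suc l) = (if bad ?h ?k ?B (s X) l then insert l (?bad l) else ?bad l)"
      by (auto simp: less_Suc_eq)
    have eq: "ev (?grow ;; ?thr ;; COUNT ;; ?fin) ?t = ev ?fin t3"
      unfolding t1_def t2_def t3_def by (simp only: ev.simps(3))
    show "I (Suc l) (ev (?grow ;; ?thr ;; COUNT ;; ?fin) ?t)"
      unfolding eq
    proof (cases "bad ?h ?k ?B (s X) l")
      case True
      then have fin: "ev ?fin t3 = ev (COPY ''z'') (set_var ''f'' 1 t3)" using bad by simp
      have "Max (?bad (Suc l)) = l" using True unfolding bad_Suc by (intro Max_eqI) auto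
      moreover have "marked (ev (COPY ''z'') (set_var ''f'' 1 t3)) ''z'' = reach_del (s X) l"
        using ev_COPY(2)[OF gm3, of "''z''"] q3 by (simp add: marked_def)
      moreover have "ev (COPY ''z'') (set_var ''f'' 1 t3) ''f'' = (set_var ''f'' 1 t3) ''f''" by (rule ev_frame) simp
      ultimately show "I (Suc l) (ev ?fin t3)" unfolding I_def fin using True bad_Suc by simp
    next
      case False
      then have "ev ?fin t3 = t3" using bad by simp
      moreover have "?bad (Suc l) = ?bad l" using False bad_Suc by simp
      ultimately show "I (Suc l) (ev ?fin t3)" using I f3 z3 unfolding I_def by simp
    qed
  qed
  have ev: "ev (FIND X) s = set_var ''a'' m t" unfolding FIND_def using t(2) sm by (simp only: ev.simps(2,3) exp_val.simps)
  have f: "ev (FIND X) s ''f'' 0 = t ''f'' 0" and z: "marked (ev (FIND X) s) ''z'' = marked t ''z''"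
    unfolding ev by (simp_all add: marked_def)
  show "0 < ev (FIND X) s ''f'' 0 \<longleftrightarrow> viol \<noteq> None" "viol = Some Z \<Longrightarrow> marked (ev (FIND X) s) ''z'' = Z"
    unfolding f z using t(1) sm by (auto simp: I_def viol_def violator_def split: if_splits)
qed

lemma ev_CHECK:
  assumes s: "graph_mem s"
  shows "0 < ev CHECK s ''j'' 0 \<longleftrightarrow> 0 < s ''j'' 0 \<and> marked s ''q'' = {..<n}"
proof -
  define I where "I l t \<longleftrightarrow> (0 < t ''j'' 0 \<longleftrightarrow> 0 < s ''j'' 0 \<and> (\<forall>u<l. s ''q'' u \<noteq> 0))" for l and t :: memory
  have sn: "s ''n'' 0 = n" using s by (simp add: graph_mem_def)
  obtain t where t: "I (s ''n'' 0) t" "ev CHECK s = set_var ''u'' (s ''n'' 0) t"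
    unfolding CHECK_def
  proof (rule For_rule[where I = I and s = s])
    show "I 0 s" by (simp add: I_def)
  next
    fix l t
    let ?c = "Cond (Cell ''q'' (Var ''u'')) Nop (Set ''j'' (Const 0))"
    assume I: "I l t" and fr: "\<And>x. x \<noteq> ''u'' \<Longrightarrow> x \<notin> assigned ?c \<Longrightarrow> t x = s x"
    then have "t ''q'' = s ''q''" by simp
    then show "I (Suc l) (ev ?c (set_var ''u'' l t))" using I by (auto simp: I_def less_Suc_eq)
  qed
  then show ?thesis using sn by (auto simp: I_def marked_def)
qed

lemma ev_EXTEND:
  assumes s: "graph_mem s"
  shows "0 < ev EXTEND s ''j'' 0 \<longleftrightarrow> extendable d (s ''x'') (s ''y'')"
proof -
  let ?root = "Eq (Var ''u'') (Var ''r'')"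
  let ?e = "For ''i'' ''m'' (Assign ''e'' (Var ''i'')
       (Minus (Cell ''d'' (Var ''i'')) (Plus (Cell ''x'' (Var ''i'')) (Cell ''y'' (Var ''i'')))))"
  let ?del = "GROW (Minus (Cell ''e'' (Var ''i'')) (Eq (Var ''i'') (Var ''b'')))
          (Plus (Cell ''R'' (Var ''u'')) (Cell ''S'' (Var ''u'')))"
  define R1 where "R1 = reach (s ''x'') {r}"
  define R2 where "R2 = reach (s ''y'') {r}"
  define e where "e = (\<lambda>i. d i - (s ''x'' i + s ''y'' i))"
  define s1 where "s1 = ev (COPY ''R'') (ev (GROW (Cell ''x'' (Var ''i'')) ?root) s)"
  define s2 where "s2 = ev (COPY ''S'') (ev (GROW (Cell ''y'' (Var ''i'')) ?root) s1)"
  define s3 where "s3 = ev ?e s2"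
  define s4 where "s4 = set_var ''j'' 1 s3"
  define s5 where "s5 = ev (GROW (Cell ''e'' (Var ''i'')) (Cell ''R'' (Var ''u''))) s4"
  define s6 where "s6 = ev CHECK s5"
  define s7 where "s7 = ev (GROW (Cell ''e'' (Var ''i'')) (Cell ''S'' (Var ''u''))) s6"
  define s8 where "s8 = ev CHECK s7"
  let ?tmp = "{''i'', ''w'', ''u'', ''q'', ''t''}"
  have f1: "s1 x = s x" if "x \<notin> ?tmp \<union> {''R''}" for x
    unfolding s1_def using that by (subst ev_frame; simp)+
  have f2: "s2 x = s1 x" if "x \<notin> ?tmp \<union> {''S''}" for x
    unfolding s2_def using that by (subst ev_frame; simp)+
  have f3: "s3 x = s2 x" if "x \<notin> {''i'', ''e''}" for x
    unfolding s3_def using that by (intro ev_frame) simp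
  have f5: "s5 x = s4 x" if "x \<notin> ?tmp" for x unfolding s5_def using that by (intro ev_frame) simp
  have f6: "s6 x = s5 x" if "x \<notin> {''u'', ''j''}" for x unfolding s6_def using that by (intro ev_frame) simp
  have f7: "s7 x = s6 x" if "x \<notin> ?tmp" for x unfolding s7_def using that by (intro ev_frame) simp
  have f8: "s8 x = s7 x" if "x \<notin> {''u'', ''j''}" for x unfolding s8_def using that by (intro ev_frame) simp
  have gmf: "graph_mem (ev c t)" if "graph_mem t" "assigned c \<inter> {''n'', ''m'', ''r'', ''T'', ''H'', ''d'', ''D''} = {}" for c t
    using that by (rule graph_mem_ev)
  have g1': "graph_mem (ev (GROW (Cell ''x'' (Var ''i'')) ?root) s)" by (rule gmf[OF s]) simp
  then have g1: "graph_mem s1" unfolding s1_def by (rule gmf) simp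
  have g2': "graph_mem (ev (GROW (Cell ''y'' (Var ''i'')) ?root) s1)" by (rule gmf[OF g1]) simp
  then have g2: "graph_mem s2" unfolding s2_def by (rule gmf) simp
  have g3: "graph_mem s3" unfolding s3_def by (rule gmf[OF g2]) simp
  have g4: "graph_mem s4" unfolding s4_def by (rule graph_mem_cong[OF g3]) auto
  have g5: "graph_mem s5" unfolding s5_def by (rule gmf[OF g4]) simp
  have g6: "graph_mem s6" unfolding s6_def by (rule gmf[OF g5]) simp
  have g7: "graph_mem s7" unfolding s7_def by (rule gmf[OF g6]) simp
  have g8: "graph_mem s8" unfolding s8_def by (rule gmf[OF g7]) simp
  have "marked (ev (GROW (Cell ''x'' (Var ''i'')) ?root) s) ''q'' = R1"
    unfolding R1_def by (rule ev_GROW_root[OF s]) auto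
  then have m1: "marked s1 ''R'' = R1" unfolding s1_def using ev_COPY(2)[OF g1', of "''R''"] by simp
  have "marked (ev (GROW (Cell ''y'' (Var ''i'')) ?root) s1) ''q'' = reach (s1 ''y'') {r}"
    by (rule ev_GROW_root[OF g1]) auto
  then have m2: "marked s2 ''S'' = R2" unfolding s2_def using ev_COPY(2)[OF g2', of "''S''"] f1 by (simp add: R2_def)
  have R2: "marked s2 ''R'' = R1" using m1 f2 by (simp add: marked_def)
  have "s3 ''e'' = (\<lambda>j. if j < s2 ''m'' 0 then s2 ''d'' j - (s2 ''x'' j + s2 ''y'' j) else s2 ''e'' j)"
    unfolding s3_def by (rule ev_For_fill) auto
  then have e3: "s3 ''e'' j = e j" if "j < m" for j
    using that g2 f2 f1 by (simp add: graph_mem_def e_def)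
  have R4: "marked s4 ''R'' = R1" and S4: "marked s4 ''S'' = R2" and e4: "s4 ''e'' = s3 ''e''"
    using R2 m2 f3 by (simp_all add: marked_def s4_def)
  have R6: "s6 ''R'' = s4 ''R''" and S6: "s6 ''S'' = s4 ''S''" and e6: "s6 ''e'' = s3 ''e''"
    using f6 f5 e4 by simp_all
  have R8: "s8 ''R'' = s4 ''R''" and S8: "s8 ''S'' = s4 ''S''" and e8: "s8 ''e'' = s3 ''e''"
    using f8 f7 R6 S6 e6 by simp_all
  have "marked s5 ''q'' = reach e {u. u < n \<and> 0 < s4 ''R'' u}"
    unfolding s5_def by (rule ev_GROW[OF g4]) (use e3 e4 in auto)
  then have q5: "marked s5 ''q'' = reach e R1" using R4 by (simp add: marked_def)
  have "marked s7 ''q'' = reach e {u. u < n \<and> 0 < s4 ''S'' u}"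
    unfolding s7_def by (rule ev_GROW[OF g6]) (use e3 e6 S6 in auto)
  then have q7: "marked s7 ''q'' = reach e R2" using S4 by (simp add: marked_def)
  have "s5 ''j'' 0 = 1" using f5[of "''j''"] by (simp add: s4_def)
  then have j6: "0 < s6 ''j'' 0 \<longleftrightarrow> reach e R1 = {..<n}"
    unfolding s6_def ev_CHECK[OF g5] q5 by simp
  have "s7 ''j'' = s6 ''j''" by (rule f7) simp
  then have j8: "0 < s8 ''j'' 0 \<longleftrightarrow> reach e R1 = {..<n} \<and> reach e R2 = {..<n}"
    unfolding s8_def ev_CHECK[OF g7] q7 by (simp only: j6)
  define I where "I l t \<longleftrightarrow> (0 < t ''j'' 0 \<longleftrightarrow> 0 < s8 ''j'' 0 \<and> (\<forall>i<l. reach (e(i := e i - 1)) (R1 \<union> R2) = {..<n}))" for l and t :: memory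
  have sm: "s8 ''m'' 0 = m" using g8 by (simp add: graph_mem_def)
  obtain t where t: "I (s8 ''m'' 0) t" "ev (For ''b'' ''m'' (?del ;; CHECK)) s8 = set_var ''b'' (s8 ''m'' 0) t"
  proof (rule For_rule[where I = I and s = s8 and i = "''b''" and b = "''m''" and c = "?del ;; CHECK"])
    show "I 0 s8" by (simp add: I_def)
  next
    fix l t
    assume l: "l < s8 ''m'' 0" and I: "I l t"
      and fr: "\<And>x. x \<noteq> ''b'' \<Longrightarrow> x \<notin> assigned (?del ;; CHECK) \<Longrightarrow> t x = s8 x"
    let ?t = "set_var ''b'' l t"
    have gm: "graph_mem ?t" by (rule graph_mem_cong[OF g8]) (auto simp: fr)
    have e: "t ''e'' = s3 ''e''" "t ''R'' = s4 ''R''" "t ''S'' = s4 ''S''" using e8 R8 S8 by (simp_all add: fr)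
    have gm': "graph_mem (ev ?del ?t)" by (rule gmf[OF gm]) simp
    have "marked (ev ?del ?t) ''q'' = reach (\<lambda>i. e i - (if i = l then 1 else 0)) {u. u < n \<and> 0 < s4 ''R'' u + s4 ''S'' u}"
      by (rule ev_GROW[OF gm]) (use e e3 in auto)
    also have "\<dots> = reach (e(l := e l - 1)) (R1 \<union> R2)"
    proof -
      have "{u. u < n \<and> 0 < s4 ''R'' u + s4 ''S'' u} = R1 \<union> R2"
        unfolding R4[symmetric] S4[symmetric] by (auto simp: marked_def)
      moreover have "(\<lambda>i. e i - (if i = l then 1 else 0)) = e(l := e l - 1)" by auto
      ultimately show ?thesis by simp
    qed
    finally have q: "marked (ev ?del ?t) ''q'' = reach (e(l := e l - 1)) (R1 \<union> R2)" .
    have "ev ?del ?t ''j'' = ?t ''j''" by (rule ev_frame) simp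
    then have "ev ?del ?t ''j'' 0 = t ''j'' 0" by simp
    then have "0 < ev (?del ;; CHECK) ?t ''j'' 0 \<longleftrightarrow> 0 < t ''j'' 0 \<and> reach (e(l := e l - 1)) (R1 \<union> R2) = {..<n}"
      using ev_CHECK[OF gm'] q by simp
    then show "I (Suc l) (ev (?del ;; CHECK) ?t)" using I unfolding I_def less_Suc_eq by blast
  qed
  have "ev EXTEND s = ev (For ''b'' ''m'' (?del ;; CHECK)) s8"
    unfolding EXTEND_def s8_def s7_def s6_def s5_def s4_def s3_def s2_def s1_def
    by (simp only: ev.simps(2,3) exp_val.simps)
  also note t(2)
  finally have "ev EXTEND s ''j'' 0 = t ''j'' 0" by simp
  moreover have "0 < t ''j'' 0 \<longleftrightarrow> 0 < s8 ''j'' 0 \<and> (\<forall>i<m. reach (e(i := e i - 1)) (R1 \<union> R2) = {..<n})"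
    using t(1) unfolding sm I_def .
  ultimately have "0 < ev EXTEND s ''j'' 0 \<longleftrightarrow> reach e R1 = {..<n} \<and> reach e R2 = {..<n} \<and>
      (\<forall>i\<in>{..<m}. reach (e(i := e i - 1)) (R1 \<union> R2) = {..<n})"
    unfolding j8 Ball_def lessThan_iff by simp
  also have "\<dots> \<longleftrightarrow> extendable d (s ''x'') (s ''y'')"
    unfolding extendable_iff e_def R1_def R2_def ..
  finally show ?thesis .
qed

end

section \<open>Repairs and the program for the main case\<close>

definition UNDO :: "string \<Rightarrow> prg" where
  "UNDO X = Assign X (Var ''l'') (Minus (Cell X (Var ''l'')) (Const 1))"

text \<open>Register \<open>p\<close> is the number of candidates still to be skipped, and
  \<open>v\<close> tells that none has been taken yet. The copy is added tentatively, because
  \<open>EXTEND\<close> tests the stored cores, and is removed if the test fails or \<open>p\<close>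
  is positive.\<close>

definition TRY :: "string \<Rightarrow> prg" where
  "TRY X = Cond (Var ''v'') (Cond (Cell ''z'' (Cell ''T'' (Var ''l''))) (Cond (Cell ''z'' (Cell ''H'' (Var ''l''))) Nop
     (Cond (Minus (Cell ''d'' (Var ''l'')) (Plus (Cell ''x'' (Var ''l'')) (Cell ''y'' (Var ''l''))))
       (Assign X (Var ''l'') (Plus (Cell X (Var ''l'')) (Const 1)) ;; EXTEND ;;
        Cond (Var ''j'') (Cond (Var ''p'') (Set ''p'' (Minus (Var ''p'') (Const 1)) ;; UNDO X) (Set ''v'' (Const 0)))
          (UNDO X)) Nop)) Nop) Nop"

definition REPAIR :: "string \<Rightarrow> exp \<Rightarrow> prg" where
  "REPAIR X e = FIND X ;; Cond (Var ''f'')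
     (Set ''p'' e ;; Set ''v'' (Const 1) ;; For ''l'' ''m'' (TRY X)) Nop"

definition LARGE :: prg where
  "LARGE = For ''i'' ''m'' (Assign ''x'' (Var ''i'') (Const 0)) ;;
     For ''i'' ''m'' (Assign ''y'' (Var ''i'') (Const 0)) ;;
     For ''s'' ''t3''
       (Cond (Minus (Var ''t1'') (Var ''s'')) (Set ''B'' (Var ''b0'')) (Set ''B'' (Var ''n'')) ;;
        Cond (Minus (Var ''t2'') (Var ''s'')) (Set ''h'' (Var ''k'')) (Set ''h'' (Var ''n'')) ;;
        REPAIR ''x'' (Cell ''g'' (Plus (Var ''s'') (Var ''s''))) ;;
        REPAIR ''y'' (Cell ''g'' (Plus (Plus (Var ''s'') (Var ''s'')) (Const 1)))) ;;
     Set ''h'' (Var ''n'') ;; Set ''B'' (Var ''n'') ;;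
     FIND ''x'' ;; Set ''o'' (Var ''f'') ;; FIND ''y'' ;;
     Set ''ok'' (Minus (Const 1) (Plus (Var ''o'') (Var ''f'')))"

lemma assigned_UNDO [simp]: "assigned (UNDO X) = {X}"
  by (simp add: UNDO_def)

lemma assigned_TRY [simp]:
  "assigned (TRY X) = {X, ''p'', ''v'', ''i'', ''w'', ''u'', ''q'', ''t'', ''R'', ''S'', ''e'', ''j'', ''b''}"
  by (auto simp: TRY_def)

lemma assigned_REPAIR [simp]:
  "assigned (REPAIR X e) = {X, ''p'', ''v'', ''l'', ''i'', ''w'', ''u'', ''q'', ''t'', ''R'', ''S'', ''e'', ''j'', ''b'',
     ''f'', ''a'', ''c'', ''z''}"
  by (auto simp: REPAIR_def)

lemma assigned_LARGE [simp]:
  "assigned LARGE = {''x'', ''y'', ''s'', ''B'', ''h'', ''o'', ''ok'', ''p'', ''v'', ''l'', ''i'', ''w'', ''u'', ''q'', ''t'',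
     ''R'', ''S'', ''e'', ''j'', ''b'', ''f'', ''a'', ''c'', ''z''}"
  by (auto simp: LARGE_def)

context arc_array
begin

lemma ev_TRY:
  assumes s: "graph_mem s" and XY: "(X, Y) \<in> {(''x'', ''y''), (''y'', ''x'')}"
    and l: "s ''l'' 0 = l" "l < m"
  defines "cand \<equiv> candidate (s X) (s Y) (marked s ''z'') l"
  shows "s ''v'' 0 = 0 \<or> \<not> cand \<Longrightarrow> ev (TRY X) s X = s X \<and> ev (TRY X) s ''v'' 0 = s ''v'' 0 \<and>
      ev (TRY X) s ''p'' 0 = s ''p'' 0"
    "s ''v'' 0 \<noteq> 0 \<Longrightarrow> cand \<Longrightarrow> s ''p'' 0 \<noteq> 0 \<Longrightarrow> ev (TRY X) s X = s X \<and>
      ev (TRY X) s ''v'' 0 = s ''v'' 0 \<and> ev (TRY X) s ''p'' 0 = s ''p'' 0 - 1"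
    "s ''v'' 0 \<noteq> 0 \<Longrightarrow> cand \<Longrightarrow> s ''p'' 0 = 0 \<Longrightarrow> ev (TRY X) s X = (s X)(l := Suc (s X l)) \<and>
      ev (TRY X) s ''v'' 0 = 0"
proof -
  define s1 where "s1 = s(X := (s X)(l := Suc (s X l)))"
  define s2 where "s2 = ev EXTEND s1"
  have X: "X \<notin> {''n'', ''m'', ''r'', ''T'', ''H'', ''d'', ''D'', ''l'', ''v'', ''p'', ''z'', ''j''}" "X \<noteq> Y"
    and X': "''l'' \<noteq> X" "''v'' \<noteq> X" "''p'' \<noteq> X" "''z'' \<noteq> X" "''j'' \<noteq> X"
    using XY by auto
  have gm1: "graph_mem s1" by (rule graph_mem_cong[OF s]) (use X in \<open>auto simp: s1_def\<close>)
  have fr: "s2 x = s1 x" if "x \<notin> assigned EXTEND" for x unfolding s2_def using that by (rule ev_frame)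
  have s2X: "s2 X = (s X)(l := Suc (s X l))" using XY by (auto simp: fr s1_def)
  have s2v: "s2 ''v'' = s ''v''" "s2 ''p'' = s ''p''" "s2 ''l'' = s ''l''" using X X' by (simp_all add: fr s1_def)
  have j: "0 < s2 ''j'' 0 \<longleftrightarrow> extendable d ((s X)(l := Suc (s X l))) (s Y)"
    unfolding s2_def ev_EXTEND[OF gm1] using XY by (auto simp: s1_def extendable_commute)
  have av: "s ''x'' l + s ''y'' l = s X l + s Y l" using XY by auto
  have TH: "s ''T'' l = src l" "s ''H'' l = dst l" "s ''d'' l = d l" "src l < n" "dst l < n"
    using s l(2) src_in dst_in by (auto simp: graph_mem_def)
  have cand: "cand \<longleftrightarrow> s ''z'' (src l) \<noteq> 0 \<and> s ''z'' (dst l) = 0 \<and> d l - (s X l + s Y l) \<noteq> 0 \<and> 0 < s2 ''j'' 0"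
    unfolding cand_def candidate_def j using TH(4,5) by (auto simp: marked_def)
  let ?last = "Cond (Var ''j'') (Cond (Var ''p'') (Set ''p'' (Minus (Var ''p'') (Const 1)) ;; UNDO X) (Set ''v'' (Const 0)))
          (UNDO X)"
  have ev: "ev (TRY X) s = (if s ''v'' 0 \<noteq> 0 \<and> s ''z'' (src l) \<noteq> 0 \<and> s ''z'' (dst l) = 0 \<and> d l - (s X l + s Y l) \<noteq> 0
      then ev ?last s2 else s)"
    unfolding TRY_def s2_def s1_def
    by (simp only: ev.simps(1-4) exp_val.simps l(1) TH(1-3) av) (auto simp: l(1))
  have undo: "((s X)(l := Suc (s X l)))(l := s X l) = s X" by simp
  have last: "ev ?last s2 = (if 0 < s2 ''j'' 0 then if s ''p'' 0 \<noteq> 0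
      then s2(''p'' := (s2 ''p'')(0 := s ''p'' 0 - 1), X := s X)
      else s2(''v'' := (s2 ''v'')(0 := 0)) else s2(X := s X))"
    using X X' by (simp add: UNDO_def s2X s2v l(1))
  show "s ''v'' 0 = 0 \<or> \<not> cand \<Longrightarrow> ev (TRY X) s X = s X \<and> ev (TRY X) s ''v'' 0 = s ''v'' 0 \<and>
      ev (TRY X) s ''p'' 0 = s ''p'' 0"
    unfolding ev last cand using X X' by (auto simp: s2v)
  show "s ''v'' 0 \<noteq> 0 \<Longrightarrow> cand \<Longrightarrow> s ''p'' 0 \<noteq> 0 \<Longrightarrow> ev (TRY X) s X = s X \<and>
      ev (TRY X) s ''v'' 0 = s ''v'' 0 \<and> ev (TRY X) s ''p'' 0 = s ''p'' 0 - 1"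
    unfolding ev last cand using X X' by (auto simp: s2v)
  show "s ''v'' 0 \<noteq> 0 \<Longrightarrow> cand \<Longrightarrow> s ''p'' 0 = 0 \<Longrightarrow> ev (TRY X) s X = (s X)(l := Suc (s X l)) \<and>
      ev (TRY X) s ''v'' 0 = 0"
    unfolding ev last cand using X X' by (auto simp: s2X)
qed

lemma ev_REPAIR:
  assumes s: "graph_mem s" and XY: "(X, Y) \<in> {(''x'', ''y''), (''y'', ''x'')}"
    and e: "exp_val e (ev (FIND X) s) = c"
  shows "ev (REPAIR X e) s X = repair (s ''h'' 0) (s ''k'' 0) (s ''B'' 0) c (s X) (s Y)"
proof -
  have X: "X \<in> {''x'', ''y''}" "Y \<in> {''x'', ''y''}" "X \<noteq> Y" using XY by auto
  define s1 where "s1 = ev (FIND X) s"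
  have fr: "s1 x = s x" if "x \<notin> assigned (FIND X)" for x unfolding s1_def using that by (rule ev_frame)
  have s1XY: "s1 X = s X" "s1 Y = s Y" using X by (auto simp: fr)
  note find = ev_FIND[OF s X(1), folded s1_def]
  show ?thesis
  proof (cases "violator (s ''h'' 0) (s ''k'' 0) (s ''B'' 0) (s X)")
    case None
    then have "s1 ''f'' 0 = 0" using find(1) by simp
    then have "ev (REPAIR X e) s = s1" unfolding REPAIR_def s1_def by (simp only: ev.simps exp_val.simps) simp
    then show ?thesis using None s1XY by (simp add: repair_def)
  next
    case (Some Z)
    then have f: "s1 ''f'' 0 \<noteq> 0" and z: "marked s1 ''z'' = Z" using find by simp_all
    define s2 where "s2 = set_var ''v'' 1 (set_var ''p'' c s1)"
    have ev: "ev (REPAIR X e) s = ev (For ''l'' ''m'' (TRY X)) s2"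
      unfolding REPAIR_def s2_def using f e unfolding s1_def[symmetric]
      by (simp only: ev.simps(2-4) exp_val.simps s1_def[symmetric]) simp
    have s2: "s2 X = s X" "s2 Y = s Y" "marked s2 ''z'' = Z" "s2 ''v'' 0 = 1" "s2 ''p'' 0 = c"
      using X s1XY z by (auto simp: s2_def marked_def)
    have gm1: "graph_mem s1" unfolding s1_def by (rule graph_mem_ev[OF s]) simp
    have gm2: "graph_mem s2" by (rule graph_mem_cong[OF gm1]) (auto simp: s2_def)
    define L where "L l = filter (candidate (s X) (s Y) Z) [0..<l]" for l
    have L_Suc: "L (Suc l) = L l @ (if candidate (s X) (s Y) Z l then [l] else [])" for l by (simp add: L_def)
    \<comment> \<open>\<open>L l\<close> lists the candidates below \<open>l\<close>. Rejected
      copies are undone, so every test during the search refers to the original \<open>s X\<close>;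
      meanwhile \<open>p\<close> is the guess minus the number of candidates passed.\<close>
    define I where "I l t \<longleftrightarrow> (if t ''v'' 0 = 0 then c < length (L l) \<and> t X = (s X)(L l ! c := Suc (s X (L l ! c)))
        else length (L l) \<le> c \<and> t X = s X \<and> t ''p'' 0 = c - length (L l))" for l and t :: memory
    have sm: "s2 ''m'' 0 = m" using gm2 by (simp add: graph_mem_def)
    obtain t where t: "I (s2 ''m'' 0) t" "ev (For ''l'' ''m'' (TRY X)) s2 = set_var ''l'' (s2 ''m'' 0) t"
    proof (rule For_rule[where I = I and s = s2 and i = "''l''" and b = "''m''" and c = "TRY X"])
      show "I 0 s2" unfolding I_def using s2 by (simp add: L_def)
    next
      fix l t
      assume lm: "l < s2 ''m'' 0" and I: "I l t"
        and fr: "\<And>x. x \<noteq> ''l'' \<Longrightarrow> x \<notin> assigned (TRY X) \<Longrightarrow> t x = s2 x"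
      let ?t = "set_var ''l'' l t"
      have gm: "graph_mem ?t" by (rule graph_mem_cong[OF gm2]) (use X in \<open>auto simp: fr\<close>)
      have tY: "?t Y = s Y" and tz: "marked ?t ''z'' = Z" using X s2 by (auto simp: fr marked_def)
      have tv: "?t ''v'' 0 = t ''v'' 0" "?t ''p'' 0 = t ''p'' 0" "?t X = t X" "?t ''l'' 0 = l" using X by auto
      have lm': "l < m" using lm sm by simp
      define u where "u = ev (TRY X) ?t"
      note attempt = ev_TRY[OF gm XY tv(4) lm', unfolded tv(1-3) tY tz, folded u_def]
      have "I (Suc l) u"
      proof (cases "t ''v'' 0 = 0")
        case True
        then have "u X = t X" "u ''v'' 0 = 0" using attempt(1) by simp_all
        then show ?thesis using I True unfolding I_def L_Suc by (simp add: nth_append)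
      next
        case False
        then have tX: "t X = s X" and len: "length (L l) \<le> c" "t ''p'' 0 = c - length (L l)"
          using I by (simp_all add: I_def)
        show ?thesis
        proof (cases "candidate (s X) (s Y) Z l")
          case cand: True
          show ?thesis
          proof (cases "t ''p'' 0 = 0")
            case True
            then have c: "c = length (L l)" using len by simp
            have "u X = (s X)(l := Suc (s X l))" "u ''v'' 0 = 0"
              using attempt(3) False cand True unfolding tX by simp_all
            then show ?thesis unfolding I_def L_Suc using cand c by (simp add: nth_append)
          next
            case p: False
            have "u X = s X" "u ''v'' 0 = t ''v'' 0" "u ''p'' 0 = t ''p'' 0 - 1"
              using attempt(2) False cand p unfolding tX by simp_all
            then show ?thesis unfolding I_def L_Suc using cand False p len by simp
          qed
        next
          case cand: False
          have "u X = s X" "u ''v'' 0 = t ''v'' 0" "u ''p'' 0 = t ''p'' 0"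
            using attempt(1) cand unfolding tX by simp_all
          then show ?thesis unfolding I_def L_Suc using cand False len by simp
        qed
      qed
      then show "I (Suc l) (ev (TRY X) ?t)" unfolding u_def .
    qed
    have "ev (REPAIR X e) s X = t X" unfolding ev t(2) using X by auto
    moreover have "L m = candidates (s X) (s Y) Z" by (simp add: L_def candidates_def)
    ultimately show ?thesis using t(1) Some unfolding sm I_def by (auto simp: repair_def augment_def split: if_splits)
  qed
qed

lemma repair_outside: "m \<le> i \<Longrightarrow> repair h k B c x y i = x i"
  by (cases rule: repair_cases[of h k B x c y]) auto

text \<open>\<open>ev_LARGE\<close> equates arrays as functions on all indices, so the cells beyond
  the arcs have to be 0 on both sides.\<close>

lemma run_outside: "m \<le> i \<Longrightarrow> fst (run k B t1 t2 g t) i = 0 \<and> snd (run k B t1 t2 g t) i = 0"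
  by (induction t) (auto simp: repair_both_def Let_def repair_outside split: prod.splits)

lemma ev_LARGE:
  assumes s: "graph_mem s" and out: "\<And>i. m \<le> i \<Longrightarrow> s ''x'' i = 0 \<and> s ''y'' i = 0"
  defines "result \<equiv> run (s ''k'' 0) (s ''b0'' 0) (s ''t1'' 0) (s ''t2'' 0) (s ''g'') (s ''t3'' 0)"
  shows "(ev LARGE s ''x'', ev LARGE s ''y'') = result" "0 < ev LARGE s ''ok'' 0 \<longleftrightarrow> accepting (s ''k'' 0) result"
proof -
  let ?k = "s ''k'' 0" and ?b = "s ''b0'' 0" and ?t1 = "s ''t1'' 0" and ?t2 = "s ''t2'' 0" and ?t3 = "s ''t3'' 0"
  let ?zx = "For ''i'' ''m'' (Assign ''x'' (Var ''i'') (Const 0))"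
  let ?zy = "For ''i'' ''m'' (Assign ''y'' (Var ''i'') (Const 0))"
  let ?B = "Cond (Minus (Var ''t1'') (Var ''s'')) (Set ''B'' (Var ''b0'')) (Set ''B'' (Var ''n''))"
  let ?h = "Cond (Minus (Var ''t2'') (Var ''s'')) (Set ''h'' (Var ''k'')) (Set ''h'' (Var ''n''))"
  let ?ex = "Cell ''g'' (Plus (Var ''s'') (Var ''s''))"
  let ?ey = "Cell ''g'' (Plus (Plus (Var ''s'') (Var ''s'')) (Const 1))"
  let ?body = "?B ;; ?h ;; REPAIR ''x'' ?ex ;; REPAIR ''y'' ?ey"
  define s1 where "s1 = ev ?zx s"
  define s2 where "s2 = ev ?zy s1"
  have f1: "s1 x = s x" if "x \<notin> {''i'', ''x''}" for x unfolding s1_def using that by (intro ev_frame) simp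
  have f2: "s2 x = s1 x" if "x \<notin> {''i'', ''y''}" for x unfolding s2_def using that by (intro ev_frame) simp
  have sm: "s ''m'' 0 = m" "s1 ''m'' 0 = m" using s by (simp_all add: graph_mem_def f1)
  have "s1 ''x'' = (\<lambda>j. if j < s ''m'' 0 then 0 else s ''x'' j)" unfolding s1_def by (rule ev_For_fill) auto
  then have x2: "s2 ''x'' = (\<lambda>_. 0)" using out by (auto simp: f2 sm fun_eq_iff)
  have "s2 ''y'' = (\<lambda>j. if j < s1 ''m'' 0 then 0 else s1 ''y'' j)" unfolding s2_def by (rule ev_For_fill) auto
  then have y2: "s2 ''y'' = (\<lambda>_. 0)" using out by (auto simp: f1 sm fun_eq_iff)
  have gm2: "graph_mem s2" by (rule graph_mem_cong[OF s]) (auto simp: f1 f2)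
  define I where "I j t \<longleftrightarrow> (t ''x'', t ''y'') = run ?k ?b ?t1 ?t2 (s ''g'') j" for j and t :: memory
  have st3: "s2 ''t3'' 0 = ?t3" by (simp add: f1 f2)
  obtain s3 where s3: "I (s2 ''t3'' 0) s3" "ev (For ''s'' ''t3'' ?body) s2 = set_var ''s'' (s2 ''t3'' 0) s3"
  proof (rule For_rule[where I = I and s = s2 and i = "''s''" and b = "''t3''" and c = ?body])
    show "I 0 s2" by (simp add: I_def x2 y2)
  next
    fix j t
    assume I: "I j t" and fr: "\<And>x. x \<noteq> ''s'' \<Longrightarrow> x \<notin> assigned ?body \<Longrightarrow> t x = s2 x"
    let ?t = "set_var ''s'' j t"
    define u1 where "u1 = ev ?B ?t"
    define u2 where "u2 = ev ?h u1"
    define u3 where "u3 = ev (REPAIR ''x'' ?ex) u2"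
    define u4 where "u4 = ev (REPAIR ''y'' ?ey) u3"
    have g1: "u1 x = ?t x" if "x \<noteq> ''B''" for x unfolding u1_def using that by (intro ev_frame) simp
    have g2: "u2 x = u1 x" if "x \<noteq> ''h''" for x unfolding u2_def using that by (intro ev_frame) simp
    have g3: "u3 x = u2 x" if "x \<notin> assigned (REPAIR ''x'' ?ex)" for x unfolding u3_def using that by (rule ev_frame)
    have g4: "u4 x = u3 x" if "x \<notin> assigned (REPAIR ''y'' ?ey)" for x unfolding u4_def using that by (rule ev_frame)
    have gmt: "graph_mem ?t" by (rule graph_mem_cong[OF gm2]) (auto simp: fr)
    have gmu2: "graph_mem u2" by (rule graph_mem_cong[OF gmt]) (auto simp: g1 g2)
    have gmu3: "graph_mem u3" unfolding u3_def by (rule graph_mem_ev[OF gmu2]) simp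
    have nt: "s ''n'' 0 = n" using s by (simp add: graph_mem_def)
    have B: "u2 ''B'' 0 = (if j < ?t1 then ?b else n)" by (simp add: g2) (simp add: u1_def nt fr f1 f2)
    have h: "u2 ''h'' 0 = (if j < ?t2 then ?k else n)" by (simp add: u2_def g1 nt fr f1 f2)
    have c2: "u2 ''k'' 0 = ?k" "u2 ''g'' = s ''g''" "u2 ''s'' 0 = j" "u2 ''x'' = t ''x''" "u2 ''y'' = t ''y''"
      by (simp_all add: g1 g2 fr f1 f2)
    have find: "exp_val ?ex (ev (FIND ''x'') u2) = s ''g'' (j + j)" by (simp add: ev_frame c2)
    have x3: "u3 ''x'' = repair (if j < ?t2 then ?k else n) ?k (if j < ?t1 then ?b else n) (s ''g'' (j + j)) (t ''x'') (t ''y'')"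
      unfolding u3_def ev_REPAIR[OF gmu2, of "''x''" "''y''", simplified, OF find] by (simp only: B h c2)
    have c3: "u3 ''k'' 0 = ?k" "u3 ''g'' = s ''g''" "u3 ''s'' 0 = j" "u3 ''y'' = t ''y''"
      "u3 ''B'' = u2 ''B''" "u3 ''h'' = u2 ''h''"
      by (simp_all add: g3 c2)
    have find: "exp_val ?ey (ev (FIND ''y'') u3) = s ''g'' (j + j + 1)" by (simp add: ev_frame c3)
    have y4: "u4 ''y'' = repair (if j < ?t2 then ?k else n) ?k (if j < ?t1 then ?b else n) (s ''g'' (j + j + 1)) (t ''y'') (u3 ''x'')"
      unfolding u4_def ev_REPAIR[OF gmu3, of "''y''" "''x''", simplified, OF find] by (simp only: B h c3)
    have x4: "u4 ''x'' = u3 ''x''" by (simp add: g4)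
    have eq: "ev ?body ?t = u4" unfolding u4_def u3_def u2_def u1_def by (simp only: ev.simps(3))
    show "I (Suc j) (ev ?body ?t)"
      unfolding eq I_def run.simps I[unfolded I_def, symmetric] repair_both_def Let_def prod.case x4 y4 x3 ..
  qed
  define s4 where "s4 = set_var ''B'' n (set_var ''h'' n (set_var ''s'' (s2 ''t3'' 0) s3))"
  define s5 where "s5 = ev (FIND ''x'') s4"
  define s6 where "s6 = set_var ''o'' (s5 ''f'' 0) s5"
  define s7 where "s7 = ev (FIND ''y'') s6"
  have f3: "set_var ''s'' (s2 ''t3'' 0) s3 x = s2 x" if "x \<notin> assigned (For ''s'' ''t3'' ?body)" for x
    unfolding s3(2)[symmetric] using that by (rule ev_frame)
  have f3': "s3 x = s2 x" if "x \<notin> assigned (For ''s'' ''t3'' ?body)" for x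
  proof -
    have "x \<noteq> ''s''" using that by auto
    then show ?thesis using f3[OF that] by simp
  qed
  have gm3: "graph_mem s3" by (rule graph_mem_cong[OF gm2]) (auto simp: f3')
  then have n3: "s3 ''n'' 0 = n" by (simp add: graph_mem_def)
  have gm4: "graph_mem s4" by (rule graph_mem_cong[OF gm3]) (auto simp: s4_def)
  have gm5: "graph_mem s5" unfolding s5_def by (rule graph_mem_ev[OF gm4]) simp
  have gm6: "graph_mem s6" by (rule graph_mem_cong[OF gm5]) (auto simp: s6_def)
  have xy: "(s3 ''x'', s3 ''y'') = result" using s3(1) unfolding I_def st3 result_def .
  have k3: "s3 ''k'' 0 = ?k" by (simp add: f3' f1 f2)
  have fr5: "s5 x = s4 x" if "x \<notin> assigned (FIND ''x'')" for x unfolding s5_def using that by (rule ev_frame)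
  have fr7: "s7 x = s6 x" if "x \<notin> assigned (FIND ''y'')" for x unfolding s7_def using that by (rule ev_frame)
  have v5: "0 < s5 ''f'' 0 \<longleftrightarrow> violator n ?k n (s3 ''x'') \<noteq> None"
    unfolding s5_def by (subst ev_FIND(1)[OF gm4]) (simp_all add: s4_def k3)
  have v7: "0 < s7 ''f'' 0 \<longleftrightarrow> violator n ?k n (s3 ''y'') \<noteq> None"
    unfolding s7_def by (subst ev_FIND(1)[OF gm6]) (simp_all add: s6_def fr5 s4_def k3)
  have o7: "s7 ''o'' 0 = s5 ''f'' 0" by (simp add: fr7 s6_def)
  have eq: "ev LARGE s = set_var ''ok'' (1 - (s7 ''o'' 0 + s7 ''f'' 0)) s7"
    unfolding LARGE_def s7_def s6_def s5_def s4_def s2_def[symmetric] s1_def[symmetric]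
    using s3(2) n3
    by (simp only: ev.simps(2,3) exp_val.simps s1_def[symmetric] s2_def[symmetric]) simp
  have "s7 ''x'' = s3 ''x''" "s7 ''y'' = s3 ''y''" by (simp_all add: fr7 s6_def fr5 s4_def)
  then show "(ev LARGE s ''x'', ev LARGE s ''y'') = result" unfolding eq using xy by simp
  have "0 < ev LARGE s ''ok'' 0 \<longleftrightarrow> \<not> 0 < s5 ''f'' 0 \<and> \<not> 0 < s7 ''f'' 0" unfolding eq by (simp add: o7)
  also have "\<dots> \<longleftrightarrow> accepting ?k result" unfolding v5 v7 xy[symmetric] by (simp add: accepting_def)
  finally show "0 < ev LARGE s ''ok'' 0 \<longleftrightarrow> accepting ?k result" .
qed

end

section \<open>The case \<open>n + 1 < 2 * k\<close>: checking a guessed pair of flows\<close>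

definition BALANCE :: "exp \<Rightarrow> prg" where
  "BALANCE G = For ''i'' ''m''
     (Cond (Eq (Cell ''H'' (Var ''i'')) (Var ''v'')) (Set ''c'' (Plus (Var ''c'') G)) Nop ;;
      Cond (Eq (Cell ''T'' (Var ''i'')) (Var ''v'')) (Set ''a'' (Plus (Var ''a'') G)) Nop)"

text \<open>Starting \<open>a\<close> at 1 and \<open>c\<close> at 0 turns the balance at a vertex
  into the equality of \<open>c\<close> and \<open>a\<close>.\<close>

definition CONSERVE :: "exp \<Rightarrow> prg" where
  "CONSERVE G = For ''v'' ''n'' (Set ''c'' (Const 0) ;; Set ''a'' (Const 1) ;; BALANCE G ;;
     Cond (Eq (Var ''v'') (Var ''r'')) Nop (Cond (Eq (Var ''c'') (Var ''a'')) Nop (Set ''ok'' (Const 0))))"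

text \<open>Division by \<open>cap\<close>, rounded up, through repeated subtraction. If
  \<open>cap\<close> is positive, values up to \<open>n\<close> need at most \<open>n\<close>
  subtractions; if it is 0, a positive value stays in \<open>a\<close> and makes \<open>CEIL\<close>
  reject.\<close>

definition DIVIDE :: "string \<Rightarrow> prg" where
  "DIVIDE X = For ''t'' ''n'' (Cond (Var ''a'')
     (Set ''a'' (Minus (Var ''a'') (Var ''cap'')) ;; Assign X (Var ''i'') (Plus (Cell X (Var ''i'')) (Const 1))) Nop)"

definition CEIL :: "string \<Rightarrow> exp \<Rightarrow> prg" where
  "CEIL X G = For ''i'' ''m'' (Set ''a'' G ;; Assign X (Var ''i'') (Const 0) ;; DIVIDE X ;;
     Cond (Var ''a'') (Set ''ok'' (Const 0)) Nop)"

definition FITS :: prg where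
  "FITS = For ''i'' ''m'' (Cond (Minus (Plus (Cell ''x'' (Var ''i'')) (Cell ''y'' (Var ''i''))) (Cell ''d'' (Var ''i'')))
     (Set ''ok'' (Const 0)) Nop)"

text \<open>The guess holds two flows, the second one at offset \<open>m\<close>. For given flows
  the least multiplicities that carry them are the best choice, so multiplicities need not be
  guessed.\<close>

definition SMALL :: prg where
  "SMALL = Set ''ok'' (Const 1) ;;
     CONSERVE (Cell ''g'' (Var ''i'')) ;; CONSERVE (Cell ''g'' (Plus (Var ''m'') (Var ''i''))) ;;
     CEIL ''x'' (Cell ''g'' (Var ''i'')) ;; CEIL ''y'' (Cell ''g'' (Plus (Var ''m'') (Var ''i''))) ;; FITS"

lemma assigned_BALANCE [simp]: "assigned (BALANCE G) = {''i'', ''c'', ''a''}"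
  by (auto simp: BALANCE_def)

lemma assigned_CONSERVE [simp]: "assigned (CONSERVE G) = {''v'', ''i'', ''c'', ''a'', ''ok''}"
  by (auto simp: CONSERVE_def)

lemma assigned_DIVIDE [simp]: "assigned (DIVIDE X) = {''t'', ''a'', X}"
  by (auto simp: DIVIDE_def)

lemma assigned_CEIL [simp]: "assigned (CEIL X G) = {''i'', ''t'', ''a'', X, ''ok''}"
  by (auto simp: CEIL_def)

lemma assigned_FITS [simp]: "assigned FITS = {''i'', ''ok''}"
  by (auto simp: FITS_def)

lemma assigned_SMALL [simp]: "assigned SMALL = {''ok'', ''v'', ''i'', ''c'', ''a'', ''t'', ''x'', ''y''}"
  by (auto simp: SMALL_def)

context arc_array
begin

lemma ev_BALANCE:
  assumes s: "graph_mem s"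
    and G: "\<And>i t. i < m \<Longrightarrow> (\<And>x. x \<notin> {''i'', ''c'', ''a''} \<Longrightarrow> t x = s x) \<Longrightarrow> t ''i'' 0 = i \<Longrightarrow> exp_val G t = z i"
  shows "ev (BALANCE G) s ''c'' 0 = s ''c'' 0 + inflow z (s ''v'' 0)"
    "ev (BALANCE G) s ''a'' 0 = s ''a'' 0 + outflow z (s ''v'' 0)"
proof -
  let ?v = "s ''v'' 0"
  let ?in = "Cond (Eq (Cell ''H'' (Var ''i'')) (Var ''v'')) (Set ''c'' (Plus (Var ''c'') G)) Nop"
  let ?out = "Cond (Eq (Cell ''T'' (Var ''i'')) (Var ''v'')) (Set ''a'' (Plus (Var ''a'') G)) Nop"
  have sm: "s ''m'' 0 = m" using s by (simp add: graph_mem_def)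
  define I where "I l t \<longleftrightarrow> t ''c'' 0 = s ''c'' 0 + (\<Sum>i<l. if dst i = ?v then z i else 0) \<and>
    t ''a'' 0 = s ''a'' 0 + (\<Sum>i<l. if src i = ?v then z i else 0)" for l and t :: memory
  obtain t where t: "I (s ''m'' 0) t" "ev (BALANCE G) s = set_var ''i'' (s ''m'' 0) t"
    unfolding BALANCE_def
  proof (rule For_rule[where I = I and s = s and i = "''i''" and b = "''m''" and c = "?in ;; ?out"])
    show "I 0 s" by (simp add: I_def)
  next
    fix l t
    assume l: "l < s ''m'' 0" and I: "I l t" and fr: "\<And>x. x \<noteq> ''i'' \<Longrightarrow> x \<notin> assigned (?in ;; ?out) \<Longrightarrow> t x = s x"
    let ?t = "set_var ''i'' l t"
    have lm: "l < m" using l sm by simp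
    have TH: "s ''T'' l = src l" "s ''H'' l = dst l" using s lm by (simp_all add: graph_mem_def)
    have G1: "exp_val G ?t = z l" by (rule G[OF lm]) (auto simp: fr)
    have in1: "ev ?in ?t = (if dst l = ?v then set_var ''c'' (t ''c'' 0 + z l) ?t else ?t)"
      using G1 by (simp add: fr TH)
    define u where "u = ev ?in ?t"
    have u: "u x = ?t x" if "x \<noteq> ''c''" for x unfolding u_def using that by (intro ev_frame) simp
    have G2: "exp_val G u = z l" by (rule G[OF lm]) (auto simp: fr u)
    have uc: "u ''c'' 0 = t ''c'' 0 + (if dst l = ?v then z l else 0)" unfolding u_def in1 by simp
    have "ev ?out u = (if src l = ?v then set_var ''a'' (t ''a'' 0 + z l) u else u)"
      using G2 by (simp add: fr TH u)
    then show "I (Suc l) (ev (?in ;; ?out) ?t)"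
      using I uc unfolding ev.simps(3) u_def[symmetric] I_def by (simp add: u)
  qed
  show "ev (BALANCE G) s ''c'' 0 = s ''c'' 0 + inflow z ?v" "ev (BALANCE G) s ''a'' 0 = s ''a'' 0 + outflow z ?v"
    using t(1) unfolding t(2) I_def sm inflow_def outflow_def by simp_all
qed

lemma ev_CONSERVE:
  assumes s: "graph_mem s"
    and G: "\<And>i t. i < m \<Longrightarrow> (\<And>x. x \<notin> {''v'', ''i'', ''c'', ''a'', ''ok''} \<Longrightarrow> t x = s x) \<Longrightarrow> t ''i'' 0 = i \<Longrightarrow>
      exp_val G t = z i"
  shows "0 < ev (CONSERVE G) s ''ok'' 0 \<longleftrightarrow> 0 < s ''ok'' 0 \<and> unit_flow z"
proof -
  let ?pre = "Set ''c'' (Const 0) ;; Set ''a'' (Const 1)"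
  let ?fin = "Cond (Eq (Var ''v'') (Var ''r'')) Nop (Cond (Eq (Var ''c'') (Var ''a'')) Nop (Set ''ok'' (Const 0)))"
  let ?body = "Set ''c'' (Const 0) ;; Set ''a'' (Const 1) ;; BALANCE G ;; ?fin"
  have sn: "s ''n'' 0 = n" "s ''r'' 0 = r" using s by (simp_all add: graph_mem_def)
  define I where "I l t \<longleftrightarrow> (0 < t ''ok'' 0 \<longleftrightarrow> 0 < s ''ok'' 0 \<and> (\<forall>v<l. v = r \<or> inflow z v = outflow z v + 1))"
    for l and t :: memory
  obtain t where t: "I (s ''n'' 0) t" "ev (CONSERVE G) s = set_var ''v'' (s ''n'' 0) t"
    unfolding CONSERVE_def
  proof (rule For_rule[where I = I and s = s and i = "''v''" and b = "''n''" and c = ?body])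
    show "I 0 s" by (simp add: I_def)
  next
    fix l t
    assume I: "I l t" and fr: "\<And>x. x \<noteq> ''v'' \<Longrightarrow> x \<notin> assigned ?body \<Longrightarrow> t x = s x"
    let ?t = "set_var ''a'' 1 (set_var ''c'' 0 (set_var ''v'' l t))"
    define u where "u = ev (BALANCE G) ?t"
    have gm: "graph_mem ?t" by (rule graph_mem_cong[OF s]) (auto simp: fr)
    have G': "exp_val G t' = z i" if "i < m" and t': "\<And>x. x \<notin> {''i'', ''c'', ''a''} \<Longrightarrow> t' x = ?t x"
      and "t' ''i'' 0 = i" for i t'
    proof (rule G)
      fix x assume "x \<notin> {''v'', ''i'', ''c'', ''a'', ''ok''}"
      then show "t' x = s x" using t'[of x] by (simp add: fr)
    qed (use that in simp_all)
    have "u ''c'' 0 = ?t ''c'' 0 + inflow z (?t ''v'' 0)"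
      unfolding u_def by (rule ev_BALANCE(1)[OF gm]) (rule G', assumption, blast, assumption)
    moreover have "u ''a'' 0 = ?t ''a'' 0 + outflow z (?t ''v'' 0)"
      unfolding u_def by (rule ev_BALANCE(2)[OF gm]) (rule G', assumption, blast, assumption)
    ultimately have u1: "u ''c'' 0 = inflow z l" "u ''a'' 0 = 1 + outflow z l" by simp_all
    have uf: "u x = ?t x" if "x \<notin> {''i'', ''c'', ''a''}" for x unfolding u_def using that by (intro ev_frame) simp
    have eq: "ev ?body (set_var ''v'' l t) = ev ?fin u" unfolding u_def by (simp only: ev.simps(2,3) exp_val.simps)
    have "ev ?fin u = (if l = r \<or> inflow z l = 1 + outflow z l then u else set_var ''ok'' 0 u)"
      using u1 sn by (simp add: uf fr)
    then show "I (Suc l) (ev ?body (set_var ''v'' l t))"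
      using I unfolding eq I_def by (auto simp: uf less_Suc_eq)
  qed
  have "0 < ev (CONSERVE G) s ''ok'' 0 \<longleftrightarrow> 0 < s ''ok'' 0 \<and> (\<forall>v<n. v = r \<or> inflow z v = outflow z v + 1)"
    using t(1) unfolding t(2) I_def sn by simp
  also have "\<dots> \<longleftrightarrow> 0 < s ''ok'' 0 \<and> unit_flow z" unfolding unit_flow_def by auto
  finally show ?thesis .
qed

text \<open>A copy is added only while something is left of the value, so the count never exceeds a
  sufficient number of copies. This gives the minimality in the third claim.\<close>

lemma ev_DIVIDE:
  assumes s: "graph_mem s" "s ''i'' 0 = i" and X: "X \<in> {''x'', ''y''}" and Xi: "s X i = 0"
  defines "t \<equiv> ev (DIVIDE X) s"
  shows "\<forall>j. j \<noteq> i \<longrightarrow> t X j = s X j" "t ''a'' 0 = s ''a'' 0 - s ''cap'' 0 * t X i"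
    "\<forall>c. s ''a'' 0 \<le> s ''cap'' 0 * c \<longrightarrow> t X i \<le> c" "t X i = n \<or> t ''a'' 0 = 0"
proof -
  let ?z = "s ''a'' 0" and ?cap = "s ''cap'' 0"
  let ?c = "Cond (Var ''a'')
     (Set ''a'' (Minus (Var ''a'') (Var ''cap'')) ;; Assign X (Var ''i'') (Plus (Cell X (Var ''i'')) (Const 1))) Nop"
  have sn: "s ''n'' 0 = n" using s by (simp add: graph_mem_def)
  define I where "I l t \<longleftrightarrow> (\<forall>j. j \<noteq> i \<longrightarrow> t X j = s X j) \<and> t ''a'' 0 = ?z - ?cap * t X i \<and>
    (\<forall>c. ?z \<le> ?cap * c \<longrightarrow> t X i \<le> c) \<and> (t X i = l \<or> t ''a'' 0 = 0)" for l and t :: memory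
  obtain u where u: "I (s ''n'' 0) u" "t = set_var ''t'' (s ''n'' 0) u"
    unfolding t_def DIVIDE_def
  proof (rule For_rule[where I = I and s = s and i = "''t''" and b = "''n''" and c = ?c])
    show "I 0 s" using Xi by (simp add: I_def)
  next
    fix l t
    assume I: "I l t" and fr: "\<And>x. x \<noteq> ''t'' \<Longrightarrow> x \<notin> assigned ?c \<Longrightarrow> t x = s x"
    let ?t = "set_var ''t'' l t"
    have cap: "t ''cap'' = s ''cap''" "t ''i'' 0 = i" using X s(2) by (auto simp: fr)
    define u where "u = ev ?c ?t"
    have uX: "u X = (if t ''a'' 0 \<noteq> 0 then (t X)(i := Suc (t X i)) else t X)"
      and ua: "u ''a'' 0 = t ''a'' 0 - (if t ''a'' 0 \<noteq> 0 then ?cap else 0)"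
      unfolding u_def using X cap by auto
    have "I (Suc l) u"
    proof (cases "t ''a'' 0 = 0")
      case True
      then show ?thesis using I uX ua unfolding I_def by simp
    next
      case False
      then have "t X i = l" using I by (simp add: I_def)
      moreover have "Suc (t X i) \<le> c" if c: "?z \<le> ?cap * c" for c
      proof (rule ccontr)
        assume "\<not> Suc (t X i) \<le> c"
        then have "?cap * c \<le> ?cap * t X i" by (intro mult_le_mono2) simp
        with c have "?z \<le> ?cap * t X i" by (rule le_trans)
        then have "?z - ?cap * t X i = 0" by simp
        then show False using I False unfolding I_def by argo
      qed
      ultimately show ?thesis using I uX ua False unfolding I_def by simp
    qed
    then show "I (Suc l) (ev ?c ?t)" unfolding u_def .
  qed
  have tu: "t X = u X" "t ''a'' = u ''a''" using X unfolding u(2) by auto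
  note fin = u(1)[unfolded I_def sn]
  show "\<forall>j. j \<noteq> i \<longrightarrow> t X j = s X j" "t ''a'' 0 = ?z - ?cap * t X i"
    "\<forall>c. ?z \<le> ?cap * c \<longrightarrow> t X i \<le> c" "t X i = n \<or> t ''a'' 0 = 0"
    unfolding tu
    by (rule fin[THEN conjunct1] fin[THEN conjunct2, THEN conjunct1]
      fin[THEN conjunct2, THEN conjunct2, THEN conjunct1] fin[THEN conjunct2, THEN conjunct2, THEN conjunct2])+
qed

lemma ev_CEIL:
  assumes s: "graph_mem s" and X: "X \<in> {''x'', ''y''}"
    and G: "\<And>i t. i < m \<Longrightarrow> (\<And>x. x \<notin> {''i'', ''t'', ''a'', X, ''ok''} \<Longrightarrow> t x = s x) \<Longrightarrow> t ''i'' 0 = i \<Longrightarrow>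
      exp_val G t = z i"
  defines "t \<equiv> ev (CEIL X G) s"
  shows "\<forall>i\<ge>m. t X i = s X i" "\<forall>i<m. \<forall>c. z i \<le> s ''cap'' 0 * c \<longrightarrow> t X i \<le> c"
    "0 < t ''ok'' 0 \<longleftrightarrow> 0 < s ''ok'' 0 \<and> (\<forall>i<m. z i \<le> s ''cap'' 0 * t X i)"
    "\<forall>i<m. z i \<le> s ''cap'' 0 * t X i \<or> t X i = n"
proof -
  let ?cap = "s ''cap'' 0"
  let ?fin = "Cond (Var ''a'') (Set ''ok'' (Const 0)) Nop"
  let ?body = "Set ''a'' G ;; Assign X (Var ''i'') (Const 0) ;; DIVIDE X ;; ?fin"
  have sm: "s ''m'' 0 = m" using s by (simp add: graph_mem_def)
  define I where "I l t \<longleftrightarrow> (\<forall>i\<ge>m. t X i = s X i) \<and> (\<forall>i<l. \<forall>c. z i \<le> ?cap * c \<longrightarrow> t X i \<le> c) \<and>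
    (0 < t ''ok'' 0 \<longleftrightarrow> 0 < s ''ok'' 0 \<and> (\<forall>i<l. z i \<le> ?cap * t X i)) \<and>
    (\<forall>i<l. z i \<le> ?cap * t X i \<or> t X i = n)" for l and t :: memory
  obtain u where u: "I (s ''m'' 0) u" "t = set_var ''i'' (s ''m'' 0) u"
    unfolding t_def CEIL_def
  proof (rule For_rule[where I = I and s = s and i = "''i''" and b = "''m''" and c = ?body])
    show "I 0 s" by (simp add: I_def)
  next
    fix l t
    assume l: "l < s ''m'' 0" and I: "I l t" and fr: "\<And>x. x \<noteq> ''i'' \<Longrightarrow> x \<notin> assigned ?body \<Longrightarrow> t x = s x"
    have lm: "l < m" using l sm by simp
    let ?t = "set_var ''i'' l t"
    have X': "X \<noteq> ''i''" "X \<noteq> ''a''" "X \<noteq> ''cap''" "X \<noteq> ''ok''" "''cap'' \<noteq> X" "''i'' \<noteq> X" "''a'' \<noteq> X" "''ok'' \<noteq> X"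
      using X by auto
    have Gz: "exp_val G ?t = z l"
      by (rule G[OF lm]) (use X in \<open>auto simp: fr\<close>)
    define t1 where "t1 = (set_var ''a'' (z l) ?t)(X := (t X)(l := 0))"
    have t1: "ev (Assign X (Var ''i'') (Const 0)) (ev (Set ''a'' G) ?t) = t1"
      unfolding t1_def using X' by (simp add: Gz)
    have gm: "graph_mem t1" by (rule graph_mem_cong[OF s]) (use X in \<open>auto simp: t1_def fr\<close>)
    have t1v: "t1 ''i'' 0 = l" "t1 X = (t X)(l := 0)" "t1 ''a'' 0 = z l" "t1 ''cap'' 0 = ?cap" "t1 ''ok'' = t ''ok''"
      using X by (elim insertE emptyE; simp add: t1_def fr)+
    define t2 where "t2 = ev (DIVIDE X) t1"
    have "t1 X l = 0" by (simp add: t1v)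
    note div = ev_DIVIDE[OF gm t1v(1) X this, folded t2_def, unfolded t1v(3,4)]
    have ok2: "t2 ''ok'' = t ''ok''"
      unfolding t2_def t1v(5)[symmetric] by (rule ev_frame) (use X' in simp)
    have t2X: "t2 X j = t X j" if "j \<noteq> l" for j using div(1) that by (simp add: t1v)
    have a2: "t2 ''a'' 0 = 0 \<longleftrightarrow> z l \<le> ?cap * t2 X l" using div(2) by simp
    define u where "u = ev ?fin t2"
    have uX: "u X = t2 X" unfolding u_def using X' by simp
    have uok: "0 < u ''ok'' 0 \<longleftrightarrow> 0 < t ''ok'' 0 \<and> z l \<le> ?cap * t2 X l"
      unfolding u_def a2[symmetric] using ok2 by simp
    have eq: "ev ?body ?t = u" unfolding u_def t2_def t1[symmetric] by (simp only: ev.simps(3))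
    have old: "i < l \<Longrightarrow> t2 X i = t X i" for i using t2X[of i] by simp
    show "I (Suc l) (ev ?body ?t)"
      unfolding eq I_def uX uok
    proof (intro conjI)
      show "\<forall>i\<ge>m. t2 X i = s X i" using I lm t2X unfolding I_def by fastforce
      show "\<forall>i<Suc l. \<forall>c. z i \<le> ?cap * c \<longrightarrow> t2 X i \<le> c"
        using I div(3) old unfolding I_def less_Suc_eq by fastforce
      show "(0 < t ''ok'' 0 \<and> z l \<le> ?cap * t2 X l) \<longleftrightarrow> 0 < s ''ok'' 0 \<and> (\<forall>i<Suc l. z i \<le> ?cap * t2 X i)"
        using I old unfolding I_def less_Suc_eq by fastforce
      show "\<forall>i<Suc l. z i \<le> ?cap * t2 X i \<or> t2 X i = n"
        using I div(4) a2 old unfolding I_def less_Suc_eq by fastforce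
    qed
  qed
  have "t X = u X" "t ''ok'' = u ''ok''" using X unfolding u(2) by auto
  then show "\<forall>i\<ge>m. t X i = s X i" "\<forall>i<m. \<forall>c. z i \<le> ?cap * c \<longrightarrow> t X i \<le> c"
    "0 < t ''ok'' 0 \<longleftrightarrow> 0 < s ''ok'' 0 \<and> (\<forall>i<m. z i \<le> ?cap * t X i)"
    "\<forall>i<m. z i \<le> ?cap * t X i \<or> t X i = n"
    using u(1) unfolding I_def sm by simp_all
qed

lemma ev_FITS:
  assumes s: "graph_mem s"
  shows "0 < ev FITS s ''ok'' 0 \<longleftrightarrow> 0 < s ''ok'' 0 \<and> (\<forall>i<m. s ''x'' i + s ''y'' i \<le> d i)"
proof -
  let ?c = "Cond (Minus (Plus (Cell ''x'' (Var ''i'')) (Cell ''y'' (Var ''i''))) (Cell ''d'' (Var ''i'')))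
     (Set ''ok'' (Const 0)) Nop"
  have sm: "s ''m'' 0 = m" using s by (simp add: graph_mem_def)
  define I where "I l t \<longleftrightarrow> (0 < t ''ok'' 0 \<longleftrightarrow> 0 < s ''ok'' 0 \<and> (\<forall>i<l. s ''x'' i + s ''y'' i \<le> d i))"
    for l and t :: memory
  obtain t where t: "I (s ''m'' 0) t" "ev FITS s = set_var ''i'' (s ''m'' 0) t"
    unfolding FITS_def
  proof (rule For_rule[where I = I and s = s and i = "''i''" and b = "''m''" and c = ?c])
    show "I 0 s" by (simp add: I_def)
  next
    fix l t
    assume l: "l < s ''m'' 0" and I: "I l t" and fr: "\<And>x. x \<noteq> ''i'' \<Longrightarrow> x \<notin> assigned ?c \<Longrightarrow> t x = s x"
    have "s ''d'' l = d l" using l sm s by (simp add: graph_mem_def)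
    then show "I (Suc l) (ev ?c (set_var ''i'' l t))"
      using I unfolding I_def by (auto simp: fr less_Suc_eq)
  qed
  then show ?thesis unfolding t(2) using t(1) unfolding I_def sm by simp
qed

lemma ev_SMALL:
  assumes s: "graph_mem s"
  defines "t \<equiv> ev SMALL s" and "z \<equiv> s ''g''" and "z' \<equiv> \<lambda>i. s ''g'' (m + i)"
  shows "\<forall>i\<ge>m. t ''x'' i = s ''x'' i \<and> t ''y'' i = s ''y'' i"
    "0 < t ''ok'' 0 \<Longrightarrow> unit_flow z \<and> unit_flow z' \<and> (\<forall>i<m. z i \<le> s ''cap'' 0 * t ''x'' i) \<and>
      (\<forall>i<m. z' i \<le> s ''cap'' 0 * t ''y'' i) \<and> (\<forall>i<m. t ''x'' i + t ''y'' i \<le> d i)"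
    "unit_flow z \<Longrightarrow> unit_flow z' \<Longrightarrow> \<forall>i<m. z i \<le> n \<Longrightarrow> \<forall>i<m. z' i \<le> n \<Longrightarrow>
      \<forall>i<m. z i \<le> s ''cap'' 0 * x i \<Longrightarrow> \<forall>i<m. z' i \<le> s ''cap'' 0 * y i \<Longrightarrow>
      \<forall>i<m. x i + y i \<le> d i \<Longrightarrow> 0 < t ''ok'' 0"
proof -
  let ?G = "Cell ''g'' (Var ''i'')" and ?G' = "Cell ''g'' (Plus (Var ''m'') (Var ''i''))"
  let ?cap = "s ''cap'' 0"
  define s1 where "s1 = set_var ''ok'' 1 s"
  define s2 where "s2 = ev (CONSERVE ?G) s1"
  define s3 where "s3 = ev (CONSERVE ?G') s2"
  define s4 where "s4 = ev (CEIL ''x'' ?G) s3"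
  define s5 where "s5 = ev (CEIL ''y'' ?G') s4"
  have sm: "s ''m'' 0 = m" using s by (simp add: graph_mem_def)
  have eq: "t = ev FITS s5"
    unfolding t_def SMALL_def s5_def s4_def s3_def s2_def s1_def by (simp only: ev.simps(2,3) exp_val.simps)
  have f2: "s2 x = s1 x" if "x \<notin> {''v'', ''i'', ''c'', ''a'', ''ok''}" for x unfolding s2_def using that by (intro ev_frame) simp
  have f3: "s3 x = s2 x" if "x \<notin> {''v'', ''i'', ''c'', ''a'', ''ok''}" for x unfolding s3_def using that by (intro ev_frame) simp
  have f4: "s4 x = s3 x" if "x \<notin> {''i'', ''t'', ''a'', ''x'', ''ok''}" for x unfolding s4_def using that by (intro ev_frame) simp
  have f5: "s5 x = s4 x" if "x \<notin> {''i'', ''t'', ''a'', ''y'', ''ok''}" for x unfolding s5_def using that by (intro ev_frame) simp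
  have ft: "t x = s5 x" if "x \<notin> {''i'', ''ok''}" for x unfolding eq using that by (intro ev_frame) simp
  have g1: "graph_mem s1" by (rule graph_mem_cong[OF s]) (auto simp: s1_def)
  have g2: "graph_mem s2" unfolding s2_def by (rule graph_mem_ev[OF g1]) simp
  have g3: "graph_mem s3" unfolding s3_def by (rule graph_mem_ev[OF g2]) simp
  have g4: "graph_mem s4" unfolding s4_def by (rule graph_mem_ev[OF g3]) simp
  have g5: "graph_mem s5" unfolding s5_def by (rule graph_mem_ev[OF g4]) simp
  have ok2: "0 < s2 ''ok'' 0 \<longleftrightarrow> unit_flow z"
  proof -
    have "0 < s2 ''ok'' 0 \<longleftrightarrow> 0 < s1 ''ok'' 0 \<and> unit_flow z"
      unfolding s2_def by (rule ev_CONSERVE[OF g1]) (auto simp: s1_def z_def)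
    then show ?thesis by (simp add: s1_def)
  qed
  have ok3: "0 < s3 ''ok'' 0 \<longleftrightarrow> unit_flow z \<and> unit_flow z'"
    unfolding s3_def ok2[symmetric] by (rule ev_CONSERVE[OF g2]) (auto simp: f2 s1_def z'_def sm)
  have cap: "s3 ''cap'' 0 = ?cap" "s4 ''cap'' 0 = ?cap" by (simp_all add: f4 f3 f2 s1_def)
  have c4: "\<forall>i\<ge>m. s4 ''x'' i = s3 ''x'' i" "\<forall>i<m. \<forall>c. z i \<le> s3 ''cap'' 0 * c \<longrightarrow> s4 ''x'' i \<le> c"
    "0 < s4 ''ok'' 0 \<longleftrightarrow> 0 < s3 ''ok'' 0 \<and> (\<forall>i<m. z i \<le> s3 ''cap'' 0 * s4 ''x'' i)"
    "\<forall>i<m. z i \<le> s3 ''cap'' 0 * s4 ''x'' i \<or> s4 ''x'' i = n"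
    unfolding s4_def by (rule ev_CEIL[OF g3]; auto simp: f3 f2 s1_def z_def)+
  have c5: "\<forall>i\<ge>m. s5 ''y'' i = s4 ''y'' i" "\<forall>i<m. \<forall>c. z' i \<le> s4 ''cap'' 0 * c \<longrightarrow> s5 ''y'' i \<le> c"
    "0 < s5 ''ok'' 0 \<longleftrightarrow> 0 < s4 ''ok'' 0 \<and> (\<forall>i<m. z' i \<le> s4 ''cap'' 0 * s5 ''y'' i)"
    "\<forall>i<m. z' i \<le> s4 ''cap'' 0 * s5 ''y'' i \<or> s5 ''y'' i = n"
    unfolding s5_def by (rule ev_CEIL[OF g4]; auto simp: f4 f3 f2 s1_def z'_def sm)+
  note c4 = c4[unfolded cap] and c5 = c5[unfolded cap]
  have xy: "t ''x'' = s4 ''x''" "t ''y'' = s5 ''y''" by (simp_all add: ft f5)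
  have ok: "0 < t ''ok'' 0 \<longleftrightarrow> unit_flow z \<and> unit_flow z' \<and> (\<forall>i<m. z i \<le> ?cap * t ''x'' i) \<and>
      (\<forall>i<m. z' i \<le> ?cap * t ''y'' i) \<and> (\<forall>i<m. t ''x'' i + t ''y'' i \<le> d i)"
    unfolding xy unfolding eq ev_FITS[OF g5] c5(3) c4(3) ok3 by (simp add: f5 conj_assoc)
  show "\<forall>i\<ge>m. t ''x'' i = s ''x'' i \<and> t ''y'' i = s ''y'' i"
    unfolding xy using c4(1) c5(1) by (simp add: f4 f3 f2 s1_def)
  show "0 < t ''ok'' 0 \<Longrightarrow> unit_flow z \<and> unit_flow z' \<and> (\<forall>i<m. z i \<le> ?cap * t ''x'' i) \<and>
      (\<forall>i<m. z' i \<le> ?cap * t ''y'' i) \<and> (\<forall>i<m. t ''x'' i + t ''y'' i \<le> d i)"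
    using ok by blast
  assume z: "unit_flow z" "unit_flow z'" "\<forall>i<m. z i \<le> n" "\<forall>i<m. z' i \<le> n"
    "\<forall>i<m. z i \<le> ?cap * x i" "\<forall>i<m. z' i \<le> ?cap * y i" "\<forall>i<m. x i + y i \<le> d i"
  \<comment> \<open>If the capacity is positive, stopping at \<open>w = n\<close> copies is harmless
    because the flow value is at most \<open>n\<close>; if it is 0, the flow value is 0 by the
    second assumption.\<close>
  have le: "c \<le> ?cap * w" if "c \<le> n" "c \<le> ?cap * b" "c \<le> ?cap * w \<or> w = n" for c b w
  proof (cases "?cap = 0")
    case False
    then have "w \<le> ?cap * w" by (cases ?cap) auto
    then show ?thesis using that(1,3) by linarith
  qed (use that in simp)
  show "0 < t ''ok'' 0"
    unfolding ok
  proof (intro conjI allI impI)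
    fix i assume i: "i < m"
    show "z i \<le> ?cap * t ''x'' i" unfolding xy using le[of "z i" "x i" "s4 ''x'' i"] z i c4(4) by blast
    show "z' i \<le> ?cap * t ''y'' i" unfolding xy using le[of "z' i" "y i" "s5 ''y'' i"] z i c5(4) by blast
    have "t ''x'' i \<le> x i" "t ''y'' i \<le> y i" unfolding xy using c4(2) c5(2) z i by blast+
    then show "t ''x'' i + t ''y'' i \<le> d i" using z(7) i by (meson add_mono le_trans)
  qed (use z in auto)
qed

end

section \<open>The odometer and the output\<close>

definition INCR :: prg where
  "INCR = Set ''a'' (Const 1) ;; For ''i'' ''L'' (Cond (Var ''a'')
     (Assign ''g'' (Var ''i'') (Plus (Cell ''g'' (Var ''i'')) (Const 1)) ;;
      Cond (Minus (Var ''bb'') (Cell ''g'' (Var ''i''))) (Set ''a'' (Const 0)) (Assign ''g'' (Var ''i'') (Const 0))) Nop)"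

definition PUT :: "exp \<Rightarrow> prg" where
  "PUT e = Assign ''out'' (Var ''p'') e ;; Set ''p'' (Plus (Var ''p'') (Const 1))"

text \<open>A \<open>For\<close> loop is bounded by a scalar, so the loop over the copies runs up to
  \<open>M\<close> and a guard skips the excess. \<open>ready\<close> fixes \<open>M\<close> as
  \<open>n + n\<close>, which no multiplicity below \<open>trunc\<close> exceeds.\<close>

definition EMIT_ARC :: "string \<Rightarrow> exp \<Rightarrow> prg" where
  "EMIT_ARC X lo = For ''j'' ''M'' (Cond (Minus (Cell X (Var ''i'')) (Var ''j''))
     (PUT (Cell ''T'' (Var ''i'')) ;; PUT (Cell ''H'' (Var ''i'')) ;; PUT (Plus lo (Var ''j''))) Nop)"

definition EMIT :: "string \<Rightarrow> exp \<Rightarrow> prg" where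
  "EMIT X lo = Set ''c'' (Const 0) ;; For ''i'' ''m'' (Set ''c'' (Plus (Var ''c'') (Cell X (Var ''i'')))) ;;
     PUT (Var ''c'') ;; For ''i'' ''m'' (EMIT_ARC X lo)"

definition OUT :: prg where
  "OUT = Cond (Var ''ok'')
     (Set ''p'' (Const 1) ;; PUT (Const 1) ;; EMIT ''x'' (Const 0) ;; EMIT ''y'' (Cell ''x'' (Var ''i'')) ;;
      Set ''out'' (Minus (Var ''p'') (Const 1)))
     (Assign ''out'' (Const 1) (Const 0) ;; Set ''out'' (Const 1))"

lemma assigned_INCR [simp]: "assigned INCR = {''a'', ''i'', ''g''}"
  by (auto simp: INCR_def)

lemma assigned_PUT [simp]: "assigned (PUT e) = {''out'', ''p''}"
  by (auto simp: PUT_def)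

lemma assigned_EMIT_ARC [simp]: "assigned (EMIT_ARC X lo) = {''j'', ''out'', ''p''}"
  by (auto simp: EMIT_ARC_def)

lemma assigned_EMIT [simp]: "assigned (EMIT X lo) = {''c'', ''i'', ''j'', ''out'', ''p''}"
  by (auto simp: EMIT_def)

definition digits :: "nat \<Rightarrow> nat \<Rightarrow> nat \<Rightarrow> nat \<Rightarrow> nat" where
  "digits b L j i = (if i < L then j div b ^ i mod b else 0)"

text \<open>By Horner's scheme, least significant digit first. Counting up to \<open>b ^ L\<close>
  thus meets every guess sequence.\<close>

lemma digits_surj:
  assumes "\<And>i. g i < b" "\<And>i. L \<le> i \<Longrightarrow> g i = 0"
  shows "\<exists>j<b ^ L. g = digits b L j"
  using assms
proof (induction L arbitrary: g)
  case 0
  then show ?case by (auto simp: digits_def fun_eq_iff)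
next
  case (Suc L)
  have "\<exists>j<b ^ L. (\<lambda>i. g (Suc i)) = digits b L j"
    using Suc.prems by (intro Suc.IH) auto
  then obtain j where j: "j < b ^ L" "\<And>i. g (Suc i) = digits b L j i" by (metis (full_types))
  have b: "0 < b" "g 0 < b" using Suc.prems(1)[of 0] by auto
  define l where "l = g 0 + b * j"
  have "l < b * Suc j" using b by (simp add: l_def)
  also have "\<dots> \<le> b * b ^ L" using j(1) by (intro mult_le_mono2) simp
  finally have "l < b ^ Suc L" by simp
  moreover have "g i = digits b (Suc L) l i" for i
  proof (cases i)
    case 0
    then show ?thesis using b by (simp add: digits_def l_def)
  next
    case (Suc i')
    have "l div b ^ Suc i' = j div b ^ i'" using b by (simp add: l_def div_mult2_eq)
    then show ?thesis using Suc j(2)[of i'] by (simp add: digits_def)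
  qed
  ultimately show ?case by blast
qed

lemma ev_INCR:
  assumes s: "s ''L'' 0 = L" "s ''bb'' 0 = b" "0 < b" and g: "s ''g'' = digits b L j" and j: "j < b ^ L"
  shows "0 < ev INCR s ''a'' 0 \<longleftrightarrow> Suc j = b ^ L" "ev INCR s ''g'' = digits b L (Suc j)"
proof -
  let ?c = "Cond (Var ''a'')
     (Assign ''g'' (Var ''i'') (Plus (Cell ''g'' (Var ''i'')) (Const 1)) ;;
      Cond (Minus (Var ''bb'') (Cell ''g'' (Var ''i''))) (Set ''a'' (Const 0)) (Assign ''g'' (Var ''i'') (Const 0))) Nop"
  let ?s = "set_var ''a'' 1 s"
  \<comment> \<open>The carry reaches position \<open>l\<close> exactly if all lower digits
    overflow, that is, if \<open>b ^ l\<close> divides \<open>Suc j\<close>.\<close>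
  define I where "I l t \<longleftrightarrow> (0 < t ''a'' 0 \<longleftrightarrow> b ^ l dvd Suc j) \<and>
    (\<forall>i. t ''g'' i = (if i < l then Suc j div b ^ i mod b else digits b L j i))" for l and t :: memory
  obtain t where t: "I (?s ''L'' 0) t" "ev (For ''i'' ''L'' ?c) ?s = set_var ''i'' (?s ''L'' 0) t"
  proof (rule For_rule[where I = I and s = ?s and i = "''i''" and b = "''L''" and c = ?c])
    show "I 0 ?s" by (simp add: I_def g)
  next
    fix l t
    assume l: "l < ?s ''L'' 0" and I: "I l t" and fr: "\<And>x. x \<noteq> ''i'' \<Longrightarrow> x \<notin> assigned ?c \<Longrightarrow> t x = ?s x"
    have lL: "l < L" using l s by simp
    have bb: "t ''bb'' 0 = b" using s by (simp add: fr)
    define u where "u = ev ?c (set_var ''i'' l t)"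
    have gl: "t ''g'' l = j div b ^ l mod b" using I lL by (simp add: I_def digits_def)
    have pow: "b ^ Suc l dvd Suc j \<longleftrightarrow> b ^ l dvd Suc j \<and> b dvd Suc j div b ^ l"
    proof
      assume d: "b ^ Suc l dvd Suc j"
      then have "b ^ l dvd Suc j" by (metis dvd_mult_right power_Suc)
      moreover from this have "b dvd Suc j div b ^ l" using d s(3) by (metis dvd_div_iff_mult power_Suc power_not_zero neq0_conv)
      ultimately show "b ^ l dvd Suc j \<and> b dvd Suc j div b ^ l" ..
    next
      assume "b ^ l dvd Suc j \<and> b dvd Suc j div b ^ l"
      then show "b ^ Suc l dvd Suc j" using s(3) by (metis dvd_div_iff_mult power_Suc power_not_zero neq0_conv)
    qed
    show "I (Suc l) (ev ?c (set_var ''i'' l t))"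
      unfolding u_def[symmetric]
    proof (cases "b ^ l dvd Suc j")
      case False
      then have a: "t ''a'' 0 = 0" using I by (simp add: I_def)
      then have u: "u ''a'' 0 = 0" "u ''g'' = t ''g''" unfolding u_def by simp_all
      have "Suc j div b ^ l = j div b ^ l" using False by (simp add: div_Suc dvd_eq_mod_eq_0)
      then have "u ''g'' l = Suc j div b ^ l mod b" using gl u by simp
      then show "I (Suc l) u" using I u False pow unfolding I_def by (auto simp: less_Suc_eq)
    next
      case True
      then have a: "t ''a'' 0 \<noteq> 0" using I by (auto simp: I_def)
      have q: "Suc j div b ^ l = Suc (j div b ^ l)" using True by (simp add: div_Suc dvd_eq_mod_eq_0)
      have u: "u ''a'' 0 = (if Suc (t ''g'' l) < b then 0 else t ''a'' 0)"
        "u ''g'' = (t ''g'')(l := if Suc (t ''g'' l) < b then Suc (t ''g'' l) else 0)"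
        unfolding u_def using a bb by auto
      have "j div b ^ l mod b < b" using s(3) by simp
      then have m: "Suc j div b ^ l mod b = (if Suc (t ''g'' l) < b then Suc (t ''g'' l) else 0)"
        unfolding q gl by (auto simp: mod_Suc)
      have "b dvd Suc j div b ^ l \<longleftrightarrow> \<not> Suc (t ''g'' l) < b"
        unfolding dvd_eq_mod_eq_0 m by simp
      then show "I (Suc l) u" using I u True pow a m unfolding I_def by (auto simp: less_Suc_eq)
    qed
  qed
  have eq: "ev INCR s = set_var ''i'' (?s ''L'' 0) t" unfolding INCR_def using t(2) by (simp only: ev.simps(2,3) exp_val.simps)
  have "b ^ L dvd Suc j \<longleftrightarrow> Suc j = b ^ L" using j by (auto dest: dvd_imp_le)
  then show "0 < ev INCR s ''a'' 0 \<longleftrightarrow> Suc j = b ^ L" "ev INCR s ''g'' = digits b L (Suc j)"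
    using t(1) s(1) unfolding eq I_def by (auto simp: digits_def)
qed

definition written :: "memory \<Rightarrow> nat list \<Rightarrow> bool" where
  "written s xs \<longleftrightarrow> s ''p'' 0 = Suc (length xs) \<and> (\<forall>i<length xs. s ''out'' (Suc i) = xs ! i)"

lemma ev_PUT: "written s xs \<Longrightarrow> exp_val e s = c \<Longrightarrow> written (ev (PUT e) s) (xs @ [c])"
  by (auto simp: written_def PUT_def nth_append less_Suc_eq)

lemma written_cong: "written s xs \<Longrightarrow> t ''p'' = s ''p'' \<Longrightarrow> t ''out'' = s ''out'' \<Longrightarrow> written t xs"
  by (simp add: written_def)

lemma ev_EMIT_ARC:
  assumes s: "written s xs" "s ''i'' 0 = i" "s ''T'' i = a" "s ''H'' i = b" "s X i = c" "c \<le> s ''M'' 0"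
    and X: "X \<notin> {''j'', ''out'', ''p''}"
    and lo: "\<And>t. (\<And>x. x \<notin> {''j'', ''out'', ''p''} \<Longrightarrow> t x = s x) \<Longrightarrow> exp_val lo t = l"
  shows "written (ev (EMIT_ARC X lo) s) (xs @ concat (map (\<lambda>j. [a, b, l + j]) [0..<c]))"
proof -
  let ?put = "PUT (Cell ''T'' (Var ''i'')) ;; PUT (Cell ''H'' (Var ''i'')) ;; PUT (Plus lo (Var ''j''))"
  let ?c = "Cond (Minus (Cell X (Var ''i'')) (Var ''j'')) ?put Nop"
  define I where "I j t \<longleftrightarrow> written t (xs @ concat (map (\<lambda>j. [a, b, l + j]) [0..<min j c]))" for j and t :: memory
  obtain t where t: "I (s ''M'' 0) t" "ev (EMIT_ARC X lo) s = set_var ''j'' (s ''M'' 0) t"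
    unfolding EMIT_ARC_def
  proof (rule For_rule[where I = I and s = s and i = "''j''" and b = "''M''" and c = ?c])
    show "I 0 s" using s(1) by (simp add: I_def)
  next
    fix j t
    assume I: "I j t" and fr: "\<And>x. x \<noteq> ''j'' \<Longrightarrow> x \<notin> assigned ?c \<Longrightarrow> t x = s x"
    let ?t = "set_var ''j'' j t"
    let ?xs = "xs @ concat (map (\<lambda>j. [a, b, l + j]) [0..<min j c])"
    have W: "written ?t ?xs" by (rule written_cong[OF I[unfolded I_def]]) simp_all
    have v: "?t ''i'' 0 = i" "?t ''T'' i = a" "?t ''H'' i = b" "?t X i = c" "?t ''j'' 0 = j"
      using s X by (auto simp: fr)
    show "I (Suc j) (ev ?c ?t)"
    proof (cases "j < c")
      case True
      define u1 where "u1 = ev (PUT (Cell ''T'' (Var ''i''))) ?t"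
      define u2 where "u2 = ev (PUT (Cell ''H'' (Var ''i''))) u1"
      have f1: "u1 x = ?t x" if "x \<notin> {''out'', ''p''}" for x unfolding u1_def using that by (intro ev_frame) simp
      have f2: "u2 x = u1 x" if "x \<notin> {''out'', ''p''}" for x unfolding u2_def using that by (intro ev_frame) simp
      have w1: "written u1 (?xs @ [a])" unfolding u1_def by (rule ev_PUT[OF W]) (use v in simp)
      have w2: "written u2 ((?xs @ [a]) @ [b])" unfolding u2_def
        by (rule ev_PUT[OF w1]) (use v in \<open>simp add: f1\<close>)
      have e: "exp_val lo u2 = l" by (rule lo) (auto simp: f1 f2 fr)
      have w3: "written (ev (PUT (Plus lo (Var ''j''))) u2) (((?xs @ [a]) @ [b]) @ [l + j])"
        by (rule ev_PUT[OF w2]) (use v e in \<open>simp add: f1 f2\<close>)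
      have "ev ?c ?t = ev (PUT (Plus lo (Var ''j''))) u2"
        unfolding u2_def u1_def using v True by (simp only: ev.simps(3,4) exp_val.simps) simp
      then show ?thesis using w3 True unfolding I_def by (simp add: min_def)
    next
      case False
      then have eq: "ev ?c ?t = ?t" using v by (simp only: ev.simps(1,4) exp_val.simps) simp
      have "min (Suc j) c = min j c" using False by simp
      then show ?thesis unfolding eq I_def using W by (simp only:)
    qed
  qed
  have "written t (xs @ concat (map (\<lambda>j. [a, b, l + j]) [0..<c]))"
    using t(1) unfolding I_def min_absorb2[OF s(6)] .
  then show ?thesis unfolding t(2) by (rule written_cong) simp_all
qed

lemma ev_EMIT:
  assumes s: "written s xs" "s ''m'' 0 = m" "\<And>i. i < m \<Longrightarrow> s ''T'' i = src i" "\<And>i. i < m \<Longrightarrow> s ''H'' i = dst i"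
      "\<And>i. i < m \<Longrightarrow> s X i \<le> s ''M'' 0"
    and X: "X \<notin> {''c'', ''i'', ''j'', ''out'', ''p''}"
    and lo: "\<And>i t. i < m \<Longrightarrow> (\<And>x. x \<notin> {''c'', ''i'', ''j'', ''out'', ''p''} \<Longrightarrow> t x = s x) \<Longrightarrow> t ''i'' 0 = i \<Longrightarrow>
      exp_val lo t = l i"
  shows "written (ev (EMIT X lo) s) (xs @ (\<Sum>i<m. s X i) #
    concat (map (\<lambda>i. concat (map (\<lambda>j. [src i, dst i, l i + j]) [0..<s X i])) [0..<m]))"
proof -
  let ?sum = "For ''i'' ''m'' (Set ''c'' (Plus (Var ''c'') (Cell X (Var ''i''))))"
  let ?xs = "\<lambda>m. xs @ (\<Sum>i<s ''m'' 0. s X i) #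
    concat (map (\<lambda>i. concat (map (\<lambda>j. [src i, dst i, l i + j]) [0..<s X i])) [0..<m])"
  let ?s = "set_var ''c'' 0 s"
  have X': "X \<noteq> ''c''" "X \<noteq> ''i''" "''c'' \<noteq> X" "''i'' \<noteq> X" using X by auto
  define J where "J k t \<longleftrightarrow> t ''c'' 0 = (\<Sum>i<k. s X i)" for k and t :: memory
  obtain t where t: "J (?s ''m'' 0) t" "ev ?sum ?s = set_var ''i'' (?s ''m'' 0) t"
  proof (rule For_rule[where I = J and s = ?s and i = "''i''" and b = "''m''" and c = "Set ''c'' (Plus (Var ''c'') (Cell X (Var ''i'')))"])
    show "J 0 ?s" by (simp add: J_def)
  next
    fix k t
    assume J: "J k t" and fr: "\<And>x. x \<noteq> ''i'' \<Longrightarrow> x \<notin> assigned (Set ''c'' (Plus (Var ''c'') (Cell X (Var ''i'')))) \<Longrightarrow> t x = ?s x"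
    have "t X = s X" using X' by (simp add: fr)
    then show "J (Suc k) (ev (Set ''c'' (Plus (Var ''c'') (Cell X (Var ''i'')))) (set_var ''i'' k t))"
      using J X' by (simp add: J_def)
  qed
  define s1 where "s1 = ev ?sum ?s"
  have f1: "s1 x = s x" if "x \<notin> {''c'', ''i''}" for x
  proof -
    have "s1 x = ?s x" unfolding s1_def using that by (intro ev_frame) simp
    then show ?thesis using that by simp
  qed
  have c1: "s1 ''c'' 0 = (\<Sum>i<s ''m'' 0. s X i)" using t(1) unfolding s1_def t(2) J_def by simp
  define s2 where "s2 = ev (PUT (Var ''c'')) s1"
  have f2: "s2 x = s1 x" if "x \<notin> {''out'', ''p''}" for x unfolding s2_def using that by (intro ev_frame) simp
  have "written s1 xs" by (rule written_cong[OF s(1)]) (simp_all add: f1)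
  then have w2: "written s2 (?xs 0)" unfolding s2_def using ev_PUT[of s1 xs "Var ''c''"] c1 by simp
  have m2: "s2 ''m'' 0 = m" using s(2) by (simp add: f1 f2)
  define I where "I k t \<longleftrightarrow> written t (?xs k)" for k and t :: memory
  obtain u where u: "I (s2 ''m'' 0) u" "ev (For ''i'' ''m'' (EMIT_ARC X lo)) s2 = set_var ''i'' (s2 ''m'' 0) u"
  proof (rule For_rule[where I = I and s = s2 and i = "''i''" and b = "''m''" and c = "EMIT_ARC X lo"])
    show "I 0 s2" using w2 by (simp add: I_def)
  next
    fix k t
    assume k: "k < s2 ''m'' 0" and I: "I k t" and fr: "\<And>x. x \<noteq> ''i'' \<Longrightarrow> x \<notin> assigned (EMIT_ARC X lo) \<Longrightarrow> t x = s2 x"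
    let ?t = "set_var ''i'' k t"
    have km: "k < m" using k m2 by simp
    have W: "written ?t (?xs k)" by (rule written_cong[OF I[unfolded I_def]]) simp_all
    have tX: "t X = s X" using X by (simp add: fr f1 f2)
    have "written (ev (EMIT_ARC X lo) ?t) (?xs k @ concat (map (\<lambda>j. [src k, dst k, l k + j]) [0..<s X k]))"
    proof (rule ev_EMIT_ARC[OF W])
      fix t' assume t': "\<And>x. x \<notin> {''j'', ''out'', ''p''} \<Longrightarrow> t' x = ?t x"
      show "exp_val lo t' = l k"
      proof (rule lo[OF km])
        fix x assume "x \<notin> {''c'', ''i'', ''j'', ''out'', ''p''}"
        then show "t' x = s x" using t'[of x] by (simp add: fr f1 f2)
      qed (use t'[of "''i''"] in simp)
    qed (use s km X X' tX in \<open>simp_all add: fr f1 f2\<close>)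
    then show "I (Suc k) (ev (EMIT_ARC X lo) ?t)" by (simp add: I_def)
  qed
  have "ev (EMIT X lo) s = ev (For ''i'' ''m'' (EMIT_ARC X lo)) s2"
    unfolding EMIT_def s2_def s1_def by (simp only: ev.simps(2,3) exp_val.simps)
  also note u(2)
  finally have "ev (EMIT X lo) s = set_var ''i'' (s2 ''m'' 0) u" .
  moreover have "written u (?xs m)" using u(1) unfolding I_def m2 .
  ultimately show ?thesis unfolding s(2) using written_cong[of u _ "set_var ''i'' (s2 ''m'' 0) u"] by simp
qed

lemma length_arc_copies: "length (arc_copies n lo x) = (\<Sum>i<n * n. x i)"
  by (simp add: arc_copies_def length_concat comp_def interv_sum_list_conv_sum_set_nat atLeast0LessThan)

lemma encode_arc_copies:
  "encode_arcs (arc_copies n lo x) = (\<Sum>i<n * n. x i) #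
     concat (map (\<lambda>i. concat (map (\<lambda>j. [i div n, i mod n, lo i + j]) [0..<x i])) [0..<n * n])"
proof -
  have "concat (map (\<lambda>(u, v, i). [u, v, i]) (concat (map (\<lambda>i. map (\<lambda>j. (i div n, i mod n, lo i + j)) [0..<x i]) is)))
      = concat (map (\<lambda>i. concat (map (\<lambda>j. [i div n, i mod n, lo i + j]) [0..<x i])) is)" for "is"
    by (induction "is") (simp_all add: comp_def)
  then show ?thesis unfolding encode_arcs_def length_arc_copies unfolding arc_copies_def by simp
qed

lemma ev_OUT:
  assumes s: "s ''m'' 0 = n * n" "\<And>i. i < n * n \<Longrightarrow> s ''T'' i = i div n" "\<And>i. i < n * n \<Longrightarrow> s ''H'' i = i mod n"
    and le: "\<And>i. 0 < s ''ok'' 0 \<Longrightarrow> i < n * n \<Longrightarrow> s ''x'' i \<le> s ''M'' 0 \<and> s ''y'' i \<le> s ''M'' 0"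
  shows "output_of (ev OUT s) = (if 0 < s ''ok'' 0
    then 1 # encode_arcs (arc_copies n (\<lambda>_. 0) (s ''x'')) @ encode_arcs (arc_copies n (s ''x'') (s ''y'')) else [0])"
proof (cases "0 < s ''ok'' 0")
  case False
  then have "ev OUT s ''out'' 0 = 1" "ev OUT s ''out'' 1 = 0" by (simp_all add: OUT_def)
  then show ?thesis using False by (simp add: output_of_def)
next
  case True
  define s1 where "s1 = set_var ''p'' 1 s"
  define s2 where "s2 = ev (PUT (Const 1)) s1"
  define s3 where "s3 = ev (EMIT ''x'' (Const 0)) s2"
  define s4 where "s4 = ev (EMIT ''y'' (Cell ''x'' (Var ''i''))) s3"
  let ?xs = "1 # encode_arcs (arc_copies n (\<lambda>_. 0) (s ''x'')) @ encode_arcs (arc_copies n (s ''x'') (s ''y''))"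
  have f2: "s2 x = s x" if "x \<notin> {''out'', ''p''}" for x
  proof -
    have "s2 x = s1 x" unfolding s2_def using that by (intro ev_frame) simp
    then show ?thesis using that by (simp add: s1_def)
  qed
  have f3: "s3 x = s2 x" if "x \<notin> {''c'', ''i'', ''j'', ''out'', ''p''}" for x
    unfolding s3_def using that by (intro ev_frame) simp
  have "written s1 []" by (simp add: written_def s1_def)
  then have w2: "written s2 [1]" unfolding s2_def using ev_PUT[of s1 "[]" "Const 1"] by simp
  have "written s3 ([1] @ (\<Sum>i<n * n. s2 ''x'' i) #
    concat (map (\<lambda>i. concat (map (\<lambda>j. [i div n, i mod n, 0 + j]) [0..<s2 ''x'' i])) [0..<n * n]))"
    unfolding s3_def by (rule ev_EMIT[OF w2]) (use s le True in \<open>simp_all add: f2\<close>)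
  then have w3: "written s3 (1 # encode_arcs (arc_copies n (\<lambda>_. 0) (s ''x'')))"
    by (simp add: encode_arc_copies f2)
  have "written s4 ((1 # encode_arcs (arc_copies n (\<lambda>_. 0) (s ''x''))) @ (\<Sum>i<n * n. s3 ''y'' i) #
    concat (map (\<lambda>i. concat (map (\<lambda>j. [i div n, i mod n, s ''x'' i + j]) [0..<s3 ''y'' i])) [0..<n * n]))"
    unfolding s4_def by (rule ev_EMIT[OF w3]) (use s le True in \<open>simp_all add: f2 f3\<close>)
  then have w4: "written s4 ?xs" by (simp add: encode_arc_copies f2 f3)
  have "ev OUT s = s4(''out'' := (s4 ''out'')(0 := s4 ''p'' 0 - 1))"
    unfolding OUT_def s4_def s3_def s2_def s1_def using True
    by (simp only: ev.simps(2-4) exp_val.simps) simp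
  then have "output_of (ev OUT s) = map (\<lambda>i. s4 ''out'' (Suc i)) [0..<length ?xs]"
    using w4 by (simp add: output_of_def written_def)
  also have "\<dots> = ?xs" using w4 by (intro nth_equalityI) (auto simp: written_def simp del: upt_Suc)
  finally show ?thesis using True by simp
qed

section \<open>Reading the input and computing the constants\<close>

definition READ :: prg where
  "READ = Set ''k'' (Cell ''in'' (Const 1)) ;; Set ''n'' (Cell ''in'' (Const 2)) ;; Set ''r'' (Cell ''in'' (Const 3)) ;;
     Set ''kk'' (Minus (Var ''k'') (Minus (Var ''k'') (Var ''n''))) ;;
     Set ''M'' (Plus (Var ''n'') (Var ''n'')) ;; Set ''cap'' (Minus (Var ''n'') (Var ''k''))"

text \<open>Cell 0 of the input holds its length and cells 1 to 3 hold \<open>k\<close>,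
  \<open>n\<close> and \<open>r\<close>, so the matrix starts at cell 4.\<close>

definition ENTRY :: exp where
  "ENTRY = Cell ''in'' (Plus (Var ''m'') (Const 4))"

definition ROW :: prg where
  "ROW = For ''v'' ''n'' (Assign ''T'' (Var ''m'') (Var ''u'') ;; Assign ''H'' (Var ''m'') (Var ''v'') ;;
     Assign ''d'' (Var ''m'') (Minus ENTRY (Minus ENTRY (Var ''M''))) ;; Set ''m'' (Plus (Var ''m'') (Const 1)))"

definition TABLES :: prg where
  "TABLES = For ''u'' ''n'' ROW"

definition DEGREES :: prg where
  "DEGREES = For ''i'' ''m'' (Cond (Cell ''d'' (Var ''i''))
     (Assign ''D'' (Cell ''T'' (Var ''i'')) (Plus (Cell ''D'' (Cell ''T'' (Var ''i''))) (Const 1))) Nop)"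

definition SQUARE :: prg where
  "SQUARE = For ''i'' ''kk'' (For ''j'' ''kk'' (Set ''t1'' (Plus (Var ''t1'') (Const 1))))"

definition CUBE :: prg where
  "CUBE = For ''i'' ''kk'' (For ''j'' ''kk'' (For ''l'' ''kk'' (Set ''c'' (Plus (Var ''c'') (Const 1)))))"

definition DOUBLE :: "string \<Rightarrow> prg" where
  "DOUBLE x = Set x (Plus (Var x) (Var x))"

definition OPTIONS :: prg where
  "OPTIONS = For ''i'' ''kk'' (Set ''bb'' (Plus (Var ''bb'') (Var ''b0'')))"

definition SETUP :: prg where
  "SETUP = DEGREES ;; SQUARE ;; CUBE ;;
     Set ''t2'' (Plus (Var ''t1'') (Plus (Var ''t1'') (Var ''c''))) ;; Set ''t3'' (Plus (Var ''t2'') (Var ''n'')) ;;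
     Set ''b0'' (Var ''c'') ;; DOUBLE ''b0'' ;; DOUBLE ''b0'' ;; DOUBLE ''b0'' ;; DOUBLE ''b0'' ;;
     Set ''small'' (Minus (Plus (Var ''k'') (Var ''k'')) (Plus (Var ''n'') (Const 1))) ;;
     Cond (Var ''small'')
       (Set ''bb'' (Plus (Var ''n'') (Const 1)) ;; Set ''L'' (Plus (Var ''m'') (Var ''m'')))
       (OPTIONS ;; Set ''L'' (Plus (Var ''t1'') (Var ''t1'')))"

definition BODY :: prg where
  "BODY = Cond (Var ''small'') SMALL LARGE ;;
     Cond (Var ''ok'') (Set ''act'' (Const 0)) (INCR ;; Cond (Var ''a'') (Set ''act'' (Const 0)) Nop)"

lemma assigned_READ [simp]: "assigned READ = {''k'', ''n'', ''r'', ''kk'', ''M'', ''cap''}"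
  by (auto simp: READ_def)

lemma assigned_ROW [simp]: "assigned ROW = {''v'', ''T'', ''H'', ''d'', ''m''}"
  by (auto simp: ROW_def)

lemma assigned_TABLES [simp]: "assigned TABLES = {''u'', ''v'', ''T'', ''H'', ''d'', ''m''}"
  by (auto simp: TABLES_def)

lemma assigned_DEGREES [simp]: "assigned DEGREES = {''i'', ''D''}"
  by (auto simp: DEGREES_def)

lemma assigned_SQUARE [simp]: "assigned SQUARE = {''i'', ''j'', ''t1''}"
  by (auto simp: SQUARE_def)

lemma assigned_CUBE [simp]: "assigned CUBE = {''i'', ''j'', ''l'', ''c''}"
  by (auto simp: CUBE_def)

lemma assigned_OPTIONS [simp]: "assigned OPTIONS = {''i'', ''bb''}"
  by (auto simp: OPTIONS_def)

lemma assigned_SETUP [simp]: "assigned SETUP = {''i'', ''D'', ''j'', ''t1'', ''l'', ''c'', ''t2'', ''t3'', ''b0'', ''small'',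
    ''bb'', ''L''}"
  by (auto simp: SETUP_def DOUBLE_def)

lemma assigned_BODY [simp]:
  "assigned BODY = assigned SMALL \<union> assigned LARGE \<union> assigned INCR \<union> {''act''}"
  unfolding BODY_def by (simp only: assigned.simps) blast

lemma For_add:
  assumes "\<And>j t. (\<And>x. x \<noteq> i \<Longrightarrow> x \<notin> assigned c \<Longrightarrow> t x = s x) \<Longrightarrow> ev c (set_var i j t) x 0 = t x 0 + q"
    and "x \<noteq> i"
  shows "ev (For i b c) s x 0 = s x 0 + s b 0 * q"
proof -
  obtain t where t: "t x 0 = s x 0 + s b 0 * q" "ev (For i b c) s = set_var i (s b 0) t"
  proof (rule For_rule[where I = "\<lambda>j t. t x 0 = s x 0 + j * q" and s = s and i = i and b = b and c = c])
    fix j t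
    assume I: "t x 0 = s x 0 + j * q" and fr: "\<And>x. x \<noteq> i \<Longrightarrow> x \<notin> assigned c \<Longrightarrow> t x = s x"
    have "ev c (set_var i j t) x 0 = t x 0 + q" using fr by (rule assms(1))
    then show "ev c (set_var i j t) x 0 = s x 0 + Suc j * q" using I by simp
  qed auto
  then show ?thesis using assms(2) by simp
qed

lemma ev_SQUARE: "ev SQUARE s ''t1'' 0 = s ''t1'' 0 + s ''kk'' 0 * s ''kk'' 0"
proof -
  have "ev (For ''j'' ''kk'' (Set ''t1'' (Plus (Var ''t1'') (Const 1)))) s ''t1'' 0 = s ''t1'' 0 + s ''kk'' 0 * 1" for s
    by (rule For_add) simp_all
  note inner = this
  show ?thesis
    unfolding SQUARE_def by (rule For_add) (simp_all only: inner, simp_all)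
qed

lemma ev_CUBE: "ev CUBE s ''c'' 0 = s ''c'' 0 + s ''kk'' 0 * (s ''kk'' 0 * s ''kk'' 0)"
proof -
  have 1: "ev (For ''l'' ''kk'' (Set ''c'' (Plus (Var ''c'') (Const 1)))) s ''c'' 0 = s ''c'' 0 + s ''kk'' 0 * 1" for s
    by (rule For_add) simp_all
  have 2: "ev (For ''j'' ''kk'' (For ''l'' ''kk'' (Set ''c'' (Plus (Var ''c'') (Const 1))))) s ''c'' 0
      = s ''c'' 0 + s ''kk'' 0 * s ''kk'' 0" for s
    by (rule For_add) (simp_all only: 1, simp_all)
  show ?thesis
    unfolding CUBE_def by (rule For_add) (simp_all only: 2, simp_all)
qed

lemma ev_OPTIONS: "ev OPTIONS s ''bb'' 0 = s ''bb'' 0 + s ''kk'' 0 * s ''b0'' 0"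
  unfolding OPTIONS_def by (rule For_add) simp_all

lemma concat_rows:
  "concat (map (\<lambda>u. map (m u) [0..<n]) [0..<l]) = map (\<lambda>i. m (i div n) (i mod n)) [0..<l * n]"
proof (induction l)
  case (Suc l)
  have "map (\<lambda>i. m (i div n) (i mod n)) [l * n..<l * n + n] = map (m l) [0..<n]"
    by (rule nth_equalityI) simp_all
  moreover have "[0..<Suc l * n] = [0..<l * n] @ [l * n..<l * n + n]"
    using upt_add_eq_append[of 0 "l * n" n] by (simp add: add.commute)
  ultimately show ?case using Suc by simp
qed simp

lemma encode_instance_flat:
  "encode_instance k n m r = k # n # r # map (\<lambda>i. m (i div n) (i mod n)) [0..<n * n]"
  by (simp add: encode_instance_def concat_rows)

context rooted_multi_digraph
begin

text \<open>A branching can do with \<open>n\<close> copies of an arc, as no cut demands more than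
  \<open>n\<close> units, so \<open>n + n\<close> copies serve both. This removes the multiplicities
  from the running time.\<close>

definition trunc :: "nat \<Rightarrow> nat" where
  "trunc i = min (m (i div n) (i mod n)) (n + n)"

text \<open>Arcs 0 and \<open>n * n - 1\<close> are the pairs \<open>(0, 0)\<close> and
  \<open>(n - 1, n - 1)\<close>, loops of multiplicity 0.\<close>

sublocale arc_array n "n * n" "\<lambda>i. i div n" "\<lambda>i. i mod n" r trunc
proof unfold_locales
  have n: "0 < n" using r_less by simp
  then show "0 < n * n" by simp
  show "trunc 0 = 0" using loopfree[of 0] n by (simp add: trunc_def)
  obtain n' where n': "n = Suc n'" using n by (cases n) simp_all
  then have "n * n - 1 = n' + n' * n" by simp
  then have "(n * n - 1) div n = n - 1" "(n * n - 1) mod n = n - 1"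
    using n' by (simp_all del: mult_Suc mult_Suc_right)
  then show "trunc (n * n - 1) = 0" using loopfree[of "n - 1"] n by (simp add: trunc_def)
  show "inj_on (\<lambda>i. (i div n, i mod n)) {..<n * n}"
    by (rule inj_onI) (metis div_mult_mod_eq prod.inject)
qed

text \<open>The bound on \<open>t3\<close> is kept in both cases: the time bound of
  \<open>BODY\<close> is syntactic and charges the loops of \<open>LARGE\<close> even when
  \<open>SMALL\<close> is executed.\<close>

definition ready :: "nat \<Rightarrow> memory \<Rightarrow> bool" where
  "ready k s \<longleftrightarrow> graph_mem s \<and> s ''k'' 0 = k \<and> s ''cap'' 0 = n - k \<and> s ''M'' 0 = n + n \<and>
     s ''small'' 0 = k + k - (n + 1) \<and> s ''t3'' 0 \<le> 4 * n ^ 3 \<and>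
     (if 2 * k \<le> n + 1 then s ''t1'' 0 = k * k \<and> s ''t2'' 0 = k * k + (k * k + k * (k * k)) \<and>
        s ''t3'' 0 = s ''t2'' 0 + n \<and> s ''b0'' 0 = 16 * (k * (k * k)) \<and>
        s ''bb'' 0 = k * (16 * (k * (k * k))) \<and> s ''L'' 0 = k * k + k * k
      else s ''bb'' 0 = n + 1 \<and> s ''L'' 0 = n * n + n * n)"

lemma ready_cong:
  assumes "ready k s" "\<And>x. x \<in> {''n'', ''m'', ''r'', ''T'', ''H'', ''d'', ''D'', ''k'', ''cap'', ''M'', ''small'', ''t1'',
    ''t2'', ''t3'', ''b0'', ''bb'', ''L''} \<Longrightarrow> t x = s x"
  shows "ready k t"
proof -
  have "graph_mem s" using assms(1) by (simp add: ready_def)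
  then have "graph_mem t" by (rule graph_mem_cong) (auto simp: assms(2))
  then show ?thesis using assms(1) unfolding ready_def by (simp add: assms(2))
qed

lemma ev_READ:
  fixes k
  defines "s \<equiv> ev READ (initial_memory (encode_instance k n m r))"
  shows "s ''k'' 0 = k" "s ''n'' 0 = n" "s ''r'' 0 = r" "s ''kk'' 0 = min k n" "s ''M'' 0 = n + n" "s ''cap'' 0 = n - k"
    "i < n * n \<Longrightarrow> s ''in'' (i + 4) = m (i div n) (i mod n)"
    "x \<notin> {''in'', ''k'', ''n'', ''r'', ''kk'', ''M'', ''cap''} \<Longrightarrow> s x = (\<lambda>_. 0)"
proof -
  let ?s = "initial_memory (encode_instance k n m r)"
  have ins: "?s ''in'' 1 = k" "?s ''in'' 2 = n" "?s ''in'' 3 = r" "i < n * n \<Longrightarrow> ?s ''in'' (i + 4) = m (i div n) (i mod n)" for i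
    unfolding initial_memory_def encode_instance_flat by (simp_all add: numeral_eq_Suc)
  have other: "?s x = (\<lambda>_. 0)" if "x \<noteq> ''in''" for x using that by (simp add: initial_memory_def)
  show "s ''k'' 0 = k" "s ''n'' 0 = n" "s ''r'' 0 = r" "s ''kk'' 0 = min k n" "s ''M'' 0 = n + n" "s ''cap'' 0 = n - k"
    using ins(1-3) unfolding s_def READ_def by (simp_all add: min_def)
  have "s ''in'' = ?s ''in''" unfolding s_def by (rule ev_frame) simp
  then show "i < n * n \<Longrightarrow> s ''in'' (i + 4) = m (i div n) (i mod n)" using ins(4) by simp
  assume x: "x \<notin> {''in'', ''k'', ''n'', ''r'', ''kk'', ''M'', ''cap''}"
  then have "s x = ?s x" unfolding s_def by (intro ev_frame) simp
  then show "s x = (\<lambda>_. 0)" using other[of x] x by simp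
qed

lemma ev_TABLES:
  assumes s: "s ''n'' 0 = n" "s ''m'' 0 = 0" "s ''M'' 0 = n + n"
    "\<And>i. i < n * n \<Longrightarrow> s ''in'' (i + 4) = m (i div n) (i mod n)"
  defines "t \<equiv> ev TABLES s"
  shows "t ''m'' 0 = n * n" "\<forall>i<n * n. t ''T'' i = i div n \<and> t ''H'' i = i mod n \<and> t ''d'' i = trunc i"
proof -
  define J where "J l t \<longleftrightarrow> t ''m'' 0 = l \<and> (\<forall>i<l. t ''T'' i = i div n \<and> t ''H'' i = i mod n \<and> t ''d'' i = trunc i)"
    for l and t :: memory
  let ?c = "Assign ''T'' (Var ''m'') (Var ''u'') ;; Assign ''H'' (Var ''m'') (Var ''v'') ;;
     Assign ''d'' (Var ''m'') (Minus ENTRY (Minus ENTRY (Var ''M''))) ;; Set ''m'' (Plus (Var ''m'') (Const 1))"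
  have row: "J (u * n + n) (ev ROW t)"
    if t: "J (u * n) t" "t ''u'' 0 = u" and fr: "\<And>x. x \<notin> assigned TABLES \<Longrightarrow> t x = s x" and u: "u < n" for u t
  proof -
    obtain t' where t': "J (u * n + t ''n'' 0) t'" "ev ROW t = set_var ''v'' (t ''n'' 0) t'"
      unfolding ROW_def
    proof (rule For_rule[where I = "\<lambda>v. J (u * n + v)" and s = t and i = "''v''" and b = "''n''" and c = ?c])
      show "J (u * n + 0) t" using t(1) by simp
    next
      fix v t'
      assume v: "v < t ''n'' 0" and J: "J (u * n + v) t'" and fr': "\<And>x. x \<noteq> ''v'' \<Longrightarrow> x \<notin> assigned ?c \<Longrightarrow> t' x = t x"
      have vn: "v < n" using v s(1) by (simp add: fr)
      have lt: "u * n + v < n * n" by (rule arc_index_less[OF u vn])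
      have dm: "(u * n + v) div n = u" "(u * n + v) mod n = v" using vn by simp_all
      have c: "t' ''u'' 0 = u" "t' ''M'' 0 = n + n" "t' ''in'' (u * n + v + 4) = m u v"
        using t(2) s(3) s(4)[OF lt] dm by (simp_all add: fr fr' ENTRY_def)
      have mm: "t' ''m'' 0 = u * n + v" using J by (simp add: J_def)
      have ev: "ev ?c (set_var ''v'' v t') ''T'' = (t' ''T'')(u * n + v := u)"
        "ev ?c (set_var ''v'' v t') ''H'' = (t' ''H'')(u * n + v := v)"
        "ev ?c (set_var ''v'' v t') ''d'' = (t' ''d'')(u * n + v := m u v - (m u v - (n + n)))"
        "ev ?c (set_var ''v'' v t') ''m'' 0 = Suc (u * n + v)"
        using c mm by (simp_all add: ENTRY_def)
      have tr: "m u v - (m u v - (n + n)) = trunc (u * n + v)" unfolding trunc_def dm by (simp add: min_def)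
      show "J (u * n + Suc v) (ev ?c (set_var ''v'' v t'))"
        using J vn unfolding J_def ev tr by (auto simp: less_Suc_eq)
    qed
    have "t ''n'' 0 = n" using s(1) by (simp add: fr)
    then show ?thesis using t'(1) unfolding t'(2) J_def by simp
  qed
  obtain t' where t': "J (s ''n'' 0 * n) t'" "t = set_var ''u'' (s ''n'' 0) t'"
    unfolding t_def TABLES_def
  proof (rule For_rule[where I = "\<lambda>u. J (u * n)" and s = s and i = "''u''" and b = "''n''" and c = ROW])
    show "J (0 * n) s" using s(2) by (simp add: J_def)
  next
    fix u t
    assume u: "u < s ''n'' 0" and J: "J (u * n) t" and fr: "\<And>x. x \<noteq> ''u'' \<Longrightarrow> x \<notin> assigned ROW \<Longrightarrow> t x = s x"
    have "J (u * n + n) (ev ROW (set_var ''u'' u t))"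
      by (rule row) (use J u s(1) in \<open>auto simp: J_def fr\<close>)
    then show "J (Suc u * n) (ev ROW (set_var ''u'' u t))" by (simp add: add.commute)
  qed
  show "t ''m'' 0 = n * n" "\<forall>i<n * n. t ''T'' i = i div n \<and> t ''H'' i = i mod n \<and> t ''d'' i = trunc i"
    using t'(1) unfolding t'(2) s(1) J_def by simp_all
qed

lemma ev_DEGREES:
  assumes s: "s ''m'' 0 = n * n" "\<forall>i<n * n. s ''T'' i = i div n \<and> s ''d'' i = trunc i" "s ''D'' = (\<lambda>_. 0)"
  shows "ev DEGREES s ''D'' = outdeg"
proof -
  let ?c = "Cond (Cell ''d'' (Var ''i''))
     (Assign ''D'' (Cell ''T'' (Var ''i'')) (Plus (Cell ''D'' (Cell ''T'' (Var ''i''))) (Const 1))) Nop"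
  let ?N = "\<lambda>l u. {i. i < l \<and> i div n = u \<and> 0 < trunc i}"
  obtain t where t: "t ''D'' = (\<lambda>u. card (?N (s ''m'' 0) u))" "ev DEGREES s = set_var ''i'' (s ''m'' 0) t"
    unfolding DEGREES_def
  proof (rule For_rule[where I = "\<lambda>l t. t ''D'' = (\<lambda>u. card (?N l u))" and s = s and i = "''i''" and b = "''m''" and c = ?c])
    show "s ''D'' = (\<lambda>u. card (?N 0 u))" by (simp add: s(3))
  next
    fix l t
    assume l: "l < s ''m'' 0" and I: "t ''D'' = (\<lambda>u. card (?N l u))" and fr: "\<And>x. x \<noteq> ''i'' \<Longrightarrow> x \<notin> assigned ?c \<Longrightarrow> t x = s x"
    have "s ''T'' l = l div n" "s ''d'' l = trunc l" using l s by simp_all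
    then have ev: "ev ?c (set_var ''i'' l t) ''D'' = (if 0 < trunc l then (t ''D'')(l div n := Suc (t ''D'' (l div n))) else t ''D'')"
      by (simp add: fr)
    have N: "?N (Suc l) u = (if 0 < trunc l \<and> u = l div n then insert l (?N l u) else ?N l u)" for u
      by (auto simp: less_Suc_eq)
    have "card (?N (Suc l) u) = card (?N l u) + (if 0 < trunc l \<and> u = l div n then 1 else 0)" for u
      unfolding N by simp
    then show "ev ?c (set_var ''i'' l t) ''D'' = (\<lambda>u. card (?N (Suc l) u))"
      unfolding ev I by auto
  qed
  show ?thesis using t(1) unfolding t(2) s(1) by (simp add: outdeg_def fun_eq_iff)
qed

lemma ready_prelude:
  fixes k
  defines "s \<equiv> ev SETUP (ev TABLES (ev READ (initial_memory (encode_instance k n m r))))"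
  shows "ready k s" "s ''g'' = (\<lambda>_. 0)" "s ''x'' = (\<lambda>_. 0)" "s ''y'' = (\<lambda>_. 0)"
proof -
  define s1 where "s1 = ev READ (initial_memory (encode_instance k n m r))"
  define s2 where "s2 = ev TABLES s1"
  define s3 where "s3 = ev DEGREES s2"
  define s4 where "s4 = ev SQUARE s3"
  define s5 where "s5 = ev CUBE s4"
  let ?rest = "Set ''t2'' (Plus (Var ''t1'') (Plus (Var ''t1'') (Var ''c''))) ;; Set ''t3'' (Plus (Var ''t2'') (Var ''n'')) ;;
     Set ''b0'' (Var ''c'') ;; DOUBLE ''b0'' ;; DOUBLE ''b0'' ;; DOUBLE ''b0'' ;; DOUBLE ''b0'' ;;
     Set ''small'' (Minus (Plus (Var ''k'') (Var ''k'')) (Plus (Var ''n'') (Const 1)))"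
  let ?last = "Cond (Var ''small'')
       (Set ''bb'' (Plus (Var ''n'') (Const 1)) ;; Set ''L'' (Plus (Var ''m'') (Var ''m'')))
       (OPTIONS ;; Set ''L'' (Plus (Var ''t1'') (Var ''t1'')))"
  define s6 where "s6 = ev ?rest s5"
  have eq: "s = ev ?last s6"
    unfolding s_def SETUP_def s6_def s5_def s4_def s3_def s2_def s1_def by (simp only: ev.simps(3))
  note read = ev_READ[where k = k, folded s1_def]
  have m1: "s1 ''m'' 0 = 0" by (simp add: read(8))
  note tab = ev_TABLES[OF read(2) m1 read(5) read(7), folded s2_def]
  have f2: "s2 x = s1 x" if "x \<notin> assigned TABLES" for x unfolding s2_def using that by (rule ev_frame)
  have f3: "s3 x = s2 x" if "x \<notin> {''i'', ''D''}" for x unfolding s3_def using that by (intro ev_frame) simp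
  have f4: "s4 x = s3 x" if "x \<notin> {''i'', ''j'', ''t1''}" for x unfolding s4_def using that by (intro ev_frame) simp
  have f5: "s5 x = s4 x" if "x \<notin> {''i'', ''j'', ''l'', ''c''}" for x unfolding s5_def using that by (intro ev_frame) simp
  have f6: "s6 x = s5 x" if "x \<notin> {''t2'', ''t3'', ''b0'', ''small''}" for x
    unfolding s6_def using that by (intro ev_frame) (simp add: DOUBLE_def)
  have fs: "s x = s6 x" if "x \<notin> {''bb'', ''L'', ''i''}" for x
    unfolding eq using that by (intro ev_frame) simp
  have D3: "s3 ''D'' = outdeg"
    unfolding s3_def by (rule ev_DEGREES) (use tab in \<open>simp_all add: f2 read\<close>)
  let ?q = "min k n"
  have t1: "s4 ''t1'' 0 = ?q * ?q" unfolding s4_def ev_SQUARE by (simp add: f3 f2 read)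
  have c5: "s5 ''c'' 0 = ?q * (?q * ?q)" unfolding s5_def ev_CUBE by (simp add: f4 f3 f2 read)
  have s5: "s5 ''t1'' 0 = ?q * ?q" "s5 ''n'' 0 = n" "s5 ''k'' 0 = k" using t1 by (simp_all add: f5 f4 f3 f2 read)
  have s6: "s6 ''t2'' 0 = ?q * ?q + (?q * ?q + ?q * (?q * ?q))" "s6 ''t3'' 0 = s6 ''t2'' 0 + n"
    "s6 ''b0'' 0 = 16 * (?q * (?q * ?q))" "s6 ''small'' 0 = k + k - (n + 1)"
    unfolding s6_def DOUBLE_def using s5 c5 by simp_all
  have s6': "s6 ''t1'' 0 = ?q * ?q" "s6 ''kk'' 0 = ?q" "s6 ''n'' 0 = n" "s6 ''k'' 0 = k" "s6 ''m'' 0 = n * n" "s6 ''bb'' 0 = 0"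
    "s6 ''r'' 0 = r" "s6 ''M'' 0 = n + n" "s6 ''cap'' 0 = n - k"
    using s5 tab by (simp_all add: f6 f5 f4 f3 f2 read)
  have n: "0 < n" using r_less by simp
  have gm: "graph_mem s"
    unfolding graph_mem_def using s6' tab(2) D3 n by (simp add: fs f6 f5 f4 f3)
  \<comment> \<open>With \<open>?q\<close> at most \<open>n\<close> and \<open>n\<close> positive,
    each of the four summands is at most \<open>n ^ 3\<close>.\<close>
  have "s6 ''t3'' 0 \<le> n * n + (n * n + n * (n * n)) + n * (n * n)"
    unfolding s6(1,2) using n by (intro add_mono mult_le_mono) auto
  also have "n * n \<le> n * (n * n)" using n by simp
  then have "n * n + (n * n + n * (n * n)) + n * (n * n) \<le> 4 * n ^ 3"
    unfolding power3_eq_cube mult.assoc by linarith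
  finally have t3: "s6 ''t3'' 0 \<le> 4 * n ^ 3" .
  have zero: "s x = (\<lambda>_. 0)" if x: "x \<in> {''g'', ''x'', ''y''}" for x
  proof -
    have "s x = s6 x" by (rule fs) (use x in auto)
    also have "\<dots> = s5 x" by (rule f6) (use x in auto)
    also have "\<dots> = s4 x" by (rule f5) (use x in auto)
    also have "\<dots> = s3 x" by (rule f4) (use x in auto)
    also have "\<dots> = s2 x" by (rule f3) (use x in auto)
    also have "\<dots> = s1 x" by (rule f2) (use x in auto)
    also have "\<dots> = (\<lambda>_. 0)" by (rule read(8)) (use x in auto)
    finally show ?thesis .
  qed
  show "ready k s"
  proof (cases "2 * k \<le> n + 1")
    case True
    then have "k \<le> n" using n by linarith
    then have q: "?q = k" by (rule min_absorb1)
    define s7 where "s7 = ev OPTIONS s6"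
    have f7: "s7 x = s6 x" if "x \<notin> {''i'', ''bb''}" for x unfolding s7_def using that by (intro ev_frame) simp
    have small: "s6 ''small'' 0 = 0" using True by (simp add: s6)
    have "s = set_var ''L'' (s7 ''t1'' 0 + s7 ''t1'' 0) s7"
      unfolding eq s7_def using small by (simp only: ev.simps(2-4) exp_val.simps) simp
    then have "s ''bb'' 0 = k * (16 * (k * (k * k)))" "s ''L'' 0 = k * k + k * k"
      using s6(3) s6' q ev_OPTIONS[of s6, folded s7_def] by (simp_all add: f7)
    then show ?thesis
      unfolding ready_def using gm True s6 s6' t3 small by (simp add: fs q)
  next
    case False
    then have small: "s6 ''small'' 0 \<noteq> 0" by (simp add: s6)
    have "s = set_var ''L'' (n * n + n * n) (set_var ''bb'' (n + 1) s6)"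
      unfolding eq using small s6' by (simp only: ev.simps(2-4) exp_val.simps) simp
    then have "s ''bb'' 0 = n + 1" "s ''L'' 0 = n * n + n * n" by simp_all
    moreover have "s ''k'' 0 = k" "s ''cap'' 0 = n - k" "s ''M'' 0 = n + n" "s ''small'' 0 = k + k - (n + 1)"
      "s ''t3'' 0 \<le> 4 * n ^ 3"
    proof -
      have "s ''k'' = s6 ''k''" "s ''cap'' = s6 ''cap''" "s ''M'' = s6 ''M''" "s ''small'' = s6 ''small''"
        "s ''t3'' = s6 ''t3''" by (rule fs, simp)+
      then show "s ''k'' 0 = k" "s ''cap'' 0 = n - k" "s ''M'' 0 = n + n" "s ''small'' 0 = k + k - (n + 1)"
        "s ''t3'' 0 \<le> 4 * n ^ 3"
        using s6(4) s6'(4,8,9) t3 by (simp_all only:)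
    qed
    ultimately show ?thesis
      unfolding ready_def if_not_P[OF False] using gm by blast
  qed
  show "s ''g'' = (\<lambda>_. 0)" "s ''x'' = (\<lambda>_. 0)" "s ''y'' = (\<lambda>_. 0)"
    by (rule zero, simp)+
qed

end

section \<open>The search and its running time\<close>

text \<open>The search is the only loop that is not a \<open>For\<close> loop: its number of rounds
  is not polynomial in \<open>n\<close> alone, so it is counted separately in
  \<open>search_loop\<close>.\<close>

definition PROGRAM :: com where
  "PROGRAM = Seq (compile READ) (Seq (compile TABLES) (Seq (compile SETUP) (Seq (Store ''act'' (Const 0) (Const 1))
     (Seq (While (Var ''act'') (compile BODY)) (compile OUT)))))"

lemma well_formed_GROW: "well_formed (GROW ew eq)"
  by (simp add: GROW_def CLOSE_def PASS_def)

lemma well_formed_FIND: "X \<noteq> ''a'' \<Longrightarrow> well_formed (FIND X)"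
  by (simp add: FIND_def COUNT_def COPY_def well_formed_GROW)

lemma well_formed_EXTEND: "well_formed EXTEND"
  by (simp add: EXTEND_def CHECK_def COPY_def well_formed_GROW)

lemma well_formed_REPAIR: "X \<in> {''x'', ''y''} \<Longrightarrow> well_formed (REPAIR X e)"
  by (auto simp: REPAIR_def TRY_def UNDO_def well_formed_EXTEND well_formed_FIND)

lemma well_formed_BODY: "well_formed BODY"
  by (simp add: BODY_def LARGE_def well_formed_REPAIR well_formed_FIND SMALL_def CONSERVE_def BALANCE_def
      CEIL_def DIVIDE_def FITS_def INCR_def)

lemma well_formed_others: "well_formed READ" "well_formed TABLES" "well_formed SETUP" "well_formed OUT"
  by (simp_all add: READ_def TABLES_def ROW_def SETUP_def DEGREES_def SQUARE_def CUBE_def DOUBLE_def OPTIONS_def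
      OUT_def EMIT_def EMIT_ARC_def PUT_def)

lemma loop_bounds_GROW: "loop_bounds (GROW ew eq) = {''m'', ''n''}"
  by (auto simp: GROW_def CLOSE_def PASS_def)

lemma loop_bounds_FIND: "loop_bounds (FIND X) = {''m'', ''n''}"
  by (auto simp: FIND_def COUNT_def COPY_def loop_bounds_GROW)

lemma loop_bounds_EXTEND: "loop_bounds EXTEND = {''m'', ''n''}"
  by (auto simp: EXTEND_def CHECK_def COPY_def loop_bounds_GROW)

lemma loop_bounds_REPAIR: "loop_bounds (REPAIR X e) = {''m'', ''n''}"
  by (auto simp: REPAIR_def TRY_def UNDO_def loop_bounds_EXTEND loop_bounds_FIND)

lemma loop_bounds_BODY: "loop_bounds BODY = {''m'', ''n'', ''t3'', ''L''}"
  by (auto simp: BODY_def LARGE_def loop_bounds_REPAIR loop_bounds_FIND SMALL_def CONSERVE_def BALANCE_def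
      CEIL_def DIVIDE_def FITS_def INCR_def)

lemma loop_bounds_others: "loop_bounds READ = {}" "loop_bounds TABLES = {''n''}" "loop_bounds SETUP = {''m'', ''kk''}"
    "loop_bounds OUT = {''m'', ''M''}"
  by (auto simp: READ_def TABLES_def ROW_def SETUP_def DEGREES_def SQUARE_def CUBE_def DOUBLE_def OPTIONS_def
      OUT_def EMIT_def EMIT_ARC_def PUT_def)

lemma assigned_OUT [simp]: "assigned OUT = {''p'', ''out'', ''c'', ''i'', ''j''}"
  by (auto simp: OUT_def)

context rooted_net
begin

lemma unit_flow_cong: "(\<And>i. i \<in> A \<Longrightarrow> z i = z' i) \<Longrightarrow> unit_flow z \<longleftrightarrow> unit_flow z'"
proof -
  assume "\<And>i. i \<in> A \<Longrightarrow> z i = z' i"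
  then have "inflow z v = inflow z' v" "outflow z v = outflow z' v" for v
    unfolding inflow_def outflow_def by (auto intro!: sum.cong)
  then show ?thesis by (simp add: unit_flow_def)
qed

end

context rooted_multi_digraph
begin

definition solution :: "nat \<Rightarrow> (nat \<Rightarrow> nat) \<Rightarrow> (nat \<Rightarrow> nat) \<Rightarrow> bool" where
  "solution k x y \<longleftrightarrow> (\<forall>i<n * n. x i + y i \<le> trunc i) \<and> feasible (n - k) x \<and> feasible (n - k) y"

definition base :: "nat \<Rightarrow> nat" where
  "base k = (if 2 * k \<le> n + 1 then k * (16 * (k * (k * k))) else n + 1)"

definition len :: "nat \<Rightarrow> nat" where
  "len k = (if 2 * k \<le> n + 1 then k * k + k * k else n * n + n * n)"

text \<open>A sufficient criterion for success on the guess \<open>g\<close> that does not mention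
  the program. \<open>ev_TEST\<close> shows that accepted guesses succeed and that any success
  yields a solution, so success on further guesses is harmless.\<close>

definition accepted :: "nat \<Rightarrow> (nat \<Rightarrow> nat) \<Rightarrow> bool" where
  "accepted k g \<longleftrightarrow> (if 2 * k \<le> n + 1
     then accepting k (run k (16 * (k * (k * k))) (k * k) (k * k + (k * k + k * (k * k))) g
       (k * k + (k * k + k * (k * k)) + n))
     else unit_flow g \<and> unit_flow (\<lambda>i. g (n * n + i)) \<and> (\<forall>i<n * n. g i \<le> n) \<and> (\<forall>i<n * n. g (n * n + i) \<le> n) \<and>
       (\<exists>x y. (\<forall>i<n * n. g i \<le> (n - k) * x i) \<and> (\<forall>i<n * n. g (n * n + i) \<le> (n - k) * y i) \<and>
         (\<forall>i<n * n. x i + y i \<le> trunc i)))"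

text \<open>Truncating both vectors at \<open>n\<close> keeps them feasible by
  \<open>cut_condition_truncate\<close>, and their sum then respects the cap \<open>n + n\<close> in
  \<open>trunc\<close>.\<close>

lemma solution_exists:
  assumes "disjoint_spanning_flow_branchings (multi_digraph n m) r k X Y"
  obtains x y where "solution k x y"
proof -
  obtain x y where xy: "\<And>i. i < n * n \<Longrightarrow> x i + y i \<le> m (i div n) (i mod n)"
    "feasible (n - k) x" "feasible (n - k) y"
    by (rule disjoint_branchings_feasible[OF assms]) blast
  have trunc: "feasible (n - k) (\<lambda>i. min (x i) n)" if "feasible (n - k) x" for x
    unfolding feasible_iff_cut
  proof (rule cut_condition_truncate[OF that[unfolded feasible_iff_cut]])
    fix i
    show "min ((n - k) * x i) (card {..<n}) \<le> (n - k) * min (x i) n" by (cases "n - k") (auto simp: min_def)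
  qed
  have "min (x i) n + min (y i) n \<le> trunc i" if "i < n * n" for i
    using xy(1)[OF that] unfolding trunc_def by linarith
  then show thesis using that[of "\<lambda>i. min (x i) n" "\<lambda>i. min (y i) n"] trunc xy(2,3) by (simp add: solution_def)
qed

text \<open>Capacities above \<open>n\<close> can be lowered to \<open>n\<close> without violating a
  cut. Hence digits of base \<open>n + 1\<close> suffice to guess a flow.\<close>

lemma bounded_unit_flow:
  assumes "feasible c x"
  obtains z where "unit_flow z" "\<And>i. z i \<le> n" "\<And>i. z i \<le> c * x i"
proof -
  have "cut_condition (\<lambda>i. min (c * x i) n)"
    by (rule cut_condition_truncate[OF assms[unfolded feasible_iff_cut]]) simp
  then obtain z where "\<And>i. z i \<le> min (c * x i) n" "unit_flow z" by (rule unit_flow_exists) blast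
  then show thesis using that by simp
qed

lemma accepted_exists:
  assumes k: "0 < k" and sol: "solution k X Y"
  obtains j where "j < base k ^ len k" "accepted k (digits (base k) (len k) j)"
proof (cases "2 * k \<le> n + 1")
  case True
  have "k \<le> n" using True k r_less by linarith
  \<comment> \<open>As \<open>k^2\<close> is at most \<open>k^3\<close>, the left-hand side is at
    most \<open>1 + 12 k^3\<close>. The factor 16 exceeds this and is produced by four
    doublings.\<close>
  have "1 + 4 * (k * k + (k * k + k * (k * k))) < 16 * (k * (k * k))"
  proof -
    have "1 + 4 * (a + (a + b)) < 16 * b" if "a \<le> b" "1 \<le> b" for a b :: nat
      using that by simp
    moreover have "k * k \<le> k * (k * k)" "1 \<le> k * (k * k)" using k by simp_all
    ultimately show ?thesis by blast
  qed
  then obtain g where g: "\<And>j. g j < k * (16 * (k * (k * k)))" "\<And>j. k * k + k * k \<le> j \<Longrightarrow> g j = 0"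
    "accepting k (run k (16 * (k * (k * k))) (k * k) (k * k + (k * k + k * (k * k))) g (k * k + (k * k + k * (k * k)) + n))"
    using run_complete[of X Y k "k * k" "k * k + (k * k + k * (k * k))" "16 * (k * (k * k))"] sol k True \<open>k \<le> n\<close>
    unfolding solution_def feasible_iff_cut by blast
  obtain j where "j < base k ^ len k" "g = digits (base k) (len k) j"
    using digits_surj[of g "base k" "len k"] g(1,2) True by (auto simp: base_def len_def)
  then show thesis using that g(3) True by (auto simp: accepted_def)
next
  case False
  have sol: "feasible (n - k) X" "feasible (n - k) Y" "\<forall>i<n * n. X i + Y i \<le> trunc i" using sol by (auto simp: solution_def)
  obtain z where z: "unit_flow z" "\<And>i. z i \<le> n" "\<And>i. z i \<le> (n - k) * X i" by (rule bounded_unit_flow[OF sol(1)]) blast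
  obtain z' where z': "unit_flow z'" "\<And>i. z' i \<le> n" "\<And>i. z' i \<le> (n - k) * Y i" by (rule bounded_unit_flow[OF sol(2)]) blast
  define g where "g i = (if i < n * n then z i else if i < n * n + n * n then z' (i - n * n) else 0)" for i
  have "unit_flow g" "unit_flow (\<lambda>i. g (n * n + i))"
    using z(1) z'(1) unit_flow_cong[of g z] unit_flow_cong[of "\<lambda>i. g (n * n + i)" z'] by (auto simp: g_def)
  moreover have "\<exists>x y. (\<forall>i<n * n. g i \<le> (n - k) * x i) \<and> (\<forall>i<n * n. g (n * n + i) \<le> (n - k) * y i) \<and>
      (\<forall>i<n * n. x i + y i \<le> trunc i)"
    by (rule exI[of _ X], rule exI[of _ Y]) (use z(3) z'(3) sol(3) in \<open>simp add: g_def\<close>)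
  moreover have "\<forall>i<n * n. g i \<le> n" "\<forall>i<n * n. g (n * n + i) \<le> n" using z(2) z'(2) by (simp_all add: g_def)
  ultimately have acc: "accepted k g" unfolding accepted_def if_not_P[OF False] by blast
  have "\<And>i. g i < n + 1" using z(2) z'(2) by (simp add: g_def less_Suc_eq_le)
  then obtain j where "j < base k ^ len k" "g = digits (base k) (len k) j"
    using digits_surj[of g "base k" "len k"] False by (auto simp: base_def len_def g_def)
  then show thesis using that acc by auto
qed

definition clean :: "memory \<Rightarrow> bool" where
  "clean s \<longleftrightarrow> (\<forall>i\<ge>n * n. s ''x'' i = 0 \<and> s ''y'' i = 0)"

lemma ev_TEST:
  assumes s: "ready k s" "clean s"
  defines "t \<equiv> ev (Cond (Var ''small'') SMALL LARGE) s"
  shows "accepted k (s ''g'') \<Longrightarrow> 0 < t ''ok'' 0" "0 < t ''ok'' 0 \<Longrightarrow> solution k (t ''x'') (t ''y'')" "clean t"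
proof -
  have gm: "graph_mem s" using s(1) by (simp add: ready_def)
  have n: "0 < n" using r_less by simp
  have "(accepted k (s ''g'') \<longrightarrow> 0 < t ''ok'' 0) \<and> (0 < t ''ok'' 0 \<longrightarrow> solution k (t ''x'') (t ''y'')) \<and> clean t"
  proof (cases "2 * k \<le> n + 1")
    case True
    then have kn: "k \<le> n" using n by linarith
    have v: "s ''small'' 0 = 0" "s ''k'' 0 = k" "s ''b0'' 0 = 16 * (k * (k * k))" "s ''t1'' 0 = k * k"
      "s ''t2'' 0 = k * k + (k * k + k * (k * k))" "s ''t3'' 0 = k * k + (k * k + k * (k * k)) + n"
      using s(1) True unfolding ready_def by simp_all
    have t: "t = ev LARGE s" unfolding t_def using v(1) by simp
    define R where "R = run k (16 * (k * (k * k))) (k * k) (k * k + (k * k + k * (k * k))) (s ''g'')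
      (k * k + (k * k + k * (k * k)) + n)"
    have large: "(t ''x'', t ''y'') = R" "0 < t ''ok'' 0 \<longleftrightarrow> accepting k R"
      using ev_LARGE[OF gm] s(2) unfolding t R_def clean_def v by blast+
    have acc: "accepted k (s ''g'') \<longleftrightarrow> accepting k R" unfolding accepted_def R_def using True by simp
    have "solution k (t ''x'') (t ''y'')" if "accepting k R"
      unfolding solution_def feasible_iff_cut
      using run_sound[of k _ _ _ _ _ "t ''x''" "t ''y''", OF large(1)[unfolded R_def, symmetric]] that large(1) kn True
      by simp
    moreover have "clean t"
      unfolding clean_def
    proof (intro allI impI)
      fix i assume "n * n \<le> i"
      then have "fst R i = 0 \<and> snd R i = 0" unfolding R_def by (rule run_outside)
      then show "t ''x'' i = 0 \<and> t ''y'' i = 0" unfolding large(1)[symmetric] by simp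
    qed
    ultimately show ?thesis using large(2) acc by blast
  next
    case False
    have v: "s ''small'' 0 \<noteq> 0" "s ''cap'' 0 = n - k" using s(1) False by (simp_all add: ready_def)
    have t: "t = ev SMALL s" unfolding t_def using v(1) by simp
    note small = ev_SMALL[OF gm, folded t, unfolded v(2)]
    have "clean t" using small(1) s(2) by (simp add: clean_def)
    moreover have "solution k (t ''x'') (t ''y'')" if "0 < t ''ok'' 0"
      using small(2)[OF that] unfolding solution_def feasible_def by (auto simp: lessThan_iff)
    moreover have "0 < t ''ok'' 0" if "accepted k (s ''g'')"
      using that False small(3) unfolding accepted_def by auto
    ultimately show ?thesis by blast
  qed
  then show "accepted k (s ''g'') \<Longrightarrow> 0 < t ''ok'' 0" "0 < t ''ok'' 0 \<Longrightarrow> solution k (t ''x'') (t ''y'')" "clean t"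
    by blast+
qed

lemma ev_BODY:
  assumes s: "ready k s" "clean s" "s ''g'' = digits (base k) (len k) j" "j < base k ^ len k" and k: "0 < k"
  defines "t \<equiv> ev BODY s"
  shows "ready k t" "clean t" "0 < t ''ok'' 0 \<Longrightarrow> solution k (t ''x'') (t ''y'') \<and> t ''act'' 0 = 0"
    "t ''ok'' 0 = 0 \<Longrightarrow> \<not> accepted k (digits (base k) (len k) j) \<and> t ''g'' = digits (base k) (len k) (Suc j) \<and>
      t ''act'' 0 = (if Suc j = base k ^ len k then 0 else s ''act'' 0)"
proof -
  let ?test = "Cond (Var ''small'') SMALL LARGE"
  let ?next = "INCR ;; Cond (Var ''a'') (Set ''act'' (Const 0)) Nop"
  define u where "u = ev ?test s"
  note test = ev_TEST[OF s(1,2), folded u_def]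
  have fu: "u x = s x" if "x \<notin> assigned ?test" for x unfolding u_def using that by (rule ev_frame)
  have ft: "t x = s x" if "x \<notin> assigned BODY" for x unfolding t_def using that by (rule ev_frame)
  have t: "t = (if 0 < u ''ok'' 0 then set_var ''act'' 0 u else ev ?next u)"
    unfolding t_def BODY_def u_def by (simp only: ev.simps(2-4) exp_val.simps) simp
  show "ready k t" by (rule ready_cong[OF s(1)], rule ft) auto
  have fn: "ev ?next u x = u x" if "x \<notin> {''a'', ''i'', ''g'', ''act''}" for x using that by (intro ev_frame) simp
  have xy: "t ''x'' = u ''x''" "t ''y'' = u ''y''" "t ''ok'' = u ''ok''" unfolding t by (simp_all add: fn del: ev.simps)
  show "clean t" using test(3) by (simp add: clean_def xy)
  show "0 < t ''ok'' 0 \<Longrightarrow> solution k (t ''x'') (t ''y'') \<and> t ''act'' 0 = 0"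
    using test(2) unfolding xy by (simp add: t)
  assume "t ''ok'' 0 = 0"
  then have ok: "u ''ok'' 0 = 0" unfolding xy .
  then have t': "t = ev ?next u" unfolding t by simp
  have "u ''L'' 0 = len k" "u ''bb'' 0 = base k"
    using s(1) by (simp_all add: fu ready_def len_def base_def split: if_splits)
  moreover have "0 < base k" using k by (simp add: base_def)
  moreover have "u ''g'' = digits (base k) (len k) j" using s(3) by (simp add: fu)
  ultimately have incr: "0 < ev INCR u ''a'' 0 \<longleftrightarrow> Suc j = base k ^ len k"
    "ev INCR u ''g'' = digits (base k) (len k) (Suc j)"
    using ev_INCR[of u "len k" "base k" j] s(4) by simp_all
  have "ev INCR u ''act'' = s ''act''" by (simp add: ev_frame fu)
  then have "t ''act'' 0 = (if Suc j = base k ^ len k then 0 else s ''act'' 0)" "t ''g'' = digits (base k) (len k) (Suc j)"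
    unfolding t' using incr by (simp_all del: ev.simps(5) split: if_splits) 
  moreover have "\<not> accepted k (digits (base k) (len k) j)" using test(1) ok s(3) by auto
  ultimately show "\<not> accepted k (digits (base k) (len k) j) \<and> t ''g'' = digits (base k) (len k) (Suc j) \<and>
      t ''act'' 0 = (if Suc j = base k ^ len k then 0 else s ''act'' 0)" by blast
qed

text \<open>By induction on the number of guesses not yet tried. A round costs the body and 3 for
  the guard; the final 3 is the failing guard.\<close>

lemma search_loop:
  assumes s: "ready k s" "clean s" "s ''g'' = digits (base k) (len k) j" "j < base k ^ len k" "s ''act'' 0 = 1"
    and k: "0 < k"
  defines "N \<equiv> 4 * n ^ 3"
  shows "\<exists>T s'. exec (While (Var ''act'') (compile BODY)) s T s' \<and>
    T \<le> (base k ^ len k - j) * (time_bound BODY N + 3) + 3 \<and> ready k s' \<and>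
    (0 < s' ''ok'' 0 \<longrightarrow> solution k (s' ''x'') (s' ''y'')) \<and>
    (s' ''ok'' 0 = 0 \<longrightarrow> (\<forall>i. j \<le> i \<longrightarrow> i < base k ^ len k \<longrightarrow> \<not> accepted k (digits (base k) (len k) i)))"
  using s
proof (induction "base k ^ len k - j" arbitrary: j s)
  case 0
  then show ?case by simp
next
  case (Suc l)
  let ?W = "While (Var ''act'') (compile BODY)"
  define t where "t = ev BODY s"
  have n: "0 < n" using r_less by simp
  have n2: "n * n \<le> n * (n * n)" "n \<le> n * n" using n by simp_all
  have N: "N = 4 * (n * (n * n))" by (simp add: N_def power3_eq_cube)
  have bounds: "s b 0 \<le> N" if "b \<in> loop_bounds BODY" for b
  proof -
    have "s ''L'' 0 \<le> N"
    proof (cases "2 * k \<le> n + 1")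
      case True
      then have "k \<le> n" using n by linarith
      then have "k * k \<le> n * n" by (intro mult_le_mono)
      moreover have "s ''L'' 0 = k * k + k * k" using True Suc.prems(1) by (simp add: ready_def)
      ultimately show ?thesis using n2 unfolding N by linarith
    next
      case False
      then have "s ''L'' 0 = n * n + n * n" using Suc.prems(1) by (simp add: ready_def)
      then show ?thesis using n2 unfolding N by linarith
    qed
    moreover have "s ''t3'' 0 \<le> N" "s ''n'' 0 \<le> N" "s ''m'' 0 \<le> N"
      using Suc.prems(1) n2 unfolding ready_def graph_mem_def N_def[symmetric] N by simp_all
    ultimately show ?thesis using that unfolding loop_bounds_BODY by auto
  qed
  have "loop_bounds BODY \<inter> assigned BODY = {}" unfolding loop_bounds_BODY by auto
  then obtain T1 where T1: "T1 \<le> time_bound BODY N" "exec (compile BODY) s T1 t"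
    using exec_compile[OF well_formed_BODY, of s N] bounds unfolding t_def by blast
  note body = ev_BODY[OF Suc.prems(1-4) k, folded t_def]
  have act: "exp_val (Var ''act'') s \<noteq> 0" using Suc.prems(5) by simp
  have step: "exec ?W s (3 + T1 + T2) s'" if "exec ?W t T2 s'" for T2 s'
    using exec.WhileTrue[OF act T1(2) that] by (simp add: numeral_eq_Suc)
  have stop: "exec ?W t 3 t" if "t ''act'' 0 = 0"
    using exec.WhileFalse[of "Var ''act''" t "compile BODY"] that by (simp add: numeral_eq_Suc)
  have pos: "base k ^ len k - j = Suc (base k ^ len k - Suc j)" using Suc.prems(4) by simp
  show ?case
  proof (cases "t ''act'' 0 = 0")
    case True
    have ex: "exec ?W s (3 + T1 + 3) t" by (rule step[OF stop[OF True]])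
    have le: "3 + T1 + 3 \<le> (base k ^ len k - j) * (time_bound BODY N + 3) + 3" unfolding pos using T1(1) by simp
    have none: "\<forall>i. j \<le> i \<longrightarrow> i < base k ^ len k \<longrightarrow> \<not> accepted k (digits (base k) (len k) i)" if "t ''ok'' 0 = 0"
    proof (intro allI impI)
      fix i assume i: "j \<le> i" "i < base k ^ len k"
      have "Suc j = base k ^ len k" using body(4)[OF that] True Suc.prems(5) by (simp split: if_splits)
      then have "i = j" using i by simp
      then show "\<not> accepted k (digits (base k) (len k) i)" using body(4)[OF that] by simp
    qed
    have sol: "0 < t ''ok'' 0 \<longrightarrow> solution k (t ''x'') (t ''y'')" using body(3) by blast
    show ?thesis
      by (rule exI[of _ "3 + T1 + 3"], rule exI[of _ t], rule conjI[OF ex], rule conjI[OF le],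
          rule conjI[OF body(1)], rule conjI[OF sol], rule impI, rule none)
  next
    case False
    then have ok: "t ''ok'' 0 = 0" using body(3) by (cases "t ''ok'' 0") auto
    note b4 = body(4)[OF ok]
    have "Suc j \<noteq> base k ^ len k" using b4 False by (auto split: if_splits)
    then have j: "Suc j < base k ^ len k" using Suc.prems(4) by simp
    have act_t: "t ''act'' 0 = 1" using b4 False Suc.prems(5) by (simp split: if_splits)
    have l: "l = base k ^ len k - Suc j" using Suc.hyps(2) by simp
    have g: "t ''g'' = digits (base k) (len k) (Suc j)" using b4 by (elim conjE)
    obtain T2 s' where IH: "exec ?W t T2 s'"
      "T2 \<le> (base k ^ len k - Suc j) * (time_bound BODY N + 3) + 3" "ready k s'"
      "0 < s' ''ok'' 0 \<longrightarrow> solution k (s' ''x'') (s' ''y'')"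
      "s' ''ok'' 0 = 0 \<longrightarrow> (\<forall>i. Suc j \<le> i \<longrightarrow> i < base k ^ len k \<longrightarrow> \<not> accepted k (digits (base k) (len k) i))"
      using Suc.hyps(1)[OF l body(1,2) g j act_t] by (elim exE conjE) rule
    have le: "3 + T1 + T2 \<le> (base k ^ len k - j) * (time_bound BODY N + 3) + 3" unfolding pos using T1(1) IH(2) by simp
    have none: "\<forall>i. j \<le> i \<longrightarrow> i < base k ^ len k \<longrightarrow> \<not> accepted k (digits (base k) (len k) i)" if "s' ''ok'' 0 = 0"
    proof (intro allI impI)
      fix i assume i: "j \<le> i" "i < base k ^ len k"
      show "\<not> accepted k (digits (base k) (len k) i)"
      proof (cases "i = j")
        case True
        then show ?thesis using b4 by simp
      next
        case False
        then have "Suc j \<le> i" using i by simp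
        then show ?thesis using IH(5)[rule_format, OF that] i by blast
      qed
    qed
    show ?thesis
      by (rule exI[of _ "3 + T1 + T2"], rule exI[of _ s'], rule conjI[OF step[OF IH(1)]], rule conjI[OF le],
          rule conjI[OF IH(3)], rule conjI[OF IH(4)], rule impI, rule none)
  qed
qed

text \<open>At least one guess exists, so the cost of the other blocks may be multiplied by the
  number of guesses. The 9 consists of 3 for the guard of a round, 3 for the last guard and 3 for
  setting \<open>act\<close>.\<close>

lemma exec_PROGRAM:
  fixes k
  assumes k: "0 < k"
  defines "N \<equiv> 4 * n ^ 3"
  shows "\<exists>T s. exec PROGRAM (initial_memory (encode_instance k n m r)) T s \<and>
    T \<le> base k ^ len k * (time_bound (READ ;; TABLES ;; SETUP ;; BODY ;; OUT) N + 9) \<and>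
    (\<exists>x y. solution k x y \<and> output_of s = 1 # encode_arcs (arc_copies n (\<lambda>_. 0) x) @ encode_arcs (arc_copies n x y) \<or>
      (\<nexists>x y. solution k x y) \<and> output_of s = [0])"
proof -
  define s0 where "s0 = initial_memory (encode_instance k n m r)"
  define s1 where "s1 = ev READ s0"
  define s2 where "s2 = ev TABLES s1"
  define s3 where "s3 = ev SETUP s2"
  define s4 where "s4 = set_var ''act'' 1 s3"
  have n: "0 < n" using r_less by simp
  have n2: "n * n \<le> n * (n * n)" "n \<le> n * n" using n by simp_all
  have N: "N = 4 * (n * (n * n))" by (simp add: N_def power3_eq_cube)
  note read = ev_READ[where k = k, folded s0_def, folded s1_def]
  have m1: "s1 ''m'' 0 = 0" by (simp add: read(8))
  note tab = ev_TABLES[OF read(2) m1 read(5) read(7), folded s2_def]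
  have kk2: "s2 ''kk'' 0 = min k n" unfolding s2_def by (simp add: ev_frame read(4))
  obtain T1 where T1: "T1 \<le> time_bound READ N" "exec (compile READ) s0 T1 s1"
    using exec_compile[OF well_formed_others(1), of s0 N] unfolding loop_bounds_others s1_def by auto
  obtain T2 where T2: "T2 \<le> time_bound TABLES N" "exec (compile TABLES) s1 T2 s2"
    using exec_compile[OF well_formed_others(2), of s1 N] read(2) n2 unfolding loop_bounds_others s2_def N by auto
  have "min k n \<le> N" "n * n \<le> N" using n2 unfolding N by linarith+
  then have "s2 b 0 \<le> N" if "b \<in> {''m'', ''kk''}" for b using that tab(1) kk2 by auto
  then obtain T3 where T3: "T3 \<le> time_bound SETUP N" "exec (compile SETUP) s2 T3 s3"
    using exec_compile[OF well_formed_others(3), of s2 N] unfolding loop_bounds_others s3_def by auto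
  have T4: "exec (Store ''act'' (Const 0) (Const 1)) s3 3 s4"
    using exec.Store[of "''act''" "Const 0" "Const 1" s3] by (simp add: s4_def numeral_eq_Suc)
  note prelude = ready_prelude[where k = k, folded s0_def, folded s1_def, folded s2_def, folded s3_def]
  have r4: "ready k s4" by (rule ready_cong[OF prelude(1)]) (auto simp: s4_def)
  have c4: "clean s4" by (simp add: clean_def s4_def prelude)
  have g4: "s4 ''g'' = digits (base k) (len k) 0" by (simp add: s4_def prelude digits_def fun_eq_iff)
  have pos: "0 < base k ^ len k" using k by (simp add: base_def)
  have a4: "s4 ''act'' 0 = 1" by (simp add: s4_def)
  obtain T5 s5 where s5: "exec (While (Var ''act'') (compile BODY)) s4 T5 s5"
    "T5 \<le> base k ^ len k * (time_bound BODY N + 3) + 3" "ready k s5"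
    "0 < s5 ''ok'' 0 \<longrightarrow> solution k (s5 ''x'') (s5 ''y'')"
    "s5 ''ok'' 0 = 0 \<longrightarrow> (\<forall>i. i < base k ^ len k \<longrightarrow> \<not> accepted k (digits (base k) (len k) i))"
    using search_loop[OF r4 c4 g4 pos a4 k] unfolding N_def by auto
  have gm5: "graph_mem s5" and M5: "s5 ''M'' 0 = n + n" using s5(3) by (simp_all add: ready_def)
  then have m5: "s5 ''m'' 0 = n * n" "\<And>i. i < n * n \<Longrightarrow> s5 ''T'' i = i div n" "\<And>i. i < n * n \<Longrightarrow> s5 ''H'' i = i mod n"
    by (simp_all add: graph_mem_def)
  define s6 where "s6 = ev OUT s5"
  have "n + n \<le> N" "n * n \<le> N" using n2 unfolding N by linarith+
  then have "s5 b 0 \<le> N" if "b \<in> {''m'', ''M''}" for b using that m5(1) M5 by auto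
  then obtain T6 where T6: "T6 \<le> time_bound OUT N" "exec (compile OUT) s5 T6 s6"
    using exec_compile[OF well_formed_others(4), of s5 N] unfolding loop_bounds_others s6_def by auto
  have "exec PROGRAM s0 (T1 + (T2 + (T3 + (3 + (T5 + T6))))) s6"
    unfolding PROGRAM_def by (intro exec.Seq[OF T1(2)] exec.Seq[OF T2(2)] exec.Seq[OF T3(2)] exec.Seq[OF T4] exec.Seq[OF s5(1)] T6(2))
  moreover have "T1 + (T2 + (T3 + (3 + (T5 + T6)))) \<le> base k ^ len k * (time_bound (READ ;; TABLES ;; SETUP ;; BODY ;; OUT) N + 9)"
  proof -
    have le: "c \<le> base k ^ len k * c" for c using mult_le_mono1[OF Suc_leI[OF pos], of c] by simp
    have "T1 + (T2 + (T3 + (3 + (T5 + T6)))) \<le> (time_bound READ N + time_bound TABLES N + time_bound SETUP N + time_bound OUT N + 6)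
        + base k ^ len k * (time_bound BODY N + 3)"
      using T1(1) T2(1) T3(1) s5(2) T6(1) by linarith
    also have "\<dots> \<le> base k ^ len k * (time_bound READ N + time_bound TABLES N + time_bound SETUP N + time_bound OUT N + 6)
        + base k ^ len k * (time_bound BODY N + 3)" by (rule add_right_mono[OF le])
    also have "\<dots> = base k ^ len k * (time_bound (READ ;; TABLES ;; SETUP ;; BODY ;; OUT) N + 9)"
      unfolding time_bound.simps by (simp only: add_mult_distrib2[symmetric]) (simp add: algebra_simps)
    finally show ?thesis .
  qed
  moreover have "\<exists>x y. solution k x y \<and> output_of s6 = 1 # encode_arcs (arc_copies n (\<lambda>_. 0) x) @ encode_arcs (arc_copies n x y) \<or>
      (\<nexists>x y. solution k x y) \<and> output_of s6 = [0]"
  proof (cases "0 < s5 ''ok'' 0")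
    case True
    then have sol: "solution k (s5 ''x'') (s5 ''y'')" using s5(4) by blast
    have "s5 ''x'' i \<le> s5 ''M'' 0 \<and> s5 ''y'' i \<le> s5 ''M'' 0" if "i < n * n" for i
    proof -
      have "s5 ''x'' i + s5 ''y'' i \<le> n + n" using sol that by (auto simp: solution_def trunc_def)
      then show ?thesis using M5 by simp
    qed
    then have "output_of s6 = 1 # encode_arcs (arc_copies n (\<lambda>_. 0) (s5 ''x'')) @ encode_arcs (arc_copies n (s5 ''x'') (s5 ''y''))"
      unfolding s6_def using ev_OUT[OF m5] True by simp
    then show ?thesis using sol by blast
  next
    case False
    then have "output_of s6 = [0]" unfolding s6_def using ev_OUT[OF m5] by simp
    moreover have "\<not> solution k x y" for x y
    proof
      assume "solution k x y"
      then obtain j where "j < base k ^ len k" "accepted k (digits (base k) (len k) j)" by (rule accepted_exists[OF k])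
      then show False using s5(5) False by auto
    qed
    ultimately show ?thesis by blast
  qed
  ultimately show ?thesis unfolding s0_def by blast
qed

end

text \<open>Outside the main case \<open>n\<close> is at most \<open>2 k\<close>, so
  \<open>n * n + n * n\<close> digits of base \<open>n + 1\<close> are bounded in terms of
  \<open>k\<close> as well. This case causes the exponent \<open>8 k^2\<close>; the main case needs
  only \<open>2 k^2\<close> digits.\<close>

lemma (in rooted_multi_digraph) base_len_le:
  assumes k: "0 < k"
  shows "base k ^ len k \<le> (16 * k ^ 4) ^ (8 * k\<^sup>2)"
proof -
  have k4: "k \<le> k ^ 4" using k by (simp add: self_le_power)
  have "base k \<le> 16 * k ^ 4 \<and> len k \<le> 8 * k\<^sup>2"
  proof (cases "2 * k \<le> n + 1")
    case True
    have "k ^ 4 = k * (k * (k * k))" using power_add[of k 2 2] by (simp add: power2_eq_square mult.assoc)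
    then have "k * (16 * (k * (k * k))) = 16 * k ^ 4" by (simp only: mult.left_commute)
    then show ?thesis using True by (simp add: base_def len_def power2_eq_square)
  next
    case False
    then have "n \<le> 2 * k" "n + 1 \<le> 16 * k ^ 4" using k4 by linarith+
    moreover from this have "n * n \<le> (2 * k) * (2 * k)" by (intro mult_le_mono)
    ultimately show ?thesis using False by (simp add: base_def len_def power2_eq_square)
  qed
  moreover have "1 \<le> 16 * k ^ 4" using k by simp
  ultimately have "base k ^ len k \<le> (16 * k ^ 4) ^ len k" "(16 * k ^ 4) ^ len k \<le> (16 * k ^ 4) ^ (8 * k\<^sup>2)"
    by (metis power_mono le0, metis power_increasing)
  then show ?thesis by (rule le_trans)
qed

definition correct_output :: "nat \<Rightarrow> nat \<Rightarrow> (nat \<Rightarrow> nat \<Rightarrow> nat) \<Rightarrow> nat \<Rightarrow> nat list \<Rightarrow> bool" where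
  "correct_output k n m r out \<longleftrightarrow>
    (if \<exists>X Y. disjoint_spanning_flow_branchings (multi_digraph n m) r k X Y
     then \<exists>as bs. distinct as \<and> distinct bs \<and>
       disjoint_spanning_flow_branchings (multi_digraph n m) r k
         ((multi_digraph n m)\<lparr>arcs := set as\<rparr>) ((multi_digraph n m)\<lparr>arcs := set bs\<rparr>) \<and>
       out = 1 # encode_arcs as @ encode_arcs bs
     else out = [0])"

lemma PROGRAM_correct:
  obtains C c :: nat where "0 < C" and "\<And>(k :: nat) n m r. 0 < k \<Longrightarrow> rooted_digraph (multi_digraph n m) r \<Longrightarrow>
    \<exists>t out. runs PROGRAM (encode_instance k n m r) t out \<and> t \<le> C * (16 * k ^ 4) ^ (8 * k\<^sup>2) * n ^ c \<and>
      correct_output k n m r out"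
proof -
  let ?Q = "READ ;; TABLES ;; SETUP ;; BODY ;; OUT"
  obtain C e where poly: "\<And>N. time_bound ?Q N \<le> C * (N + 1) ^ e" using time_bound_poly by blast
  have bound: "time_bound ?Q (4 * n ^ 3) + 9 \<le> (C + 9) * 5 ^ e * n ^ (3 * e)" if n: "0 < n" for n
  proof -
    have "1 \<le> n ^ 3" using n by simp
    then have "4 * n ^ 3 + 1 \<le> 5 * n ^ 3" by linarith
    then have "(4 * n ^ 3 + 1) ^ e \<le> (5 * n ^ 3) ^ e" by (rule power_mono) simp
    also have "\<dots> = 5 ^ e * n ^ (3 * e)" by (simp add: power_mult_distrib power_mult)
    finally have le: "(4 * n ^ 3 + 1) ^ e \<le> 5 ^ e * n ^ (3 * e)" .
    have "1 \<le> 5 ^ e * n ^ (3 * e)" using n by simp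
    then have "9 \<le> 9 * (5 ^ e * n ^ (3 * e))" by linarith
    moreover have "time_bound ?Q (4 * n ^ 3) \<le> C * (5 ^ e * n ^ (3 * e))"
      using poly[of "4 * n ^ 3"] mult_le_mono2[OF le, of C] by (rule le_trans)
    ultimately show ?thesis unfolding mult.assoc add_mult_distrib by linarith
  qed
  show thesis
  proof (rule that[of "(C + 9) * 5 ^ e" "3 * e"])
    fix k n :: nat and m r
    assume k: "0 < k" and rooted: "rooted_digraph (multi_digraph n m) r"
    interpret rooted_multi_digraph n m r by (rule rooted_multi_digraph.intro[OF rooted])
    let ?ex = "\<exists>X Y. disjoint_spanning_flow_branchings (multi_digraph n m) r k X Y"
    have n: "0 < n" using r_less by simp
    obtain T s where s: "exec PROGRAM (initial_memory (encode_instance k n m r)) T s"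
      "T \<le> base k ^ len k * (time_bound ?Q (4 * n ^ 3) + 9)"
      "\<exists>x y. solution k x y \<and> output_of s = 1 # encode_arcs (arc_copies n (\<lambda>_. 0) x) @ encode_arcs (arc_copies n x y) \<or>
        (\<nexists>x y. solution k x y) \<and> output_of s = [0]"
      using exec_PROGRAM[OF k] by blast
    have sol: "disjoint_spanning_flow_branchings (multi_digraph n m) r k
        ((multi_digraph n m)\<lparr>arcs := set (arc_copies n (\<lambda>_. 0) x)\<rparr>) ((multi_digraph n m)\<lparr>arcs := set (arc_copies n x y)\<rparr>)"
      if "solution k x y" for x y
      using that by (intro feasible_disjoint_branchings) (auto simp: solution_def trunc_def)
    have runs: "runs PROGRAM (encode_instance k n m r) T (output_of s)" using s(1) by (auto simp: runs_def)
    have time: "T \<le> (C + 9) * 5 ^ e * (16 * k ^ 4) ^ (8 * k\<^sup>2) * n ^ (3 * e)"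
    proof -
      have "T \<le> (16 * k ^ 4) ^ (8 * k\<^sup>2) * ((C + 9) * 5 ^ e * n ^ (3 * e))"
        using s(2) mult_le_mono[OF base_len_le[OF k] bound[OF n]] by (rule le_trans)
      then show ?thesis by (simp only: mult_ac)
    qed
    have "correct_output k n m r (output_of s)"
    proof (cases ?ex)
      case True
      then obtain x0 y0 where "solution k x0 y0" using solution_exists by metis
      then obtain x y where xy: "solution k x y"
        "output_of s = 1 # encode_arcs (arc_copies n (\<lambda>_. 0) x) @ encode_arcs (arc_copies n x y)"
        using s(3) by blast
      then show ?thesis
        unfolding correct_output_def if_P[OF True] using distinct_arc_copies sol[OF xy(1)] by blast
    next
      case False
      then have "\<not> solution k x y" for x y using sol by blast
      then have "output_of s = [0]" using s(3) by blast
      then show ?thesis unfolding correct_output_def if_not_P[OF False] .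
    qed
    with runs time show "\<exists>t out. runs PROGRAM (encode_instance k n m r) t out \<and>
      t \<le> (C + 9) * 5 ^ e * (16 * k ^ 4) ^ (8 * k\<^sup>2) * n ^ (3 * e) \<and> correct_output k n m r out"
      by blast
  qed simp
qed

text \<open>Setting the length cell to 1 cuts the output down to its first entry, the
  answer.\<close>

lemma runs_decide:
  assumes "runs p xs t out" "out \<noteq> []"
  shows "runs (Seq p (Store ''out'' (Const 0) (Const 1))) xs (t + 3) [hd out]"
proof -
  obtain s where s: "exec p (initial_memory xs) t s" "output_of s = out" using assms(1) by (auto simp: runs_def)
  have len: "0 < s ''out'' 0" using s(2) assms(2) by (auto simp: output_of_def)
  have "exec (Store ''out'' (Const 0) (Const 1)) s 3 (set_var ''out'' 1 s)"
    using exec.Store[of "''out''" "Const 0" "Const 1" s] by (simp add: numeral_eq_Suc)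
  with s(1) have "exec (Seq p (Store ''out'' (Const 0) (Const 1))) (initial_memory xs) (t + 3) (set_var ''out'' 1 s)"
    by (rule exec.Seq)
  moreover have "output_of (set_var ''out'' 1 s) = [hd out]"
    using len unfolding s(2)[symmetric] by (simp add: output_of_def hd_map)
  ultimately show ?thesis unfolding runs_def by blast
qed

section \<open>A computable parameter function\<close>

primrec repeat :: "nat \<Rightarrow> prg \<Rightarrow> prg" where
  "repeat 0 c = Nop"
| "repeat (Suc l) c = c ;; repeat l c"

lemma For_mult:
  assumes "\<And>j t. (\<And>x. x \<noteq> i \<Longrightarrow> x \<notin> assigned c \<Longrightarrow> t x = s x) \<Longrightarrow> ev c (set_var i j t) x 0 = t x 0 * q"
    and "x \<noteq> i"
  shows "ev (For i b c) s x 0 = s x 0 * q ^ s b 0"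
proof -
  obtain t where t: "t x 0 = s x 0 * q ^ s b 0" "ev (For i b c) s = set_var i (s b 0) t"
  proof (rule For_rule[where I = "\<lambda>j t. t x 0 = s x 0 * q ^ j" and s = s and i = i and b = b and c = c])
    fix j t
    assume I: "t x 0 = s x 0 * q ^ j" and fr: "\<And>x. x \<noteq> i \<Longrightarrow> x \<notin> assigned c \<Longrightarrow> t x = s x"
    have "ev c (set_var i j t) x 0 = t x 0 * q" using fr by (rule assms(1))
    then show "ev c (set_var i j t) x 0 = s x 0 * q ^ Suc j" using I by simp
  qed auto
  then show ?thesis using assms(2) by simp
qed

text \<open>Three nested loops of \<open>x + 1\<close> rounds each around \<open>E\<close>
  doublings; the cube in the exponent is chosen because it needs no multiplication.\<close>

lemma computable_exponential: "computable_fun (\<lambda>x. 2 ^ (E * (x + 1) ^ 3))"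
proof -
  let ?D = "repeat E (DOUBLE ''y'')"
  let ?L1 = "For ''l'' ''b'' ?D" and ?L2 = "For ''j'' ''b'' (For ''l'' ''b'' ?D)"
  let ?pre = "Set ''b'' (Plus (Cell ''in'' (Const 1)) (Const 1)) ;; Set ''y'' (Const 1)"
  let ?post = "Assign ''out'' (Const 1) (Var ''y'') ;; Set ''out'' (Const 1)"
  let ?loop = "For ''i'' ''b'' ?L2 ;; ?post"
  have as: "assigned (repeat l (DOUBLE ''y'')) \<subseteq> {''y''}" and lb: "loop_bounds (repeat l (DOUBLE ''y'')) = {}"
    and wf: "well_formed (repeat l (DOUBLE ''y''))"
    and D: "ev (repeat l (DOUBLE ''y'')) s ''y'' 0 = s ''y'' 0 * 2 ^ l" for l s
    by (induction l arbitrary: s) (auto simp: DOUBLE_def)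
  have b: "''b'' \<notin> assigned ?D" "''i'' \<notin> assigned ?D" "''j'' \<notin> assigned ?D" "''l'' \<notin> assigned ?D" using as[of E] by auto
  have L1: "ev ?L1 s ''y'' 0 = s ''y'' 0 * (2 ^ E) ^ s ''b'' 0" for s
    by (rule For_mult) (simp_all add: D del: ev.simps)
  have L2: "ev ?L2 s ''y'' 0 = s ''y'' 0 * ((2 ^ E) ^ s ''b'' 0) ^ s ''b'' 0" for s
    by (rule For_mult) (simp_all only: L1, use b in simp_all)
  have L3: "ev (For ''i'' ''b'' ?L2) s ''y'' 0 = s ''y'' 0 * (((2 ^ E) ^ s ''b'' 0) ^ s ''b'' 0) ^ s ''b'' 0" for s
    by (rule For_mult) (simp_all only: L2, use b in simp_all)
  have "\<exists>t. runs (Seq (compile ?pre) (compile ?loop)) [x] t [2 ^ (E * (x + 1) ^ 3)]" for x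
  proof -
    define s1 where "s1 = ev ?pre (initial_memory [x])"
    have s1: "s1 ''b'' 0 = x + 1" "s1 ''y'' 0 = 1" unfolding s1_def by (simp_all add: initial_memory_def)
    obtain t1 where t1: "exec (compile ?pre) (initial_memory [x]) t1 s1"
      using exec_compile[of ?pre "initial_memory [x]" 0] unfolding s1_def by auto
    have bounds: "s1 c 0 \<le> x + 1" if "c \<in> loop_bounds ?loop" for c using that s1 by (simp add: lb)
    have "well_formed ?loop" using b wf by simp
    moreover have "loop_bounds ?loop \<inter> assigned ?loop = {}" using b by (simp add: lb)
    ultimately obtain t2 where t2: "exec (compile ?loop) s1 t2 (ev ?loop s1)"
      using exec_compile[of ?loop s1 "x + 1"] bounds by blast
    have "ev (For ''i'' ''b'' ?L2) s1 ''y'' 0 = 2 ^ (E * (x + 1) ^ 3)"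
      unfolding L3 s1 by (simp only: power_mult[symmetric] mult_1 power3_eq_cube mult.assoc)
    then have "output_of (ev ?loop s1) = [2 ^ (E * (x + 1) ^ 3)]"
      unfolding output_of_def ev.simps(3) by (simp only: ev.simps(2,3) exp_val.simps) simp
    then show ?thesis unfolding runs_def using exec.Seq[OF t1 t2] by blast
  qed
  then show ?thesis unfolding computable_fun_def by blast
qed

text \<open>A crude bound of the form that \<open>computable_exponential\<close> provides:
  \<open>k < 2 ^ k\<close> replaces the logarithm in the exponent by \<open>k\<close>.\<close>

lemma bound_le_exponential:
  assumes "0 < k"
  shows "(16 * k ^ 4) ^ (8 * k\<^sup>2) \<le> 2 ^ (32 * (k + 1) ^ 3)"
proof -
  have "16 * k ^ 4 \<le> 2 ^ 4 * (2 ^ k) ^ 4"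
    using less_exp[of k] by (intro mult_le_mono power_mono) auto
  also have "\<dots> = (2 :: nat) ^ (4 * (k + 1))" by (simp add: power_add power_mult[symmetric] mult.commute)
  finally have "(16 * k ^ 4) ^ (8 * k\<^sup>2) \<le> (2 ^ (4 * (k + 1))) ^ (8 * k\<^sup>2)" by (rule power_mono) simp
  also have "\<dots> = 2 ^ (4 * (k + 1) * (8 * k\<^sup>2))" by (rule power_mult[symmetric])
  also have "\<dots> \<le> 2 ^ (32 * (k + 1) ^ 3)"
  proof (rule power_increasing)
    show "4 * (k + 1) * (8 * k\<^sup>2) \<le> 32 * (k + 1) ^ 3"
      by (simp add: power2_eq_square power3_eq_cube algebra_simps)
  qed simp
  finally show ?thesis .
qed

text \<open>Outside the matrix \<open>m\<close> is arbitrary, so an encoding determines the digraph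
  but not \<open>m\<close>. That is enough to make membership in \<open>yes_instances\<close>
  independent of the representation.\<close>

lemma encode_instance_eq_iff:
  "encode_instance k n m r = encode_instance k' n' m' r' \<Longrightarrow>
    k = k' \<and> n = n' \<and> r = r' \<and> multi_digraph n m = multi_digraph n' m'"
proof -
  assume eq: "encode_instance k n m r = encode_instance k' n' m' r'"
  then have kn: "k = k'" "n = n'" "r = r'" by (simp_all add: encode_instance_def)
  have flat: "\<forall>i<n * n. m (i div n) (i mod n) = m' (i div n) (i mod n)"
    using eq unfolding encode_instance_flat kn by simp
  have "m u v = m' u v" if "u < n" "v < n" for u v
  proof -
    have "(u * n + v) div n = u" "(u * n + v) mod n = v" using that by simp_all
    then show ?thesis using flat[rule_format, OF arc_index_less[OF that]] by simp
  qed
  then show ?thesis using kn by (auto simp: multi_digraph_def)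
qed

lemma input_size_ge: "0 < n \<Longrightarrow> n \<le> input_size (encode_instance k n m r)"
proof -
  assume n: "0 < n"
  have "length xs \<le> input_size xs" for xs by (induction xs) (simp_all add: input_size_def)
  from this[of "encode_instance k n m r"] have "n * n \<le> input_size (encode_instance k n m r)"
    unfolding encode_instance_flat by simp
  moreover have "n \<le> n * n" using n by simp
  ultimately show ?thesis by (rule le_trans[rotated])
qed

theorem theorem10:
  shows "(\<exists>(p :: com) (f :: nat \<Rightarrow> real) (c :: nat).
      f \<in> O(\<lambda>k. real k ^ 2 * log 2 (real k)) \<and>
      (\<forall>k n m r. k > 0 \<longrightarrow> rooted_digraph (multi_digraph n m) r \<longrightarrow>
        (\<exists>t out. runs p (encode_instance k n m r) t out \<and>
          real t \<le> 2 powr f k * real n ^ c \<and>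
          (if \<exists>X Y. disjoint_spanning_flow_branchings (multi_digraph n m) r k X Y
           then \<exists>as bs. distinct as \<and> distinct bs \<and>
                  disjoint_spanning_flow_branchings (multi_digraph n m) r k
                    ((multi_digraph n m)\<lparr>arcs := set as\<rparr>)
                    ((multi_digraph n m)\<lparr>arcs := set bs\<rparr>) \<and>
                  out = 1 # encode_arcs as @ encode_arcs bs
           else out = [0]))))
    \<and> fixed_parameter_tractable instances parameter yes_instances"
  unfolding correct_output_def[symmetric]
proof
  obtain C c :: nat where C: "0 < C" and correct: "\<And>(k :: nat) n m r. 0 < k \<Longrightarrow> rooted_digraph (multi_digraph n m) r \<Longrightarrow>
    \<exists>t out. runs PROGRAM (encode_instance k n m r) t out \<and> t \<le> C * (16 * k ^ 4) ^ (8 * k\<^sup>2) * n ^ c \<and>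
      correct_output k n m r out"
    by (rule PROGRAM_correct) blast
  \<comment> \<open>The base-2 logarithm of \<open>C * (16 * k ^ 4) ^ (8 * k ^ 2)\<close>, with
    \<open>log 2 16 = 4\<close>.\<close>
  define f where "f k = log 2 (real C) + 8 * real k ^ 2 * (4 + 4 * log 2 (real k))" for k
  have pow: "2 powr f k = real C * (16 * real k ^ 4) ^ (8 * k\<^sup>2)" if "0 < k" for k
  proof -
    have "f k = log 2 (real C) + real (8 * k\<^sup>2) * log 2 (16 * real k ^ 4)"
    proof -
      have "log 2 (16 :: real) = log 2 (2 ^ 4)" by simp
      also have "\<dots> = 4" by (subst log_nat_power) simp_all
      finally show ?thesis using that by (simp add: f_def log_mult log_nat_power)
    qed
    also have "\<dots> = log 2 (real C) + log 2 ((16 * real k ^ 4) ^ (8 * k\<^sup>2))"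
      using that by (subst log_nat_power) simp_all
    also have "\<dots> = log 2 (real C * (16 * real k ^ 4) ^ (8 * k\<^sup>2))"
      using that C by (subst log_mult) simp_all
    finally show ?thesis using that C by simp
  qed
  have "f \<in> O(\<lambda>k. real k ^ 2 * log 2 (real k))"
  proof (rule bigoI)
    show "eventually (\<lambda>k. norm (f k) \<le> (\<bar>log 2 (real C)\<bar> + 64) * norm (real k ^ 2 * log 2 (real k))) at_top"
      using eventually_ge_at_top[of "2 :: nat"]
    proof eventually_elim
      fix k :: nat assume k: "2 \<le> k"
      \<comment> \<open>From \<open>k = 2\<close> on the logarithm is at least 1 and absorbs the
        lower-order terms; at \<open>k = 1\<close> the bounding function vanishes.\<close>
      then have L: "1 \<le> log 2 (real k)" by (simp add: le_log_iff)
      have K: "1 \<le> real k ^ 2" using k by simp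
      define P where "P = real k ^ 2 * log 2 (real k)"
      have KP: "real k ^ 2 \<le> P" unfolding P_def using mult_left_mono[OF L, of "real k ^ 2"] by simp
      then have P: "1 \<le> P" using K by linarith
      have "norm (f k) \<le> \<bar>log 2 (real C)\<bar> + \<bar>8 * real k ^ 2 * (4 + 4 * log 2 (real k))\<bar>"
        unfolding f_def by simp
      also have "8 * real k ^ 2 * (4 + 4 * log 2 (real k)) = 32 * real k ^ 2 + 32 * P"
        by (simp add: P_def algebra_simps)
      also have "\<bar>32 * real k ^ 2 + 32 * P\<bar> \<le> 64 * P" using KP P by simp
      also have "\<bar>log 2 (real C)\<bar> \<le> \<bar>log 2 (real C)\<bar> * P" using P mult_left_mono[OF P, of "\<bar>log 2 (real C)\<bar>"] by simp
      finally have "norm (f k) \<le> (\<bar>log 2 (real C)\<bar> + 64) * P" by (simp add: algebra_simps)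
      moreover have "norm P = P" using P by simp
      ultimately show "norm (f k) \<le> (\<bar>log 2 (real C)\<bar> + 64) * norm (real k ^ 2 * log 2 (real k))"
        unfolding P_def by simp
    qed
  qed
  moreover have "\<exists>t out. runs PROGRAM (encode_instance k n m r) t out \<and> real t \<le> 2 powr f k * real n ^ c \<and>
      correct_output k n m r out"
    if kr: "0 < k" "rooted_digraph (multi_digraph n m) r" for k n m r
  proof -
    obtain t out where t: "runs PROGRAM (encode_instance k n m r) t out"
      "t \<le> C * (16 * k ^ 4) ^ (8 * k\<^sup>2) * n ^ c" "correct_output k n m r out"
      using correct[OF kr] by (elim exE conjE) rule
    have "real t \<le> real (C * (16 * k ^ 4) ^ (8 * k\<^sup>2) * n ^ c)" using t(2) by (rule of_nat_mono)
    then have "real t \<le> 2 powr f k * real n ^ c" unfolding pow[OF kr(1)] by simp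
    then show ?thesis using t(1,3) by blast
  qed
  ultimately show "\<exists>(p :: com) (f :: nat \<Rightarrow> real) (c :: nat).
      f \<in> O(\<lambda>k. real k ^ 2 * log 2 (real k)) \<and>
      (\<forall>k n m r. k > 0 \<longrightarrow> rooted_digraph (multi_digraph n m) r \<longrightarrow>
        (\<exists>t out. runs p (encode_instance k n m r) t out \<and> real t \<le> 2 powr f k * real n ^ c \<and>
          correct_output k n m r out))"
    by (intro exI[of _ PROGRAM] exI[of _ f] exI[of _ c]) simp
  \<comment> \<open>32 comes from \<open>bound_le_exponential\<close>. The factor
    \<open>C + 3\<close>, whose 3 pays for the final \<open>Store\<close>, is absorbed through
    \<open>C + 3 \<le> 2 ^ (C + 3)\<close>.\<close>
  define E where "E = C + 35"
  have "\<forall>xs \<in> instances. \<exists>t. runs (Seq PROGRAM (Store ''out'' (Const 0) (Const 1))) xs t [if xs \<in> yes_instances then 1 else 0] \<and>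
    t \<le> 2 ^ (E * (parameter xs + 1) ^ 3) * input_size xs ^ c"
  proof
    fix xs assume "xs \<in> instances"
    then obtain k n m r where xs: "xs = encode_instance k n m r" and k: "0 < k"
      and rooted: "rooted_digraph (multi_digraph n m) r" by (auto simp: instances_def)
    let ?ex = "\<exists>X Y. disjoint_spanning_flow_branchings (multi_digraph n m) r k X Y"
    have yes: "xs \<in> yes_instances \<longleftrightarrow> ?ex"
    proof
      assume "xs \<in> yes_instances"
      then obtain k' n' m' r' where eq: "xs = encode_instance k' n' m' r'"
        and ex: "\<exists>X Y. disjoint_spanning_flow_branchings (multi_digraph n' m') r' k' X Y"
        unfolding yes_instances_def by blast
      note same = encode_instance_eq_iff[OF eq[unfolded xs]]
      have "k = k'" "r = r'" "multi_digraph n m = multi_digraph n' m'" using same by blast+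
      with ex show ?ex by (simp only:)
    next
      assume ?ex
      then show "xs \<in> yes_instances" unfolding yes_instances_def using xs k rooted by blast
    qed
    obtain t out where t: "runs PROGRAM xs t out" "t \<le> C * (16 * k ^ 4) ^ (8 * k\<^sup>2) * n ^ c"
      and out: "correct_output k n m r out"
      using correct[OF k rooted, folded xs] by (elim exE conjE) rule
    have hd: "out \<noteq> []" "hd out = (if xs \<in> yes_instances then 1 else 0)"
      using out unfolding yes correct_output_def by (auto split: if_splits)
    have n: "0 < n" using rooted_multi_digraph.r_less[OF rooted_multi_digraph.intro[OF rooted]] by simp
    have "t + 3 \<le> 2 ^ (E * (parameter xs + 1) ^ 3) * input_size xs ^ c"
    proof -
      let ?S = "2 ^ (32 * (k + 1) ^ 3) :: nat"
      have "t \<le> C * ?S * n ^ c"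
        by (rule le_trans[OF t(2)]) (intro mult_le_mono bound_le_exponential[OF k] order_refl)
      then have "t \<le> C * (?S * n ^ c)" by (simp only: mult.assoc)
      moreover have "1 \<le> ?S * n ^ c" using n by simp
      ultimately have "t + 3 \<le> (C + 3) * (?S * n ^ c)" unfolding add_mult_distrib by linarith
      also have "\<dots> \<le> 2 ^ ((C + 3) * (k + 1) ^ 3) * (?S * input_size xs ^ c)"
      proof (intro mult_le_mono)
        have "C + 3 \<le> 2 ^ (C + 3)" using less_exp[of "C + 3"] by simp
        also have "\<dots> \<le> 2 ^ ((C + 3) * (k + 1) ^ 3)" by (rule power_increasing) simp_all
        finally show "C + 3 \<le> 2 ^ ((C + 3) * (k + 1) ^ 3)" .
        show "n ^ c \<le> input_size xs ^ c" unfolding xs by (intro power_mono input_size_ge[OF n]) simp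
      qed simp
      also have "\<dots> = 2 ^ (E * (k + 1) ^ 3) * input_size xs ^ c"
        by (simp add: E_def power_add[symmetric] algebra_simps)
      also have "k = parameter xs" by (simp add: parameter_def xs encode_instance_def)
      finally show ?thesis .
    qed
    then show "\<exists>t. runs (Seq PROGRAM (Store ''out'' (Const 0) (Const 1))) xs t [if xs \<in> yes_instances then 1 else 0] \<and>
        t \<le> 2 ^ (E * (parameter xs + 1) ^ 3) * input_size xs ^ c"
      using runs_decide[OF t(1) hd(1)] unfolding hd(2) by blast
  qed
  then show "fixed_parameter_tractable instances parameter yes_instances"
    unfolding fixed_parameter_tractable_def
    by (intro exI[of _ "Seq PROGRAM (Store ''out'' (Const 0) (Const 1))"] exI[of _ "\<lambda>x. 2 ^ (E * (x + 1) ^ 3)"]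
        exI[of _ c] conjI computable_exponential)
qed

end
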